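(* Let $\lambda>0$ and, for each $N\in\mathbb{N}$, let $(\delta_N^{(k)})_{k\ge 0}$ be the $\delta$-chain of the centered Gibbs sampler at discretization level $N$ (defined in the context). Suppose that the discrete-level assumptions (A1) and (A2) of the context hold. Then, in the limit $N\to\infty$, almost surely with respect to the data $\boldsymbol{y}$, and where all expectations and variances are taken with respect to the randomness in the algorithm (with the data fixed): (i) for any $\delta>0$, $$\frac{N}{2}\,\mathbb{E}\left[\delta_N^{(k+1)}-\delta_N^{(k)}\,\middle|\,\delta_N^{(k)}=\delta\right]=(\alpha_0+1)\delta-f_N(\delta;y)\,\delta^2+\mathcal{O}(N^{-\frac12}),$$ where $f_N(\delta;y)$ (defined in the context) is bounded uniformly in $N$. In particular, if there exists $f(\delta;\boldsymbol{y})\in\mathbb{R}$ such that $f_N(\delta;y)\to f(\delta;\boldsymbol{y})$ as $N\to\infty$, then $$\frac{N}{2}\,\mathbb{E}\left[\delta_N^{(k+1)}-\delta_N^{(k)}\,\middle|\,\delta_N^{(k)}=\delta\right]=(\alpha_0+1)\delta-f(\delta;\boldsymbol{y})\,\delta^2+o(1);$$ (ii) for any $\delta>0$, $$\frac{N}{2}\,\mathrm{Var}\left[\delta_N^{(k+1)}-\delta_N^{(k)}\,\middle|\,\delta_N^{(k)}=\delta\right]=2\delta^2+\mathcal{O}(N^{-\frac12}).$$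
   Context: Setting. For each $N\in\mathbb{N}$, $\langle\cdot,\cdot\rangle_{\mathbb{R}^N}$ and $\|\cdot\|_{\mathbb{R}^N}$ denote the (possibly scaled) Euclidean inner product and norm on $\mathbb{R}^N$, i.e. $\langle u,v\rangle_{\mathbb{R}^N}=s_N\sum_{j=1}^N u_jv_j$ for some scaling constant $s_N>0$; $^*$ denotes the adjoint of a matrix. The matrices $\mathcal{C}_0,\mathcal{C}_1,K$ are $N\times N$ (depending on $N$), with $\mathcal{C}_0,\mathcal{C}_1$ (symmetric) positive definite. They are discretizations of positive definite operators and of a bounded operator on an infinite-dimensional separable Hilbert space. $\boldsymbol{y}$ is random data in the continuum model, and $y=y_N\in\mathbb{R}^N$ is its discretization at level $N$ (a function of $\boldsymbol{y}$). For $\lambda,\delta>0$ define the posterior covariance $\mathcal{C}_{\lambda,\delta}$ and mean $m_{\lambda,\delta}(y)$ by $$\mathcal{C}_{\lambda,\delta}^{-1}=\lambda K^*\mathcal{C}_1^{-1}K+\delta\,\mathcal{C}_0^{-1},\qquad \mathcal{C}_{\lambda,\delta}^{-1}m_{\lambda,\delta}(y)=\lambda K^*\mathcal{C}_1^{-1}y .$$ A Gaussian white noise in $\mathbb{R}^N$ is $\zeta=\sum_{j=1}^N\zeta_je_j$, where $\{e_j\}_{j=1}^N$ is an orthonormal basis of $\mathbb{R}^N$ with respect to $\langle\cdot,\cdot\rangle_{\mathbb{R}^N}$ and $\zeta_1,\dots,\zeta_N$ are independent standard normal real random variables. Discrete-level assumptions. (A1) For almost all data $\boldsymbol{y}$,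 for any $\lambda,\delta>0$, there is a constant $c_1=c_1(\boldsymbol{y};\lambda,\delta)\ge0$, independent of $N$, with $\|\mathcal{C}_0^{-\frac12}m_{\lambda,\delta}(y)\|_{\mathbb{R}^N}\le c_1$. (A2) There is a constant $c_2\ge0$, independent of $N$ and $\boldsymbol{y}$, with $\mathrm{Tr}(\mathcal{C}_1^{-\frac12}K\mathcal{C}_0K^*\mathcal{C}_1^{-\frac12})\le c_2$. Centered Gibbs sampler. Fix $\alpha_0,\beta_0>0$ (independent of $N$). $\mathrm{Gamma}(a,b)$ denotes the gamma distribution with shape $a$ and rate $b$. Given $\delta_N^{(k)}=\delta$, draw $$u_\delta^{(k)}=m_{\lambda,\delta}(y)+\mathcal{C}_{\lambda,\delta}^{\frac12}\zeta,$$ with $\zeta$ a fresh Gaussian white noise in $\mathbb{R}^N$ (independent of the data), and then, given $u_\delta^{(k)}$, draw $$\delta_N^{(k+1)}\sim\mathrm{Gamma}\Big(\alpha_0+\tfrac N2,\ \beta_0+\tfrac12\|\mathcal{C}_0^{-\frac12}u_\delta^{(k)}\|_{\mathbb{R}^N}^2\Big).$$ Definition of $f_N$. Let $W_{1,N}=\frac{1}{\sqrt{2N}}\sum_{j=1}^N(\zeta_j^2-1)$ and let $F_N(\delta;y)$ be the random variable defined by $$\beta_0+\tfrac12\|\mathcal{C}_0^{-\frac12}u_\delta^{(k)}\|_{\mathbb{R}^N}^2=\delta^{-1}\tfrac N2+\delta^{-1}\sqrt{\tfrac N2}\,W_{1,N}+F_N(\delta;y).$$ Then $f_N(\delta;y):=\mathbb{E}^\zeta[F_N(\delta;y)]$,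 the expectation being over $\zeta$ with the data fixed. Constants implicit in $\mathcal{O}(\cdot)$ are with respect to $N\to\infty$ and may depend on $\lambda,\delta,\alpha_0,\beta_0$ and $\boldsymbol{y}$. *)

theory Defs
  imports
    "HOL-Probability.Probability"
    "HOL-Library.Landau_Symbols"
    "Jordan_Normal_Form.Gauss_Jordan_Elimination"
begin

text \<open>
  The dimension \<open>N\<close> tends to infinity, so vectors and matrices are those of
  \<open>Jordan_Normal_Form\<close>, with explicit carriers. Their infix notation clashes with that
  of \<open>HOL-Analysis\<close>, which is switched off.
\<close>

unbundle no vec_syntax
unbundle no inner_syntax

definition pos_semidef_mat :: "nat \<Rightarrow> real mat \<Rightarrow> bool" where
  "pos_semidef_mat N A \<longleftrightarrow> A \<in> carrier_mat N N \<and> transpose_mat A = A \<and>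
     (\<forall>v\<in>carrier_vec N. v \<bullet> (A *\<^sub>v v) \<ge> 0)"

definition pos_def_mat :: "nat \<Rightarrow> real mat \<Rightarrow> bool" where
  "pos_def_mat N A \<longleftrightarrow> A \<in> carrier_mat N N \<and> transpose_mat A = A \<and>
     (\<forall>v\<in>carrier_vec N. v \<noteq> 0\<^sub>v N \<longrightarrow> v \<bullet> (A *\<^sub>v v) > 0)"

text \<open>Inverse and square root are only meaningful for invertible, respectively positive
  semidefinite, arguments; they are only applied to positive definite matrices.\<close>

definition mat_inv :: "real mat \<Rightarrow> real mat" where
  "mat_inv A = the (mat_inverse A)"

definition mat_sqrt :: "real mat \<Rightarrow> real mat" where
  "mat_sqrt A = (THE B. pos_semidef_mat (dim_row A) B \<and> B * B = A)"

definition mat_trace :: "real mat \<Rightarrow> real" where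
  "mat_trace A = (\<Sum>i<dim_row A. A $$ (i, i))"

text \<open>The scaled Euclidean inner product and norm. The adjoint of a real matrix with respect
  to it is the transpose, whatever the scaling constant.\<close>

definition scaled_inner :: "real \<Rightarrow> real vec \<Rightarrow> real vec \<Rightarrow> real" where
  "scaled_inner s u v = s * (u \<bullet> v)"

definition scaled_norm :: "real \<Rightarrow> real vec \<Rightarrow> real" where
  "scaled_norm s v = sqrt (scaled_inner s v v)"

definition orthonormal_basis :: "nat \<Rightarrow> real \<Rightarrow> (nat \<Rightarrow> real vec) \<Rightarrow> bool" where
  "orthonormal_basis N s e \<longleftrightarrow> (\<forall>j<N. e j \<in> carrier_vec N) \<and>
     (\<forall>i<N. \<forall>j<N. scaled_inner s (e i) (e j) = (if i = j then 1 else 0))"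

text \<open>
  The objects given at one discretization level: the scaling constant, the orthonormal basis
  in which the white noise is expanded (indexed by \<open>0, \<dots>, N - 1\<close>), the matrices
  \<open>C\<^sub>0\<close>, \<open>C\<^sub>1\<close> and the forward matrix \<open>K\<close>.
\<close>

record level =
  scal :: real
  onb :: "nat \<Rightarrow> real vec"
  cov0 :: "real mat"
  cov1 :: "real mat"
  fwd :: "real mat"

definition valid_level :: "nat \<Rightarrow> level \<Rightarrow> bool" where
  "valid_level N L \<longleftrightarrow> scal L > 0 \<and> orthonormal_basis N (scal L) (onb L) \<and>
     pos_def_mat N (cov0 L) \<and> pos_def_mat N (cov1 L) \<and> fwd L \<in> carrier_mat N N"

definition cov0_inv_sqrt :: "level \<Rightarrow> real mat" where
  "cov0_inv_sqrt L = mat_inv (mat_sqrt (cov0 L))"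

definition cov1_inv_sqrt :: "level \<Rightarrow> real mat" where
  "cov1_inv_sqrt L = mat_inv (mat_sqrt (cov1 L))"

definition post_prec :: "level \<Rightarrow> real \<Rightarrow> real \<Rightarrow> real mat" where
  "post_prec L lam del =
     lam \<cdot>\<^sub>m (transpose_mat (fwd L) * mat_inv (cov1 L) * fwd L) + del \<cdot>\<^sub>m mat_inv (cov0 L)"

definition post_cov :: "level \<Rightarrow> real \<Rightarrow> real \<Rightarrow> real mat" where
  "post_cov L lam del = mat_inv (post_prec L lam del)"

definition post_mean :: "level \<Rightarrow> real \<Rightarrow> real \<Rightarrow> real vec \<Rightarrow> real vec" where
  "post_mean L lam del y =
     post_cov L lam del *\<^sub>v (lam \<cdot>\<^sub>v ((transpose_mat (fwd L) * mat_inv (cov1 L)) *\<^sub>v y))"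

text \<open>Joint law of the \<open>N\<close> independent standard normal coordinates of the white noise.\<close>

definition std_normals :: "nat \<Rightarrow> (nat \<Rightarrow> real) measure" where
  "std_normals N = PiM {..<N} (\<lambda>_. density lborel std_normal_density)"

definition white_noise :: "nat \<Rightarrow> level \<Rightarrow> (nat \<Rightarrow> real) \<Rightarrow> real vec" where
  "white_noise N L z = vec N (\<lambda>i. \<Sum>j<N. z j * (onb L j $ i))"

definition u_draw ::
    "nat \<Rightarrow> level \<Rightarrow> real \<Rightarrow> real \<Rightarrow> real vec \<Rightarrow> (nat \<Rightarrow> real) \<Rightarrow> real vec" where
  "u_draw N L lam del y z =
     post_mean L lam del y + mat_sqrt (post_cov L lam del) *\<^sub>v white_noise N L z"

definition gamma_rate ::
    "nat \<Rightarrow> level \<Rightarrow> real \<Rightarrow> real \<Rightarrow> real \<Rightarrow> real vec \<Rightarrow> (nat \<Rightarrow> real) \<Rightarrow> real" where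
  "gamma_rate N L b0 lam del y z =
     b0 + 1/2 * (scaled_norm (scal L) (cov0_inv_sqrt L *\<^sub>v u_draw N L lam del y z))\<^sup>2"

text \<open>Gamma distribution with shape \<open>a > 0\<close> and rate \<open>b > 0\<close>.\<close>

definition gamma_density :: "real \<Rightarrow> real \<Rightarrow> real \<Rightarrow> real" where
  "gamma_density a b x =
     (if x \<le> 0 then 0 else b powr a * x powr (a - 1) * exp (- b * x) / Gamma a)"

definition gamma_distr :: "real \<Rightarrow> real \<Rightarrow> real measure" where
  "gamma_distr a b = density lborel (\<lambda>x. ennreal (gamma_density a b x))"

text \<open>
  One sweep of the centered Gibbs sampler: the conditional law of the next state of the
  \<open>\<delta>\<close>-chain, given that the current state is \<open>del\<close>, with the data \<open>y\<close> fixed. The chain is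
  time-homogeneous, so this transition kernel does not depend on the step. Conditioning on
  the current state being exactly \<open>del\<close> is understood through this kernel.
\<close>

definition delta_kernel ::
    "nat \<Rightarrow> level \<Rightarrow> real \<Rightarrow> real \<Rightarrow> real \<Rightarrow> real vec \<Rightarrow> real \<Rightarrow> real measure" where
  "delta_kernel N L a0 b0 lam y del =
     std_normals N \<bind> (\<lambda>z. gamma_distr (a0 + real N / 2) (gamma_rate N L b0 lam del y z))"

definition increment_mean ::
    "nat \<Rightarrow> level \<Rightarrow> real \<Rightarrow> real \<Rightarrow> real \<Rightarrow> real vec \<Rightarrow> real \<Rightarrow> real" where
  "increment_mean N L a0 b0 lam y del =
     prob_space.expectation (delta_kernel N L a0 b0 lam y del) (\<lambda>d. d - del)"

definition increment_var ::
    "nat \<Rightarrow> level \<Rightarrow> real \<Rightarrow> real \<Rightarrow> real \<Rightarrow> real vec \<Rightarrow> real \<Rightarrow> real" where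
  "increment_var N L a0 b0 lam y del =
     prob_space.variance (delta_kernel N L a0 b0 lam y del) (\<lambda>d. d - del)"

definition W1 :: "nat \<Rightarrow> (nat \<Rightarrow> real) \<Rightarrow> real" where
  "W1 N z = 1 / sqrt (2 * real N) * (\<Sum>j<N. ((z j)\<^sup>2 - 1))"

text \<open>The remainder in the expansion of the Gamma rate,
  \<open>gamma_rate = N / (2 del) + sqrt (N / 2) * W1 / del + rate_remainder\<close>.\<close>

definition rate_remainder ::
    "nat \<Rightarrow> level \<Rightarrow> real \<Rightarrow> real \<Rightarrow> real vec \<Rightarrow> real \<Rightarrow> (nat \<Rightarrow> real) \<Rightarrow> real" where
  "rate_remainder N L b0 lam y del z =
     gamma_rate N L b0 lam del y z
       - (1 / del * (real N / 2) + 1 / del * sqrt (real N / 2) * W1 N z)"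

definition mean_remainder ::
    "nat \<Rightarrow> level \<Rightarrow> real \<Rightarrow> real \<Rightarrow> real vec \<Rightarrow> real \<Rightarrow> real" where
  "mean_remainder N L b0 lam y del =
     prob_space.expectation (std_normals N) (rate_remainder N L b0 lam y del)"

text \<open>The discrete-level assumptions on the data \<open>y\<close> and the levels \<open>L\<close>. The law of the
  data is \<open>D\<close>.\<close>

definition assumption_A1 ::
    "'w measure \<Rightarrow> (nat \<Rightarrow> level) \<Rightarrow> (nat \<Rightarrow> 'w \<Rightarrow> real vec) \<Rightarrow> bool" where
  "assumption_A1 D L y \<longleftrightarrow>
     (AE \<omega> in D. \<forall>lam>0. \<forall>del>0. \<exists>c1\<ge>0. \<forall>N\<ge>1.
        scaled_norm (scal (L N)) (cov0_inv_sqrt (L N) *\<^sub>v post_mean (L N) lam del (y N \<omega>)) \<le> c1)"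

definition assumption_A2 :: "(nat \<Rightarrow> level) \<Rightarrow> bool" where
  "assumption_A2 L \<longleftrightarrow>
     (\<exists>c2\<ge>0. \<forall>N\<ge>1.
        mat_trace (cov1_inv_sqrt (L N) * fwd (L N) * cov0 (L N)
          * transpose_mat (fwd (L N)) * cov1_inv_sqrt (L N)) \<le> c2)"

end

theory Submission
  imports Defs "Jordan_Normal_Form.Spectral_Radius"
begin

text \<open>
  Write \<open>\<delta>\<close> for the current state and \<open>N / (2 \<delta>) * (1 + X)\<close> for the rate of the Gamma draw. Given the
  white noise, a Gamma variable of shape \<open>a = \<alpha>\<^sub>0 + N/2\<close> has mean \<open>a / rate\<close> and second
  moment \<open>a (a + 1) / rate\<^sup>2\<close>, so everything reduces to expanding \<open>E[1 / (1 + X)]\<close> and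
  \<open>E[1 / (1 + X)\<^sup>2]\<close> up to \<open>O(N\<^bsup>-3/2\<^esup>)\<close>; a prefactor \<open>N/2\<close> turns this into the claimed
  \<open>O(N\<^bsup>-1/2\<^esup>)\<close>.

  The first ingredient is linear algebra. If \<open>P\<close> is the posterior precision and \<open>R\<close> the square root of
  its inverse, then \<open>R P R = 1\<close>, and expanding \<open>P\<close> shows that
  \<open>R C\<^sub>0\<^sup>-\<^sup>1 R = (1 - \<lambda> R K\<^sup>* C\<^sub>1\<^sup>-\<^sup>1 K R) / \<delta>\<close>. Hence the quadratic part of the rate is
  exactly \<open>1 / (2 \<delta>)\<close> times the sum of the squared noise coordinates, minus a sum of squares of linear
  forms in the noise. Since \<open>P \<ge> \<delta> C\<^sub>0\<^sup>-\<^sup>1\<close>, inversion gives \<open>P\<^sup>-\<^sup>1 \<le> C\<^sub>0 / \<delta>\<close>, so the total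
  variance of these forms is controlled by the trace in (A2), and the variance of the cross term between
  mean and noise by the norm in (A1). This is lemma \<open>gamma_rate_representation\<close>.

  The second ingredient is moment control. Even moments of linear forms and of the centred
  chi-square sum come from their moment generating functions via \<open>\<bar>x\<bar>\<^sup>n / n! \<le> e\<^sup>x + e\<^sup>-\<^sup>x\<close>; sums of
  squares are handled by Jensen's inequality. So \<open>X = W + 2 \<delta> F / N\<close>, where \<open>W\<close> is centred with
  variance \<open>2 / N\<close> and eighth moment \<open>O(N\<^sup>-\<^sup>4)\<close>, and the eighth moment of \<open>F\<close> is bounded uniformly.

  The third ingredient is a Taylor expansion of \<open>1 / (1 + x)\<close> in which \<open>x\<close> may approach \<open>-1\<close>. The rate
  never falls below \<open>\<beta>\<^sub>0\<close>, so \<open>1 + X \<ge> c / N\<close>: the inverse costs at most powers of \<open>N\<close>, and on the event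
  \<open>X < -1/2\<close> these are compensated by inserting further factors \<open>2 \<bar>X\<bar> \<ge> 1\<close>. This is why eight moments are
  carried along (lemmas \<open>inverse_taylor_bounds\<close> and \<open>inverse_moment_expansion\<close>).
\<close>

section \<open>Real symmetric matrices\<close>

lemma sym_scalar_prod_swap:
  fixes A :: "real mat"
  assumes A: "A \<in> carrier_mat n n" and sym: "transpose_mat A = A"
    and x: "x \<in> carrier_vec n" and y: "y \<in> carrier_vec n"
  shows "(A *\<^sub>v x) \<bullet> y = x \<bullet> (A *\<^sub>v y)"
  using transpose_vec_mult_scalar[OF A y x] sym comm_scalar_prod[of "A *\<^sub>v x" n y] A x y
  by (simp add: comm_scalar_prod[of x n "A *\<^sub>v y"] comm_scalar_prod[of "A *\<^sub>v x" n y])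

lemma scalar_prod_self_nonneg: "(v :: real vec) \<bullet> v \<ge> 0"
  by (simp add: scalar_prod_def sum_nonneg)

lemma scalar_prod_self_eq_0:
  assumes "(v :: real vec) \<in> carrier_vec n" shows "v \<bullet> v = 0 \<longleftrightarrow> v = 0\<^sub>v n"
proof
  assume "v \<bullet> v = 0"
  then have "\<forall>i\<in>{0..<dim_vec v}. v $ i * v $ i = 0"
    unfolding scalar_prod_def by (subst (asm) sum_nonneg_eq_0_iff) auto
  then show "v = 0\<^sub>v n" using assms by (intro eq_vecI) auto
qed (use assms in auto)

lemma pos_def_imp_pos_semidef: "pos_def_mat n A \<Longrightarrow> pos_semidef_mat n A"
  unfolding pos_def_mat_def pos_semidef_mat_def
proof (elim conjE, intro conjI ballI)
  fix v :: "real vec"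
  assume "\<forall>v\<in>carrier_vec n. v \<noteq> 0\<^sub>v n \<longrightarrow> 0 < v \<bullet> (A *\<^sub>v v)" "v \<in> carrier_vec n" "A \<in> carrier_mat n n"
  then show "v \<bullet> (A *\<^sub>v v) \<ge> 0" by (cases "v = 0\<^sub>v n") (auto simp: less_imp_le)
qed auto

text \<open>A complex eigenvector exists by the fundamental theorem of algebra. Testing \<open>A\<close> on its real and
  imaginary parts and using symmetry forces the eigenvalue to be real, so both parts are real
  eigenvectors, and at least one of them is nonzero.\<close>

lemma real_eigenvector_exists:
  fixes A :: "real mat"
  assumes A: "A \<in> carrier_mat n n" and sym: "transpose_mat A = A" and n: "n > 0"
  shows "\<exists>v a. v \<in> carrier_vec n \<and> v \<noteq> 0\<^sub>v n \<and> A *\<^sub>v v = a \<cdot>\<^sub>v v"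
proof -
  let ?A = "map_mat complex_of_real A"
  have cA: "?A \<in> carrier_mat n n" using A by simp
  from spectrum_non_empty[OF cA n] obtain e where "eigenvalue ?A e"
    unfolding spectrum_def by auto
  then obtain v where v: "v \<in> carrier_vec n" "v \<noteq> 0\<^sub>v n" "?A *\<^sub>v v = e \<cdot>\<^sub>v v"
    unfolding eigenvalue_def eigenvector_def using A by auto
  define x where "x = map_vec Re v"
  define y where "y = map_vec Im v"
  have x: "x \<in> carrier_vec n" and y: "y \<in> carrier_vec n" using v by (auto simp: x_def y_def)
  have entry: "(\<Sum>j\<in>{0..<n}. complex_of_real (A $$ (i, j)) * v $ j) = e * v $ i" if "i < n" for i
    using arg_cong[OF v(3), of "\<lambda>w. w $ i"] that v(1) A by (simp add: scalar_prod_def)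
  have Ax: "A *\<^sub>v x = Re e \<cdot>\<^sub>v x - Im e \<cdot>\<^sub>v y"
  proof (rule eq_vecI)
    fix i assume "i < dim_vec (Re e \<cdot>\<^sub>v x - Im e \<cdot>\<^sub>v y)"
    then have i: "i < n" using y by simp
    show "(A *\<^sub>v x) $ i = (Re e \<cdot>\<^sub>v x - Im e \<cdot>\<^sub>v y) $ i"
      using arg_cong[OF entry[OF i], of Re] i v(1) A by (simp add: scalar_prod_def x_def y_def)
  qed (use A y in auto)
  have Ay: "A *\<^sub>v y = Im e \<cdot>\<^sub>v x + Re e \<cdot>\<^sub>v y"
  proof (rule eq_vecI)
    fix i assume "i < dim_vec (Im e \<cdot>\<^sub>v x + Re e \<cdot>\<^sub>v y)"
    then have i: "i < n" using y by simp
    show "(A *\<^sub>v y) $ i = (Im e \<cdot>\<^sub>v x + Re e \<cdot>\<^sub>v y) $ i"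
      using arg_cong[OF entry[OF i], of Im] i v(1) A by (simp add: scalar_prod_def x_def y_def add.commute)
  qed (use A y in auto)
  have "(A *\<^sub>v x) \<bullet> y = x \<bullet> (A *\<^sub>v y)" by (rule sym_scalar_prod_swap[OF A sym x y])
  moreover have "(A *\<^sub>v x) \<bullet> y = Re e * (x \<bullet> y) - Im e * (y \<bullet> y)"
    unfolding Ax using x y by (subst minus_scalar_prod_distrib[of _ n]) auto
  moreover have "x \<bullet> (A *\<^sub>v y) = Im e * (x \<bullet> x) + Re e * (x \<bullet> y)"
    unfolding Ay using x y by (subst scalar_prod_add_distrib[of _ n]) auto
  ultimately have im: "Im e * (x \<bullet> x + y \<bullet> y) = 0" by (simp add: algebra_simps)
  have nz: "x \<noteq> 0\<^sub>v n \<or> y \<noteq> 0\<^sub>v n"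
  proof (rule ccontr)
    assume "\<not> ?thesis"
    then have "Re (v $ i) = 0 \<and> Im (v $ i) = 0" if "i < n" for i
      using v(1) that by (metis carrier_vecD index_map_vec(1) index_zero_vec(1) x_def y_def)
    then have "v = 0\<^sub>v n" using v(1) by (intro eq_vecI) (auto simp: complex_eq_iff)
    with v(2) show False by simp
  qed
  then have "x \<bullet> x + y \<bullet> y \<noteq> 0"
    using scalar_prod_self_eq_0[OF x] scalar_prod_self_eq_0[OF y]
      scalar_prod_self_nonneg[of x] scalar_prod_self_nonneg[of y] by linarith
  with im have "Im e = 0" by simp
  then have "A *\<^sub>v x = Re e \<cdot>\<^sub>v x" "A *\<^sub>v y = Re e \<cdot>\<^sub>v y"
    using Ax Ay x y by (auto intro!: eq_vecI)
  then show ?thesis using nz x y by blast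
qed

text \<open>Reflecting in the hyperplane orthogonal to \<open>v - e\<^sub>0\<close> swaps \<open>v\<close> and \<open>e\<^sub>0\<close>. A symmetric
  involution with this property splits off one eigenvector by conjugation.\<close>

lemma householder_exists:
  fixes v :: "real vec"
  assumes v: "v \<in> carrier_vec n" "v \<bullet> v = 1" and n: "n > 0"
  shows "\<exists>H. H \<in> carrier_mat n n \<and> transpose_mat H = H \<and> H * H = 1\<^sub>m n \<and> H *\<^sub>v unit_vec n 0 = v"
proof (cases "v = unit_vec n 0")
  case True
  then show ?thesis by (intro exI[of _ "1\<^sub>m n"]) auto
next
  case False
  define w where "w = v - unit_vec n 0"
  have w: "w \<in> carrier_vec n" using v by (simp add: w_def)
  have "w \<noteq> 0\<^sub>v n"
  proof
    assume "w = 0\<^sub>v n"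
    then have "v $ i - unit_vec n 0 $ i = 0" if "i < n" for i
      using that v by (metis index_minus_vec(1) index_zero_vec(1) unit_vec_carrier carrier_vecD w_def)
    then have "v = unit_vec n 0" using v by (intro eq_vecI) auto
    with False show False ..
  qed
  then have ww: "w \<bullet> w \<noteq> 0" using scalar_prod_self_eq_0[OF w] by simp
  have u0: "unit_vec n 0 \<bullet> v = v $ 0" "v \<bullet> unit_vec n 0 = v $ 0"
    using v n by (auto)
  have ww2: "w \<bullet> w = 2 - 2 * v $ 0"
    unfolding w_def using v n u0
    by (subst minus_scalar_prod_distrib[of _ n], simp, simp, simp)
       (subst (1 2) scalar_prod_minus_distrib[of _ n], auto)
  define H where "H = mat n n (\<lambda>(i, j). (if i = j then 1 else 0) - 2 / (w \<bullet> w) * (w $ i * w $ j))"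
  have H: "H \<in> carrier_mat n n" by (simp add: H_def)
  have Hv: "H *\<^sub>v x = x - (2 * (w \<bullet> x) / (w \<bullet> w)) \<cdot>\<^sub>v w" if x: "x \<in> carrier_vec n" for x
  proof (rule eq_vecI)
    fix i assume "i < dim_vec (x - (2 * (w \<bullet> x) / (w \<bullet> w)) \<cdot>\<^sub>v w)"
    then have i: "i < n" using w by simp
    have "(H *\<^sub>v x) $ i = (\<Sum>j\<in>{0..<n}. ((if i = j then 1 else 0) - 2 / (w \<bullet> w) * (w $ i * w $ j)) * x $ j)"
      using i x H by (simp add: scalar_prod_def H_def)
    also have "\<dots> = (\<Sum>j\<in>{0..<n}. (if i = j then x $ j else 0)) - (\<Sum>j\<in>{0..<n}. (2 / (w \<bullet> w) * w $ i) * (w $ j * x $ j))"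
      unfolding sum_subtractf[symmetric] by (rule sum.cong) (auto simp: algebra_simps)
    also have "\<dots> = x $ i - 2 / (w \<bullet> w) * w $ i * (w \<bullet> x)"
      using i x by (simp add: scalar_prod_def[of w x] sum_distrib_left)
    finally show "(H *\<^sub>v x) $ i = (x - (2 * (w \<bullet> x) / (w \<bullet> w)) \<cdot>\<^sub>v w) $ i"
      using i w x by simp
  qed (use H w in auto)
  have sym: "transpose_mat H = H" by (rule eq_matI) (auto simp: H_def)
  have "H *\<^sub>v (H *\<^sub>v x) = x" if x: "x \<in> carrier_vec n" for x
  proof -
    define c where "c = 2 * (w \<bullet> x) / (w \<bullet> w)"
    have cx: "x - c \<cdot>\<^sub>v w \<in> carrier_vec n" using x w by simp
    have "w \<bullet> (x - c \<cdot>\<^sub>v w) = w \<bullet> x - c * (w \<bullet> w)"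
      using x w by (subst scalar_prod_minus_distrib[of _ n]) auto
    also have "\<dots> = - (w \<bullet> x)" using ww by (simp add: c_def)
    finally have "2 * (w \<bullet> (x - c \<cdot>\<^sub>v w)) / (w \<bullet> w) = - c" by (simp add: c_def)
    then have "H *\<^sub>v (x - c \<cdot>\<^sub>v w) = (x - c \<cdot>\<^sub>v w) - (-c) \<cdot>\<^sub>v w" using Hv[OF cx] by simp
    also have "\<dots> = x" using x w by (intro eq_vecI) auto
    finally show ?thesis using Hv[OF x] by (simp add: c_def)
  qed
  note invol = this
  have HH: "H * H = 1\<^sub>m n"
  proof (rule mat_col_eqI)
    fix j assume "j < dim_col (1\<^sub>m n)"
    then have j: "j < n" by simp
    have "col H j = H *\<^sub>v unit_vec n j" using H j by (intro eq_vecI) auto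
    then have "col (H * H) j = H *\<^sub>v (H *\<^sub>v unit_vec n j)" using col_mult2[OF H H j] by simp
    then show "col (H * H) j = col (1\<^sub>m n) j" using invol[of "unit_vec n j"] j by simp
  qed (use H in auto)
  have "w \<bullet> v = 1 - v $ 0" unfolding w_def using v n u0
    by (subst minus_scalar_prod_distrib[of _ n]) auto
  then have "2 * (w \<bullet> v) / (w \<bullet> w) = 1" using ww ww2 by (simp add: field_simps)
  then have "H *\<^sub>v v = v - 1 \<cdot>\<^sub>v w" using Hv[OF v(1)] by simp
  also have "\<dots> = unit_vec n 0" using v by (intro eq_vecI) (auto simp: w_def)
  finally have "H *\<^sub>v unit_vec n 0 = v" using HH H v by (metis assoc_mult_mat_vec one_mult_mat_vec)
  then show ?thesis using H sym HH by blast
qed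

section \<open>Square roots and inverses of positive definite matrices\<close>

lemma mult_mat_zero_vec:
  "(A :: real mat) \<in> carrier_mat m n \<Longrightarrow> A *\<^sub>v 0\<^sub>v n = 0\<^sub>v m"
  by (intro eq_vecI) auto

lemma quadratic_form_sum:
  assumes "A \<in> carrier_mat n n" "v \<in> carrier_vec n"
  shows "v \<bullet> (A *\<^sub>v v) = (\<Sum>i<n. \<Sum>j<n. (v $ i * A $$ (i, j) * v $ j :: real))"
proof -
  have "v \<bullet> (A *\<^sub>v v) = (\<Sum>i<n. v $ i * (\<Sum>j<n. A $$ (i, j) * v $ j))"
    using assms by (auto simp: scalar_prod_def lessThan_atLeast0 intro!: sum.cong)
  then show ?thesis by (simp add: sum_distrib_left mult.assoc)
qed

lemma pos_semidef_congruence: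
  assumes B: "pos_semidef_mat n B" and H: "H \<in> carrier_mat n n"
  shows "pos_semidef_mat n (transpose_mat H * B * H)"
proof -
  have Bc: "B \<in> carrier_mat n n" and Bs: "transpose_mat B = B" using B by (auto simp: pos_semidef_mat_def)
  have Ht: "transpose_mat H \<in> carrier_mat n n" using H by simp
  have "transpose_mat (transpose_mat H * B * H) = transpose_mat H * B * H"
    using Bc Bs H Ht by (simp add: transpose_mult[of _ n n _ n])
  moreover have "v \<bullet> ((transpose_mat H * B * H) *\<^sub>v v) \<ge> 0" if v: "v \<in> carrier_vec n" for v
  proof -
    have Hv: "H *\<^sub>v v \<in> carrier_vec n" using H v by simp
    have "(transpose_mat H * B * H) *\<^sub>v v = transpose_mat H *\<^sub>v (B *\<^sub>v (H *\<^sub>v v))"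
      using Bc H Ht v by (simp add: assoc_mult_mat_vec[of _ n n _ n])
    then have "v \<bullet> ((transpose_mat H * B * H) *\<^sub>v v) = (transpose_mat H *\<^sub>v (B *\<^sub>v (H *\<^sub>v v))) \<bullet> v"
      using comm_scalar_prod[of v n] v Ht Bc Hv by simp
    also have "\<dots> = (B *\<^sub>v (H *\<^sub>v v)) \<bullet> (H *\<^sub>v v)"
      by (rule transpose_vec_mult_scalar[OF H v]) (use Bc Hv in simp)
    also have "\<dots> = (H *\<^sub>v v) \<bullet> (B *\<^sub>v (H *\<^sub>v v))" by (rule comm_scalar_prod[of _ n]) (use Bc Hv in auto)
    finally show ?thesis using B Hv by (simp add: pos_semidef_mat_def)
  qed
  ultimately show ?thesis using H Bc Ht by (auto simp: pos_semidef_mat_def)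
qed

text \<open>The direct sum of the scalar \<open>r\<close> and the matrix \<open>B\<close>.\<close>

definition border :: "nat \<Rightarrow> real \<Rightarrow> real mat \<Rightarrow> real mat" where
  "border n r B = mat (Suc n) (Suc n)
     (\<lambda>(i, j). case i of 0 \<Rightarrow> (case j of 0 \<Rightarrow> r | Suc l \<Rightarrow> 0)
       | Suc k \<Rightarrow> (case j of 0 \<Rightarrow> 0 | Suc l \<Rightarrow> B $$ (k, l)))"

lemma border_carrier [simp]: "border n r B \<in> carrier_mat (Suc n) (Suc n)"
  by (simp add: border_def)

lemma border_index [simp]:
  "border n r B $$ (0, 0) = r"
  "k < n \<Longrightarrow> border n r B $$ (0, Suc k) = 0"
  "k < n \<Longrightarrow> border n r B $$ (Suc k, 0) = 0"
  "k < n \<Longrightarrow> l < n \<Longrightarrow> border n r B $$ (Suc k, Suc l) = B $$ (k, l)"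
  by (auto simp: border_def)

lemma border_mult:
  assumes "B \<in> carrier_mat n n" "C \<in> carrier_mat n n"
  shows "border n r B * border n s C = border n (r * s) (B * C)"
proof (rule eq_matI)
  fix i j assume "i < dim_row (border n (r * s) (B * C))" "j < dim_col (border n (r * s) (B * C))"
  then have ij: "i < Suc n" "j < Suc n" by (auto simp: border_def)
  have "(border n r B * border n s C) $$ (i, j)
      = (\<Sum>k<Suc n. border n r B $$ (i, k) * border n s C $$ (k, j))"
    using ij carrier_matD[OF border_carrier[of n r B]] carrier_matD[OF border_carrier[of n s C]]
    by (simp add: scalar_prod_def atLeast0LessThan del: sum.lessThan_Suc)
  also have "\<dots> = border n (r * s) (B * C) $$ (i, j)"
    using ij assms by (cases i; cases j)
      (simp_all add: sum.lessThan_Suc_shift scalar_prod_def atLeast0LessThan del: sum.lessThan_Suc)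
  finally show "(border n r B * border n s C) $$ (i, j) = border n (r * s) (B * C) $$ (i, j)" .
qed (simp_all add: border_def)

lemma border_quadratic_form:
  assumes B: "B \<in> carrier_mat n n" and v: "v \<in> carrier_vec (Suc n)"
  shows "v \<bullet> (border n r B *\<^sub>v v)
    = r * (v $ 0)\<^sup>2 + vec n (\<lambda>i. v $ Suc i) \<bullet> (B *\<^sub>v vec n (\<lambda>i. v $ Suc i))"
  unfolding quadratic_form_sum[OF border_carrier v] quadratic_form_sum[OF B vec_carrier]
  by (simp add: sum.lessThan_Suc_shift power2_eq_square del: sum.lessThan_Suc)

lemma pos_semidef_border_iff:
  assumes B: "B \<in> carrier_mat n n"
  shows "pos_semidef_mat (Suc n) (border n r B) \<longleftrightarrow> r \<ge> 0 \<and> pos_semidef_mat n B"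
proof
  assume L: "pos_semidef_mat (Suc n) (border n r B)"
  have form: "r * (v $ 0)\<^sup>2 + vec n (\<lambda>i. v $ Suc i) \<bullet> (B *\<^sub>v vec n (\<lambda>i. v $ Suc i)) \<ge> 0"
    if "v \<in> carrier_vec (Suc n)" for v
    using L that unfolding border_quadratic_form[OF B that, of r, symmetric] by (simp add: pos_semidef_mat_def)
  have z: "vec n (\<lambda>i. unit_vec (Suc n) 0 $ Suc i) = 0\<^sub>v n" by (intro eq_vecI) auto
  have "r \<ge> 0" using form[of "unit_vec (Suc n) 0", OF unit_vec_carrier]
    unfolding z mult_mat_zero_vec[OF B] by simp
  moreover have "B $$ (i, j) = B $$ (j, i)" if "i < n" "j < n" for i j
  proof -
    have "transpose_mat (border n r B) $$ (Suc j, Suc i) = border n r B $$ (Suc j, Suc i)"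
      using L by (simp add: pos_semidef_mat_def)
    then show ?thesis using that by (simp add: border_def)
  qed
  then have "transpose_mat B = B" using B by (intro eq_matI) auto
  moreover have "w \<bullet> (B *\<^sub>v w) \<ge> 0" if w: "w \<in> carrier_vec n" for w
  proof -
    define v where "v = vec (Suc n) (\<lambda>i. case i of 0 \<Rightarrow> 0 | Suc k \<Rightarrow> w $ k)"
    have "vec n (\<lambda>i. v $ Suc i) = w" using w by (intro eq_vecI) (auto simp: v_def)
    then show ?thesis using form[of v] by (simp add: v_def)
  qed
  ultimately show "r \<ge> 0 \<and> pos_semidef_mat n B" using B by (simp add: pos_semidef_mat_def)
next
  assume R: "r \<ge> 0 \<and> pos_semidef_mat n B"
  then have "transpose_mat B = B" by (simp add: pos_semidef_mat_def)
  then have "B $$ (j, i) = B $$ (i, j)" if "i < n" "j < n" for i j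
    using that B \<open>transpose_mat B = B\<close> index_transpose_mat(1)[of i B j] by simp
  then have "transpose_mat (border n r B) = border n r B"
    by (intro eq_matI) (auto simp: border_def split: nat.splits)
  then show "pos_semidef_mat (Suc n) (border n r B)"
    using R border_quadratic_form[OF B] by (simp add: pos_semidef_mat_def)
qed

text \<open>Induction on the dimension: conjugating by the reflection that maps the first unit vector to an
  eigenvector turns the matrix into a block-diagonal one, whose root is taken blockwise and conjugated back.\<close>

lemma pos_semidef_sqrt_exists:
  "pos_semidef_mat n A \<Longrightarrow> \<exists>B. pos_semidef_mat n B \<and> B * B = A"
proof (induction n arbitrary: A)
  case 0
  then show ?case
    by (intro exI[of _ A]) (auto simp: pos_semidef_mat_def intro!: eq_matI)
next
  case (Suc n)
  let ?n = "Suc n"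
  have A: "A \<in> carrier_mat ?n ?n" and sym: "transpose_mat A = A"
    using Suc.prems by (auto simp: pos_semidef_mat_def)
  obtain v0 a where v0: "v0 \<in> carrier_vec ?n" "v0 \<noteq> 0\<^sub>v ?n" "A *\<^sub>v v0 = a \<cdot>\<^sub>v v0"
    using real_eigenvector_exists[OF A sym] by auto
  define v where "v = (1 / sqrt (v0 \<bullet> v0)) \<cdot>\<^sub>v v0"
  have v: "v \<in> carrier_vec ?n" using v0 by (simp add: v_def)
  have "v0 \<bullet> v0 > 0"
    using scalar_prod_self_eq_0[OF v0(1)] scalar_prod_self_nonneg[of v0] v0(2) by linarith
  then have vv: "v \<bullet> v = 1" using v0(1) by (simp add: v_def)
  have Av: "A *\<^sub>v v = a \<cdot>\<^sub>v v"
    using A v0 by (simp add: v_def mult_mat_vec smult_smult_assoc mult.commute)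
  obtain H where H: "H \<in> carrier_mat ?n ?n" "transpose_mat H = H" "H * H = 1\<^sub>m ?n"
    "H *\<^sub>v unit_vec ?n 0 = v"
    using householder_exists[OF v vv] by auto
  have HHx: "H * (H * X) = X" if "X \<in> carrier_mat ?n ?n" for X
    using H(1,3) that by (metis assoc_mult_mat left_mult_one_mat)
  define M where "M = H * A * H"
  have M: "M \<in> carrier_mat ?n ?n" using H(1) A by (simp add: M_def)
  have Mpsd: "pos_semidef_mat ?n M"
    using pos_semidef_congruence[OF Suc.prems H(1)] H(2) by (simp add: M_def)
  have Hv: "H *\<^sub>v v = unit_vec ?n 0"
    using H by (metis assoc_mult_mat_vec one_mult_mat_vec unit_vec_carrier)
  have "M *\<^sub>v unit_vec ?n 0 = H *\<^sub>v (A *\<^sub>v (H *\<^sub>v unit_vec ?n 0))"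
    unfolding M_def using H(1) A by (simp add: assoc_mult_mat_vec[of _ ?n ?n _ ?n])
  also have "\<dots> = a \<cdot>\<^sub>v unit_vec ?n 0"
    using H Av v Hv by (simp add: mult_mat_vec)
  finally have M0: "M *\<^sub>v unit_vec ?n 0 = a \<cdot>\<^sub>v unit_vec ?n 0" .
  have Mi0: "M $$ (i, 0) = (if i = 0 then a else 0)" if "i < ?n" for i
    using arg_cong[OF M0, of "\<lambda>w. w $ i"] that M by simp
  have M0i: "M $$ (0, i) = (if i = 0 then a else 0)" if "i < ?n" for i
    using Mi0[OF that] Mpsd that M unfolding pos_semidef_mat_def
    by (metis carrier_matD index_transpose_mat(1) zero_less_Suc)
  define A' where "A' = mat n n (\<lambda>(i, j). M $$ (Suc i, Suc j))"
  have A': "A' \<in> carrier_mat n n" by (simp add: A'_def)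
  have Mb: "M = border n a A'"
    using M Mi0 M0i by (intro eq_matI) (auto simp: border_def A'_def split: nat.splits)
  have a: "a \<ge> 0" "pos_semidef_mat n A'"
    using Mpsd pos_semidef_border_iff[OF A'] unfolding Mb by auto
  from Suc.IH[OF a(2)] obtain B' where B': "pos_semidef_mat n B'" "B' * B' = A'" by blast
  have B'c: "B' \<in> carrier_mat n n" using B' by (simp add: pos_semidef_mat_def)
  define C where "C = border n (sqrt a) B'"
  have C: "C \<in> carrier_mat ?n ?n" by (simp add: C_def)
  have Cp: "pos_semidef_mat ?n C" using pos_semidef_border_iff[OF B'c] B' a by (simp add: C_def)
  have CC: "C * C = M" unfolding C_def Mb using border_mult[OF B'c B'c] B'(2) a by simp
  have "(H * C * H) * (H * C * H) = H * (C * C) * H"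
    using H(1) C HHx[of "C * H"] by (simp add: assoc_mult_mat[of _ ?n ?n _ ?n _ ?n])
  also have "\<dots> = A"
    unfolding CC M_def using H A HHx
    by (simp add: assoc_mult_mat[of _ ?n ?n _ ?n _ ?n])
  finally have "(H * C * H) * (H * C * H) = A" .
  moreover have "pos_semidef_mat ?n (H * C * H)"
    using pos_semidef_congruence[OF Cp H(1)] H(2) by simp
  ultimately show ?case by blast
qed

lemma pos_def_inverse:
  assumes "pos_def_mat n A"
  shows mat_inv_carrier: "mat_inv A \<in> carrier_mat n n"
    and mat_inv_right: "A * mat_inv A = 1\<^sub>m n"
    and mat_inv_left: "mat_inv A * A = 1\<^sub>m n"
proof -
  have A: "A \<in> carrier_mat n n" using assms by (simp add: pos_def_mat_def)
  have "det A \<noteq> 0"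
    using det_0_iff_vec_prod_zero_field[OF A] assms by (force simp: pos_def_mat_def)
  then have "A \<in> Units (ring_mat TYPE(real) n ())" by (rule det_non_zero_imp_unit[OF A])
  then obtain B where B: "mat_inverse A = Some B"
    using mat_inverse(1)[OF A, of "()"] by (cases "mat_inverse A") auto
  have "A * B = 1\<^sub>m n \<and> B * A = 1\<^sub>m n \<and> B \<in> carrier_mat n n" by (rule mat_inverse(2)[OF A B])
  then show "mat_inv A \<in> carrier_mat n n" "A * mat_inv A = 1\<^sub>m n" "mat_inv A * A = 1\<^sub>m n"
    by (simp_all add: mat_inv_def B)
qed

lemma left_inverse_unique:
  fixes A :: "real mat"
  assumes "A \<in> carrier_mat n n" "B \<in> carrier_mat n n" "C \<in> carrier_mat n n"
    and "A * B = 1\<^sub>m n" "C * A = 1\<^sub>m n"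
  shows "B = C"
proof -
  have "C * (A * B) = (C * A) * B" using assms(1-3) by simp
  then show ?thesis using assms by simp
qed

lemma pos_def_mat_inv:
  assumes "pos_def_mat n A" shows "pos_def_mat n (mat_inv A)"
proof -
  have A: "A \<in> carrier_mat n n" "transpose_mat A = A" using assms by (auto simp: pos_def_mat_def)
  note inv = pos_def_inverse[OF assms]
  have "A * transpose_mat (mat_inv A) = transpose_mat (mat_inv A * A)"
    using A inv(1) by (simp add: transpose_mult[of _ n n])
  then have "A * transpose_mat (mat_inv A) = 1\<^sub>m n" using inv(3) by simp
  then have "transpose_mat (mat_inv A) = mat_inv A"
    using left_inverse_unique[of A n "transpose_mat (mat_inv A)" "mat_inv A"] A(1) inv by simp
  moreover have "v \<bullet> (mat_inv A *\<^sub>v v) > 0" if v: "v \<in> carrier_vec n" "v \<noteq> 0\<^sub>v n" for v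
  proof -
    define w where "w = mat_inv A *\<^sub>v v"
    have w: "w \<in> carrier_vec n" using inv v by (simp add: w_def)
    have Aw: "A *\<^sub>v w = v"
      using A inv v by (simp add: w_def assoc_mult_mat_vec[symmetric, of A n n "mat_inv A" n])
    have "w \<noteq> 0\<^sub>v n" using Aw v A by auto
    then have "w \<bullet> (A *\<^sub>v w) > 0" using assms w by (simp add: pos_def_mat_def)
    then show ?thesis using Aw comm_scalar_prod[OF w v(1)] by (simp add: w_def)
  qed
  ultimately show ?thesis using inv by (simp add: pos_def_mat_def)
qed

text \<open>If the form of \<open>B\<close> vanishes at a vector, then \<open>B\<close> itself annihilates the vector, because \<open>B\<close> has a
  square root; hence \<open>B * B\<close> annihilates it, too.\<close>

lemma pos_def_of_square:
  assumes B: "pos_semidef_mat n B" and A: "pos_def_mat n (B * B)"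
  shows "pos_def_mat n B"
proof -
  have Bc: "B \<in> carrier_mat n n" "transpose_mat B = B" using B by (auto simp: pos_semidef_mat_def)
  from pos_semidef_sqrt_exists[OF B] obtain C where C: "pos_semidef_mat n C" "C * C = B" by blast
  have Cc: "C \<in> carrier_mat n n" "transpose_mat C = C" using C by (auto simp: pos_semidef_mat_def)
  have "v \<bullet> (B *\<^sub>v v) > 0" if v: "v \<in> carrier_vec n" "v \<noteq> 0\<^sub>v n" for v
  proof (rule ccontr)
    assume "\<not> ?thesis"
    then have z: "v \<bullet> (B *\<^sub>v v) = 0" using B v by (auto simp: pos_semidef_mat_def)
    have Cv: "C *\<^sub>v v \<in> carrier_vec n" using Cc v by simp
    have "v \<bullet> (B *\<^sub>v v) = (C *\<^sub>v v) \<bullet> (C *\<^sub>v v)"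
      using sym_scalar_prod_swap[OF Cc v(1) Cv] Cc v by (simp add: C(2)[symmetric])
    then have "C *\<^sub>v v = 0\<^sub>v n" using scalar_prod_self_eq_0[OF Cv] z by simp
    then have Bv: "B *\<^sub>v v = 0\<^sub>v n" using Cc v by (simp add: C(2)[symmetric] mult_mat_zero_vec)
    then have "(B * B) *\<^sub>v v = 0\<^sub>v n" using Bc v by (simp add: mult_mat_zero_vec)
    then have "v \<bullet> ((B * B) *\<^sub>v v) = 0" using v by simp
    moreover have "v \<bullet> ((B * B) *\<^sub>v v) > 0" using A v unfolding pos_def_mat_def by blast
    ultimately show False by simp
  qed
  then show ?thesis using Bc by (simp add: pos_def_mat_def)
qed

lemma trace_mult_commute:
  assumes "A \<in> carrier_mat n n" "B \<in> carrier_mat n n"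
  shows "mat_trace (A * B) = mat_trace (B * A)"
proof -
  have "mat_trace (A * B) = (\<Sum>i<n. \<Sum>j<n. A $$ (i, j) * B $$ (j, i))"
    using assms by (simp add: mat_trace_def scalar_prod_def lessThan_atLeast0)
  also have "\<dots> = (\<Sum>j<n. \<Sum>i<n. A $$ (i, j) * B $$ (j, i))" by (rule sum.swap)
  also have "\<dots> = mat_trace (B * A)"
    using assms by (simp add: mat_trace_def scalar_prod_def lessThan_atLeast0 mult.commute)
  finally show ?thesis .
qed

text \<open>Turns the trace in (A2) into a sum of values of the quadratic form of \<open>C\<^sub>0\<close>, and likewise the traces
  in the uniqueness proof for square roots.\<close>

lemma diag_entry_sandwich:
  assumes B: "B \<in> carrier_mat n n" and D: "D \<in> carrier_mat m n" and i: "i < m"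
  shows "(D * B * transpose_mat D) $$ (i, i) = row D i \<bullet> (B *\<^sub>v row D i)"
proof -
  have "(D * B * transpose_mat D) $$ (i, i) = (D * (B * transpose_mat D)) $$ (i, i)"
    using B D by (simp add: assoc_mult_mat[of D m n B n "transpose_mat D" m])
  also have "\<dots> = row D i \<bullet> col (B * transpose_mat D) i" using B D i by simp
  also have "col (B * transpose_mat D) i = B *\<^sub>v col (transpose_mat D) i"
    by (rule col_mult2[of _ n n _ m]) (use B D i in auto)
  finally show ?thesis using D i by simp
qed

text \<open>With \<open>D = B - C\<close>, equality of the squares gives the Sylvester equation \<open>B D + D C = 0\<close>. Multiplying
  by \<open>D\<close> and taking traces yields \<open>tr (D B D) + tr (D C D) = 0\<close>. Both traces are nonnegative, hence zero,
  and definiteness of \<open>B\<close> kills every row of \<open>D\<close>.\<close>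

lemma pos_def_sqrt_unique:
  assumes B: "pos_semidef_mat n B" and C: "pos_semidef_mat n C"
    and eq: "B * B = C * C" and pd: "pos_def_mat n (B * B)"
  shows "B = C"
proof -
  have Bc: "B \<in> carrier_mat n n" "transpose_mat B = B" using B by (auto simp: pos_semidef_mat_def)
  have Cc: "C \<in> carrier_mat n n" "transpose_mat C = C" using C by (auto simp: pos_semidef_mat_def)
  define D where "D = B - C"
  have D: "D \<in> carrier_mat n n" using Bc Cc by (simp add: D_def minus_carrier_mat)
  have Ds: "transpose_mat D = D" using Bc Cc by (simp add: D_def transpose_minus[of _ n n])
  have "B * D + D * C = (B * B - B * C) + (B * C - C * C)"
    unfolding D_def using Bc Cc
    by (simp add: mult_minus_distrib_mat[of _ n n _ n] minus_mult_distrib_mat[of _ n n _ _ n])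
  also have "\<dots> = 0\<^sub>m n n" unfolding eq using Bc Cc by (intro eq_matI) auto
  finally have syl: "B * D + D * C = 0\<^sub>m n n" .
  have "D * B * D + D * (D * C) = D * (B * D + D * C)"
    using Bc Cc D by (simp add: mult_add_distrib_mat[of _ n n _ n] assoc_mult_mat[of _ n n _ n _ n])
  then have riccati: "D * B * D + D * (D * C) = 0\<^sub>m n n" using syl D by simp
  then have ent: "(D * B * D) $$ (i, i) + (D * (D * C)) $$ (i, i) = 0" if "i < n" for i
  proof -
    have "(D * B * D) $$ (i, i) + (D * (D * C)) $$ (i, i) = (D * B * D + D * (D * C)) $$ (i, i)"
      by (rule index_add_mat(1)[symmetric]) (use that D Cc in auto)
    then show ?thesis using that by (simp add: riccati)
  qed
  have "mat_trace (D * B * D) + mat_trace (D * (D * C)) = 0"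
    using ent D by (simp add: mat_trace_def sum.distrib[symmetric])
  moreover have "mat_trace (D * (D * C)) = mat_trace (D * C * D)"
    by (rule trace_mult_commute) (use D Cc in auto)
  ultimately have tr: "mat_trace (D * B * D) + mat_trace (D * C * D) = 0" by simp
  have rowD: "row D i \<in> carrier_vec n" if "i < n" for i using that D by simp
  have trB: "mat_trace (D * B * D) = (\<Sum>i<n. row D i \<bullet> (B *\<^sub>v row D i))"
    using diag_entry_sandwich[OF Bc(1) D] Ds D by (simp add: mat_trace_def)
  have trC: "mat_trace (D * C * D) = (\<Sum>i<n. row D i \<bullet> (C *\<^sub>v row D i))"
    using diag_entry_sandwich[OF Cc(1) D] Ds D by (simp add: mat_trace_def)
  have nnB: "row D i \<bullet> (B *\<^sub>v row D i) \<ge> 0" if "i < n" for i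
    using B rowD[OF that] by (simp add: pos_semidef_mat_def)
  have nnC: "row D i \<bullet> (C *\<^sub>v row D i) \<ge> 0" if "i < n" for i
    using C rowD[OF that] by (simp add: pos_semidef_mat_def)
  have "(\<Sum>i<n. row D i \<bullet> (B *\<^sub>v row D i)) = 0"
    using tr sum_nonneg[of "{..<n}" "\<lambda>i. row D i \<bullet> (B *\<^sub>v row D i)"]
      sum_nonneg[of "{..<n}" "\<lambda>i. row D i \<bullet> (C *\<^sub>v row D i)"] nnB nnC
    unfolding trB trC by fastforce
  then have zero: "row D i \<bullet> (B *\<^sub>v row D i) = 0" if "i < n" for i
    using that nnB by (subst (asm) sum_nonneg_eq_0_iff) auto
  have "row D i = 0\<^sub>v n" if "i < n" for i
    using pos_def_of_square[OF B pd] zero[OF that] rowD[OF that] by (force simp: pos_def_mat_def)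
  then have D0: "D $$ (i, j) = 0" if "i < n" "j < n" for i j
    using that D by (metis carrier_matD index_row(1) index_zero_vec(1))
  show ?thesis
  proof (rule eq_matI)
    fix i j assume "i < dim_row C" "j < dim_col C"
    then show "B $$ (i, j) = C $$ (i, j)" using D0[of i j] Bc Cc by (simp add: D_def)
  qed (use Bc Cc in auto)
qed

text \<open>Existence and uniqueness of the root make the definite description in \<^const>\<open>mat_sqrt\<close> meaningful.\<close>

lemma mat_sqrt_pos_def:
  assumes "pos_def_mat n A"
  shows mat_sqrt_square: "mat_sqrt A * mat_sqrt A = A"
    and pos_def_mat_sqrt: "pos_def_mat n (mat_sqrt A)"
proof -
  have A: "A \<in> carrier_mat n n" using assms by (simp add: pos_def_mat_def)
  have "\<exists>!B. pos_semidef_mat n B \<and> B * B = A"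
    using pos_semidef_sqrt_exists[OF pos_def_imp_pos_semidef[OF assms]] pos_def_sqrt_unique assms
    by (metis (no_types, lifting))
  from theI'[OF this] have *: "pos_semidef_mat n (mat_sqrt A)" "mat_sqrt A * mat_sqrt A = A"
    using A by (auto simp: mat_sqrt_def)
  then show "mat_sqrt A * mat_sqrt A = A" "pos_def_mat n (mat_sqrt A)"
    using pos_def_of_square assms by auto
qed

lemma inv_sqrt_square:
  assumes "pos_def_mat n A"
  shows "mat_inv (mat_sqrt A) * mat_inv (mat_sqrt A) = mat_inv A"
proof -
  define S where "S = mat_sqrt A"
  have S: "pos_def_mat n S" "S * S = A" using mat_sqrt_pos_def[OF assms] by (auto simp: S_def)
  have Sc: "S \<in> carrier_mat n n" using S by (simp add: pos_def_mat_def)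
  have A: "A \<in> carrier_mat n n" using assms by (simp add: pos_def_mat_def)
  note i = pos_def_inverse[OF S(1)] and iA = pos_def_inverse[OF assms]
  have "A * (mat_inv S * mat_inv S) = S * ((S * mat_inv S) * mat_inv S)"
    using Sc i(1) by (simp add: S(2)[symmetric] assoc_mult_mat[of _ n n _ n _ n])
  also have "\<dots> = 1\<^sub>m n" using i by simp
  finally show ?thesis
    unfolding S_def[symmetric] using left_inverse_unique[of A n "mat_inv S * mat_inv S" "mat_inv A"] A i iA
    by simp
qed

section \<open>Posterior precision and orthonormal coordinates\<close>

lemma smult_mat_mult_mat_vec_assoc:
  fixes A :: "real mat"
  assumes "A \<in> carrier_mat m n" "v \<in> carrier_vec n"
  shows "(k \<cdot>\<^sub>m A) *\<^sub>v v = k \<cdot>\<^sub>v (A *\<^sub>v v)"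
  using assms by (intro eq_vecI) auto

lemma transpose_smult: "transpose_mat (k \<cdot>\<^sub>m A) = k \<cdot>\<^sub>m transpose_mat (A :: real mat)"
  by (intro eq_matI) auto

lemma scalar_prod_mult_sym:
  fixes A :: "real mat"
  assumes "A \<in> carrier_mat n n" "transpose_mat A = A" "x \<in> carrier_vec n" "y \<in> carrier_vec n"
  shows "(A *\<^sub>v x) \<bullet> (A *\<^sub>v y) = x \<bullet> ((A * A) *\<^sub>v y)"
  using sym_scalar_prod_swap[OF assms(1,2,3), of "A *\<^sub>v y"] assms by simp

lemma quadratic_form_add:
  assumes A: "A \<in> carrier_mat n n" and sym: "transpose_mat A = A"
    and x: "x \<in> carrier_vec n" and y: "y \<in> carrier_vec n"
  shows "(x + y) \<bullet> (A *\<^sub>v (x + y)) = x \<bullet> (A *\<^sub>v x) + 2 * (x \<bullet> (A *\<^sub>v y)) + (y \<bullet> (A *\<^sub>v y) :: real)"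
proof -
  have Ax: "A *\<^sub>v x \<in> carrier_vec n" and Ay: "A *\<^sub>v y \<in> carrier_vec n" using A x y by auto
  have "y \<bullet> (A *\<^sub>v x) = x \<bullet> (A *\<^sub>v y)"
    using sym_scalar_prod_swap[OF A sym x y] comm_scalar_prod[OF Ax y] by simp
  then show ?thesis
    using x y Ax Ay A
    by (simp add: mult_add_distrib_mat_vec[OF A x y] add_scalar_prod_distrib[of _ n]
        scalar_prod_add_distrib[of _ n])
qed

text \<open>Inversion reverses the order: the form of \<open>C\<close> is nonnegative at \<open>v - del C\<^sup>-\<^sup>1 P\<^sup>-\<^sup>1 v\<close>, and
  expanding it there, with \<open>dom\<close> applied to \<open>P\<^sup>-\<^sup>1 v\<close>, gives the claim.\<close>

lemma inverse_antimono_quadratic: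
  assumes P: "pos_def_mat n P" and C: "pos_def_mat n C" and del: "del > 0"
    and dom: "\<And>w. w \<in> carrier_vec n \<Longrightarrow> del * (w \<bullet> (mat_inv C *\<^sub>v w)) \<le> w \<bullet> (P *\<^sub>v w)"
    and v: "v \<in> carrier_vec n"
  shows "v \<bullet> (mat_inv P *\<^sub>v v) \<le> v \<bullet> (C *\<^sub>v v) / del"
proof -
  have Pc: "P \<in> carrier_mat n n" and Cc: "C \<in> carrier_mat n n" "transpose_mat C = C"
    using P C by (auto simp: pos_def_mat_def)
  note iP = pos_def_inverse[OF P] and iC = pos_def_inverse[OF C]
  define w where "w = mat_inv P *\<^sub>v v"
  have w: "w \<in> carrier_vec n" using iP v by (simp add: w_def)
  have Pw: "P *\<^sub>v w = v" using Pc iP v by (simp add: w_def assoc_mult_mat_vec[symmetric, of P n n _ n])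
  \<comment> \<open>Once \<open>w \<bullet> C\<^sup>-\<^sup>1 w\<close> is replaced by its bound \<open>(v \<bullet> w) / del\<close>, the factor \<open>del\<close> is the optimal one.\<close>
  define x where "x = (- del) \<cdot>\<^sub>v (mat_inv C *\<^sub>v w)"
  have iw: "mat_inv C *\<^sub>v w \<in> carrier_vec n" using iC w by simp
  have x: "x \<in> carrier_vec n" using iw by (simp add: x_def)
  have Cx: "C *\<^sub>v x = (- del) \<cdot>\<^sub>v w"
    using iC iw w Cc mult_mat_vec[OF Cc(1) iw, of "- del"] assoc_mult_mat_vec[OF Cc(1) iC(1) w]
    by (simp add: x_def)
  have "0 \<le> (v + x) \<bullet> (C *\<^sub>v (v + x))"
    using pos_def_imp_pos_semidef[OF C] v x by (simp add: pos_semidef_mat_def)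
  also have "\<dots> = v \<bullet> (C *\<^sub>v v) - 2 * del * (v \<bullet> w) + del * (del * (w \<bullet> (mat_inv C *\<^sub>v w)))"
    unfolding quadratic_form_add[OF Cc v x] Cx
    using v w iw comm_scalar_prod[OF iw w] by (simp add: x_def)
  also have "del * (w \<bullet> (mat_inv C *\<^sub>v w)) \<le> v \<bullet> w"
    using dom[OF w] Pw comm_scalar_prod[OF w v] by simp
  finally have "0 \<le> v \<bullet> (C *\<^sub>v v) - del * (v \<bullet> w)" using del by (simp add: mult_left_mono)
  then show ?thesis using del by (simp add: w_def field_simps)
qed

context
  fixes N :: nat and s :: real and e :: "nat \<Rightarrow> real vec"
  assumes s: "s > 0" and onb: "orthonormal_basis N s e"
begin

definition basis_mat :: "real mat" where "basis_mat = mat N N (\<lambda>(i, j). e j $ i)"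

lemma basis_carrier: "j < N \<Longrightarrow> e j \<in> carrier_vec N"
  using onb by (simp add: orthonormal_basis_def)

lemma basis_mat_carrier [simp]: "basis_mat \<in> carrier_mat N N" by (simp add: basis_mat_def)

lemma basis_mat_mult_carrier [simp]:
  "v \<in> carrier_vec N \<Longrightarrow> basis_mat *\<^sub>v v \<in> carrier_vec N"
  "v \<in> carrier_vec N \<Longrightarrow> transpose_mat basis_mat *\<^sub>v v \<in> carrier_vec N"
  by (rule mult_mat_vec_carrier[of _ N N]; simp)+

lemma basis_mat_col: "j < N \<Longrightarrow> col basis_mat j = e j"
  using basis_carrier[of j] by (intro eq_vecI) (auto simp: basis_mat_def)

lemma basis_mat_gram: "transpose_mat basis_mat * basis_mat = (1 / s) \<cdot>\<^sub>m 1\<^sub>m N"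
proof (rule eq_matI)
  fix i j assume "i < dim_row ((1 / s) \<cdot>\<^sub>m 1\<^sub>m N)" "j < dim_col ((1 / s) \<cdot>\<^sub>m 1\<^sub>m N)"
  then have ij: "i < N" "j < N" by auto
  have "(transpose_mat basis_mat * basis_mat) $$ (i, j) = row (transpose_mat basis_mat) i \<bullet> col basis_mat j"
    using ij carrier_matD[OF basis_mat_carrier] by simp
  also have "\<dots> = e i \<bullet> e j" using ij carrier_matD[OF basis_mat_carrier] by (simp add: basis_mat_col)
  also have "\<dots> = ((1 / s) \<cdot>\<^sub>m 1\<^sub>m N) $$ (i, j)"
    using onb s ij by (auto simp: orthonormal_basis_def scaled_inner_def field_simps split: if_splits)
  finally show "(transpose_mat basis_mat * basis_mat) $$ (i, j) = ((1 / s) \<cdot>\<^sub>m 1\<^sub>m N) $$ (i, j)" .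
qed (use carrier_matD[OF basis_mat_carrier] in auto)

text \<open>\<open>E\<^sup>T E = 1/s\<close> implies \<open>E E\<^sup>T = 1/s\<close>; this is what turns norms of vectors into variances of linear
  forms in the noise coordinates.\<close>

lemma parseval:
  assumes g: "g \<in> carrier_vec N"
  shows "(\<Sum>j<N. (g \<bullet> e j)\<^sup>2) = (g \<bullet> g) / s"
proof -
  let ?E = "basis_mat"
  have Et: "transpose_mat ?E \<in> carrier_mat N N" by simp
  have "(s \<cdot>\<^sub>m transpose_mat ?E) * ?E = 1\<^sub>m N"
    using s by (simp add: mult_smult_assoc_mat[of _ N N _ N] basis_mat_gram)
      (intro eq_matI, auto)
  then have "?E * (s \<cdot>\<^sub>m transpose_mat ?E) = 1\<^sub>m N"
    by (rule mat_mult_left_right_inverse[rotated 2]) auto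
  then have EE: "s \<cdot>\<^sub>m (?E * transpose_mat ?E) = 1\<^sub>m N"
    by (simp add: mult_smult_distrib[of _ N N _ N])
  define h where "h = transpose_mat ?E *\<^sub>v g"
  have h: "h \<in> carrier_vec N" using g by (simp add: h_def)
  have hj: "h $ j = g \<bullet> e j" if "j < N" for j
    using that g basis_carrier[OF that] carrier_matD[OF basis_mat_carrier]
    by (simp add: h_def basis_mat_col comm_scalar_prod[of g N])
  have "(\<Sum>j<N. (g \<bullet> e j)\<^sup>2) = h \<bullet> h"
    using h hj by (simp add: scalar_prod_def atLeast0LessThan power2_eq_square)
  also have "\<dots> = g \<bullet> (?E *\<^sub>v h)"
    using transpose_vec_mult_scalar[OF basis_mat_carrier h g] comm_scalar_prod[of g N "?E *\<^sub>v h"] g h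
    by (simp add: h_def comm_scalar_prod[of _ N])
  also have "?E *\<^sub>v h = (?E * transpose_mat ?E) *\<^sub>v g"
    unfolding h_def by (rule assoc_mult_mat_vec[of _ N N _ N, symmetric]) (use g in auto)
  also have "s * (g \<bullet> ((?E * transpose_mat ?E) *\<^sub>v g)) = g \<bullet> ((s \<cdot>\<^sub>m (?E * transpose_mat ?E)) *\<^sub>v g)"
  proof -
    have EEc: "?E * transpose_mat ?E \<in> carrier_mat N N" by (rule mult_carrier_mat[of _ N N]) auto
    then have "dim_vec ((?E * transpose_mat ?E) *\<^sub>v g) = dim_vec g"
      using g carrier_matD[OF basis_mat_carrier] by simp
    then show ?thesis using smult_mat_mult_mat_vec_assoc[OF EEc g] by (simp del: assoc_mult_mat_vec)
  qed
  then have "g \<bullet> ((?E * transpose_mat ?E) *\<^sub>v g) = (g \<bullet> g) / s"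
    using s g unfolding EE by (simp add: field_simps)
  finally show ?thesis .
qed

lemma white_noise_eq: "onb L = e \<Longrightarrow> white_noise N L z = basis_mat *\<^sub>v vec N z"
  by (rule eq_vecI)
    (auto simp: white_noise_def basis_mat_def scalar_prod_def atLeast0LessThan mult.commute)

lemma basis_expansion_scalar_prod:
  assumes g: "g \<in> carrier_vec N"
  shows "g \<bullet> (basis_mat *\<^sub>v vec N z) = (\<Sum>j<N. (g \<bullet> e j) * z j)"
proof -
  have "g \<bullet> (basis_mat *\<^sub>v vec N z) = (basis_mat *\<^sub>v vec N z) \<bullet> g"
    by (rule comm_scalar_prod[OF g]) simp
  also have "\<dots> = vec N z \<bullet> (transpose_mat basis_mat *\<^sub>v g)"
    using transpose_vec_mult_scalar[OF basis_mat_carrier, of "vec N z" g] g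
      comm_scalar_prod[of "vec N z" N "transpose_mat basis_mat *\<^sub>v g"]
      comm_scalar_prod[of "basis_mat *\<^sub>v vec N z" N g] by simp
  also have "\<dots> = (\<Sum>j<N. (g \<bullet> e j) * z j)"
    using g carrier_matD[OF basis_mat_carrier] basis_carrier
    by (simp add: scalar_prod_def[of "vec N z"] atLeast0LessThan basis_mat_col
        comm_scalar_prod[of g N] mult.commute)
  finally show ?thesis .
qed

lemma basis_expansion_norm:
  "s * ((basis_mat *\<^sub>v vec N z) \<bullet> (basis_mat *\<^sub>v vec N z)) = (\<Sum>j<N. (z j)\<^sup>2)"
proof -
  let ?E = "basis_mat" and ?z = "vec N z"
  have "(?E *\<^sub>v ?z) \<bullet> (?E *\<^sub>v ?z) = (transpose_mat ?E *\<^sub>v (?E *\<^sub>v ?z)) \<bullet> ?z"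
    by (rule transpose_vec_mult_scalar[OF basis_mat_carrier, symmetric]) auto
  also have "transpose_mat ?E *\<^sub>v (?E *\<^sub>v ?z) = (transpose_mat ?E * ?E) *\<^sub>v ?z"
    by (rule assoc_mult_mat_vec[of _ N N _ N, symmetric]) auto
  also have "\<dots> = (1 / s) \<cdot>\<^sub>v ?z"
    unfolding basis_mat_gram by (subst smult_mat_mult_mat_vec_assoc[of _ N N]) auto
  finally have "(?E *\<^sub>v ?z) \<bullet> (?E *\<^sub>v ?z) = (1 / s) * (?z \<bullet> ?z)" by simp
  then show ?thesis using s by (simp add: scalar_prod_def atLeast0LessThan power2_eq_square)
qed

end

lemma post_prec_quadratic:
  assumes L: "valid_level N L" and v: "v \<in> carrier_vec N"
  shows "v \<bullet> (post_prec L lam del *\<^sub>v v)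
    = lam * ((fwd L *\<^sub>v v) \<bullet> (mat_inv (cov1 L) *\<^sub>v (fwd L *\<^sub>v v))) + del * (v \<bullet> (mat_inv (cov0 L) *\<^sub>v v))"
proof -
  let ?K = "fwd L" and ?C1 = "mat_inv (cov1 L)" and ?C0 = "mat_inv (cov0 L)"
  have K: "?K \<in> carrier_mat N N" and C1: "?C1 \<in> carrier_mat N N" and C0: "?C0 \<in> carrier_mat N N"
    using L mat_inv_carrier by (auto simp: valid_level_def)
  have Kv: "?K *\<^sub>v v \<in> carrier_vec N" using K v by simp
  have w: "?C1 *\<^sub>v (?K *\<^sub>v v) \<in> carrier_vec N" using C1 Kv by simp
  have H: "transpose_mat ?K * ?C1 * ?K \<in> carrier_mat N N" using K C1 by simp
  have "post_prec L lam del *\<^sub>v v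
      = lam \<cdot>\<^sub>v ((transpose_mat ?K * ?C1 * ?K) *\<^sub>v v) + del \<cdot>\<^sub>v (?C0 *\<^sub>v v)"
    unfolding post_prec_def using H C0 v
    by (simp add: add_mult_distrib_mat_vec[of _ N N] smult_mat_mult_mat_vec_assoc[of _ N N] del: assoc_mult_mat)
  moreover have "(transpose_mat ?K * ?C1 * ?K) *\<^sub>v v = transpose_mat ?K *\<^sub>v (?C1 *\<^sub>v (?K *\<^sub>v v))"
    using K C1 v by (simp add: assoc_mult_mat_vec[of _ N N _ N])
  moreover have "v \<bullet> (transpose_mat ?K *\<^sub>v (?C1 *\<^sub>v (?K *\<^sub>v v))) = (?K *\<^sub>v v) \<bullet> (?C1 *\<^sub>v (?K *\<^sub>v v))"
    using transpose_vec_mult_scalar[OF K v w] comm_scalar_prod[OF Kv w] K w v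
      comm_scalar_prod[of v N "transpose_mat ?K *\<^sub>v (?C1 *\<^sub>v (?K *\<^sub>v v))"] by simp
  ultimately show ?thesis
    using v K C0 w by (simp add: scalar_prod_add_distrib[of _ N])
qed

lemma post_prec_pos_def:
  assumes L: "valid_level N L" and lam: "lam > 0" and del: "del > 0"
  shows "pos_def_mat N (post_prec L lam del)"
    and "v \<in> carrier_vec N \<Longrightarrow> del * (v \<bullet> (mat_inv (cov0 L) *\<^sub>v v)) \<le> v \<bullet> (post_prec L lam del *\<^sub>v v)"
proof -
  let ?K = "fwd L" and ?C1 = "mat_inv (cov1 L)" and ?C0 = "mat_inv (cov0 L)"
  have K: "?K \<in> carrier_mat N N" using L by (simp add: valid_level_def)
  have pd: "pos_def_mat N ?C1" "pos_def_mat N ?C0"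
    using L pos_def_mat_inv by (auto simp: valid_level_def)
  then have c: "?C1 \<in> carrier_mat N N" "transpose_mat ?C1 = ?C1" "?C0 \<in> carrier_mat N N" "transpose_mat ?C0 = ?C0"
    by (auto simp: pos_def_mat_def)
  show ge: "del * (v \<bullet> (?C0 *\<^sub>v v)) \<le> v \<bullet> (post_prec L lam del *\<^sub>v v)" if "v \<in> carrier_vec N" for v
    unfolding post_prec_quadratic[OF L that]
    using pos_def_imp_pos_semidef[OF pd(1)] K that lam by (auto simp: pos_semidef_mat_def)
  have H: "transpose_mat ?K * ?C1 * ?K \<in> carrier_mat N N" using K c by simp
  have tH: "transpose_mat (transpose_mat ?K * ?C1 * ?K) = transpose_mat ?K * ?C1 * ?K"
    using K c by (simp add: transpose_mult[of _ N N _ N])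
  have "transpose_mat (post_prec L lam del) = post_prec L lam del"
    unfolding post_prec_def
    by (subst transpose_add[of _ N N]) (use H tH c in \<open>auto simp: transpose_smult simp del: assoc_mult_mat\<close>)
  moreover have "0 < v \<bullet> (post_prec L lam del *\<^sub>v v)" if v: "v \<in> carrier_vec N" "v \<noteq> 0\<^sub>v N" for v
  proof -
    have "0 < del * (v \<bullet> (?C0 *\<^sub>v v))" using pd(2) v del by (simp add: pos_def_mat_def)
    with ge[OF v(1)] show ?thesis by linarith
  qed
  ultimately show "pos_def_mat N (post_prec L lam del)"
    using H c by (simp add: pos_def_mat_def post_prec_def del: assoc_mult_mat)
qed

text \<open>The rate as an explicit quadratic polynomial in the noise coordinates. The identity \<open>R P R = 1\<close> lets
  the quadratic form of \<open>C\<^sub>0\<^sup>-\<^sup>1\<close> at \<open>R \<zeta>\<close> be replaced by a multiple of \<open>\<zeta>\<close>'s squared norm minus a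
  multiple of the form of \<open>K\<^sup>* C\<^sub>1\<^sup>-\<^sup>1 K\<close> at \<open>R \<zeta>\<close>. The rows \<open>r\<^sub>i\<close> of \<open>C\<^sub>1\<^bsup>-1/2\<^esup> K\<close> write the latter as a sum of
  squares, and the bound \<open>R\<^sup>2 \<le> C\<^sub>0 / \<delta>\<close> makes the coefficients square-summable uniformly in the dimension.\<close>

lemma gamma_rate_representation:
  assumes L: "valid_level N L" and y: "y \<in> carrier_vec N" and lam: "lam > 0" and del: "del > 0"
    and c1: "scaled_norm (scal L) (cov0_inv_sqrt L *\<^sub>v post_mean L lam del y) \<le> c1"
    and c2: "mat_trace (cov1_inv_sqrt L * fwd L * cov0 L * transpose_mat (fwd L) * cov1_inv_sqrt L) \<le> c2"
  obtains \<kappa> :: real and b :: "nat \<Rightarrow> real" and d :: "nat \<Rightarrow> nat \<Rightarrow> real" where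
    "0 \<le> \<kappa>" "\<kappa> \<le> c1\<^sup>2 / 2" "(\<Sum>j<N. (b j)\<^sup>2) \<le> c1\<^sup>2 / del"
    "(\<Sum>i<N. \<Sum>j<N. (d i j)\<^sup>2) \<le> lam * c2 / del\<^sup>2"
    "\<And>z b0. gamma_rate N L b0 lam del y z = b0 + \<kappa> + (\<Sum>j<N. b j * z j)
       + 1 / (2 * del) * (\<Sum>j<N. (z j)\<^sup>2) - 1/2 * (\<Sum>i<N. (\<Sum>j<N. d i j * z j)\<^sup>2)"
proof -
  define s where "s = scal L"
  define e where "e = onb L"
  have s: "s > 0" and onb: "orthonormal_basis N s e"
    using L by (auto simp: valid_level_def s_def e_def)
  note Ec = basis_mat_mult_carrier[OF s onb]
  let ?E = "basis_mat N e"
  define K where "K = fwd L"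
  define C0 where "C0 = cov0 L"
  define I0 where "I0 = mat_inv C0"
  define I1 where "I1 = mat_inv (cov1 L)"
  define S0 where "S0 = cov0_inv_sqrt L"
  define S1 where "S1 = cov1_inv_sqrt L"
  define P where "P = post_prec L lam del"
  define C where "C = post_cov L lam del"
  define R where "R = mat_sqrt C"
  have K: "K \<in> carrier_mat N N" using L by (simp add: valid_level_def K_def)
  have C0pd: "pos_def_mat N C0" and C1pd: "pos_def_mat N (cov1 L)"
    using L by (auto simp: valid_level_def C0_def)
  have Ppd: "pos_def_mat N P" unfolding P_def by (rule post_prec_pos_def(1)[OF L lam del])
  have CP: "C = mat_inv P" by (simp add: C_def P_def post_cov_def)
  have Cpd: "pos_def_mat N C" unfolding CP by (rule pos_def_mat_inv[OF Ppd])
  have Rpd: "pos_def_mat N R" unfolding R_def by (rule pos_def_mat_sqrt[OF Cpd])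
  have S0pd: "pos_def_mat N S0"
    unfolding S0_def cov0_inv_sqrt_def C0_def[symmetric]
    by (rule pos_def_mat_inv[OF pos_def_mat_sqrt[OF C0pd]])
  have S1pd: "pos_def_mat N S1"
    unfolding S1_def cov1_inv_sqrt_def by (rule pos_def_mat_inv[OF pos_def_mat_sqrt[OF C1pd]])
  have c: "C0 \<in> carrier_mat N N" "P \<in> carrier_mat N N" "C \<in> carrier_mat N N" "R \<in> carrier_mat N N"
      "S0 \<in> carrier_mat N N" "S1 \<in> carrier_mat N N" "I0 \<in> carrier_mat N N" "I1 \<in> carrier_mat N N"
    using C0pd Ppd Cpd Rpd S0pd S1pd mat_inv_carrier[OF C0pd] mat_inv_carrier[OF C1pd]
    by (auto simp: pos_def_mat_def I0_def I1_def)
  have t: "transpose_mat C0 = C0" "transpose_mat P = P" "transpose_mat C = C" "transpose_mat R = R"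
      "transpose_mat S0 = S0" "transpose_mat S1 = S1"
    using C0pd Ppd Cpd Rpd S0pd S1pd by (auto simp: pos_def_mat_def)
  have mc [simp]: "A *\<^sub>v x \<in> carrier_vec N" if "A \<in> carrier_mat N N" "x \<in> carrier_vec N" for A :: "real mat" and x
    using that by simp
  have RR: "R * R = C" unfolding R_def by (rule mat_sqrt_square[OF Cpd])
  have SS0: "S0 * S0 = I0"
    unfolding S0_def cov0_inv_sqrt_def C0_def[symmetric] I0_def by (rule inv_sqrt_square[OF C0pd])
  have SS1: "S1 * S1 = I1"
    unfolding S1_def cov1_inv_sqrt_def I1_def by (rule inv_sqrt_square[OF C1pd])
  \<comment> \<open>\<open>P R\<^sup>2 = 1\<close>, and a one-sided inverse of a square matrix is two-sided, which moves one factor to the left.\<close>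
  have "(P * R) * R = 1\<^sub>m N"
    using c RR mat_inv_right[OF Ppd] by (simp add: assoc_mult_mat[of _ N N _ N _ N] CP)
  then have "R * (P * R) = 1\<^sub>m N"
    using mat_mult_left_right_inverse[of "P * R" N R] c by simp
  then have RPR: "R *\<^sub>v (P *\<^sub>v (R *\<^sub>v x)) = x" if "x \<in> carrier_vec N" for x
    using c that assoc_mult_mat_vec[of R N N "P * R" N x] assoc_mult_mat_vec[of P N N R N x] by simp
  have Cle: "x \<bullet> (C *\<^sub>v x) \<le> x \<bullet> (C0 *\<^sub>v x) / del" if "x \<in> carrier_vec N" for x
    unfolding CP
    by (rule inverse_antimono_quadratic[OF Ppd C0pd del])
      (use post_prec_pos_def(2)[OF L lam del] that in \<open>auto simp: P_def C0_def\<close>)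
  define m where "m = S0 *\<^sub>v post_mean L lam del y"
  have pm: "post_mean L lam del y \<in> carrier_vec N"
  proof -
    have "transpose_mat K * I1 \<in> carrier_mat N N" using K c by simp
    then show ?thesis
      unfolding post_mean_def using y c by (simp add: C_def K_def I1_def)
  qed
  have m: "m \<in> carrier_vec N" using c pm by (simp add: m_def)
  have c1': "s * (m \<bullet> m) \<le> c1\<^sup>2"
  proof -
    have "sqrt (s * (m \<bullet> m)) \<le> c1"
      using c1 by (simp add: scaled_norm_def scaled_inner_def m_def S0_def s_def)
    moreover have "s * (m \<bullet> m) \<ge> 0" using s scalar_prod_self_nonneg[of m] by simp
    ultimately show ?thesis by (metis sqrt_le_D)
  qed
  define g where "g = R *\<^sub>v (S0 *\<^sub>v m)"
  have g: "g \<in> carrier_vec N" using c m by (simp add: g_def)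
  have gg: "g \<bullet> g \<le> (m \<bullet> m) / del"
  proof -
    have S0m: "S0 *\<^sub>v m \<in> carrier_vec N" using c m by simp
    have "g \<bullet> g = (S0 *\<^sub>v m) \<bullet> (C *\<^sub>v (S0 *\<^sub>v m))"
      unfolding g_def using scalar_prod_mult_sym[OF c(4) t(4) S0m S0m] RR by simp
    also have "\<dots> \<le> (S0 *\<^sub>v m) \<bullet> (C0 *\<^sub>v (S0 *\<^sub>v m)) / del" by (rule Cle[OF S0m])
    also have "(S0 *\<^sub>v m) \<bullet> (C0 *\<^sub>v (S0 *\<^sub>v m)) = m \<bullet> (S0 *\<^sub>v (C0 *\<^sub>v (S0 *\<^sub>v m)))"
      using sym_scalar_prod_swap[OF c(5) t(5) m, of "C0 *\<^sub>v (S0 *\<^sub>v m)"] c S0m by simp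
    also have "S0 *\<^sub>v (C0 *\<^sub>v (S0 *\<^sub>v m)) = m"
    proof -
      have "(C0 * S0) * S0 = 1\<^sub>m N"
        using c SS0 mat_inv_right[OF C0pd] by (simp add: assoc_mult_mat[of _ N N _ N _ N] I0_def)
      then have "S0 * (C0 * S0) = 1\<^sub>m N"
        using mat_mult_left_right_inverse[of "C0 * S0" N S0] c by simp
      then show ?thesis
        using c m assoc_mult_mat_vec[of S0 N N "C0 * S0" N m] assoc_mult_mat_vec[of C0 N N S0 N m] by simp
    qed
    finally show ?thesis .
  qed
  \<comment> \<open>The rows of \<open>S1 * K\<close> give the linear forms whose squares make up the data-misfit part.\<close>
  define r where "r = (\<lambda>i. row (S1 * K) i)"
  have SK: "S1 * K \<in> carrier_mat N N" using c K by simp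
  have r: "r i \<in> carrier_vec N" if "i < N" for i
    unfolding r_def by (rule row_carrier_vec[OF that SK])
  have Rr: "R *\<^sub>v r i \<in> carrier_vec N" if "i < N" for i using r[OF that] c by simp
  define \<kappa> where "\<kappa> = s * (m \<bullet> m) / 2"
  define b where "b = (\<lambda>j. s * (g \<bullet> e j))"
  define d where "d = (\<lambda>i j. sqrt (lam * s / del) * ((R *\<^sub>v r i) \<bullet> e j))"
  show ?thesis
  proof (rule that[of \<kappa> b d])
    show "0 \<le> \<kappa>" using s scalar_prod_self_nonneg[of m] by (simp add: \<kappa>_def)
    show "\<kappa> \<le> c1\<^sup>2 / 2" using c1' by (simp add: \<kappa>_def)
    have "(\<Sum>j<N. (b j)\<^sup>2) = s\<^sup>2 * (\<Sum>j<N. (g \<bullet> e j)\<^sup>2)"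
      by (simp add: b_def power_mult_distrib sum_distrib_left)
    also have "\<dots> = s * (g \<bullet> g)"
      unfolding parseval[OF s onb g] using s by (simp add: power2_eq_square)
    also have "\<dots> \<le> s * ((m \<bullet> m) / del)" using gg s by (intro mult_left_mono) auto
    also have "\<dots> \<le> c1\<^sup>2 / del" using c1' del by (simp add: divide_right_mono)
    finally show "(\<Sum>j<N. (b j)\<^sup>2) \<le> c1\<^sup>2 / del" .
    have dsum: "(\<Sum>j<N. (d i j)\<^sup>2) \<le> lam / del\<^sup>2 * (r i \<bullet> (C0 *\<^sub>v r i))" if i: "i < N" for i
    proof -
      have "(\<Sum>j<N. (d i j)\<^sup>2) = lam * s / del * (\<Sum>j<N. ((R *\<^sub>v r i) \<bullet> e j)\<^sup>2)"
        using lam s del by (simp add: d_def power_mult_distrib sum_distrib_left)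
      also have "\<dots> = lam / del * ((R *\<^sub>v r i) \<bullet> (R *\<^sub>v r i))"
        unfolding parseval[OF s onb Rr[OF i]] using s by simp
      also have "(R *\<^sub>v r i) \<bullet> (R *\<^sub>v r i) = r i \<bullet> (C *\<^sub>v r i)"
        using scalar_prod_mult_sym[OF c(4) t(4) r[OF i] r[OF i]] RR by simp
      also have "lam / del * (r i \<bullet> (C *\<^sub>v r i)) \<le> lam / del * (r i \<bullet> (C0 *\<^sub>v r i) / del)"
        using Cle[OF r[OF i]] lam del by (intro mult_left_mono) auto
      finally show ?thesis by (simp add: power2_eq_square)
    qed
    have tr: "(\<Sum>i<N. r i \<bullet> (C0 *\<^sub>v r i)) \<le> c2"
    proof -
      have "S1 * K * C0 * transpose_mat K * S1 = (S1 * K) * C0 * transpose_mat (S1 * K)"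
        using c K t(6) by (simp add: transpose_mult[of _ N N _ N] assoc_mult_mat[of _ N N _ N _ N])
      then have "mat_trace (S1 * K * C0 * transpose_mat K * S1) = (\<Sum>i<N. r i \<bullet> (C0 *\<^sub>v r i))"
        unfolding mat_trace_def using diag_entry_sandwich[OF c(1) SK] carrier_matD(1)[OF SK]
        by (intro sum.cong) (auto simp: r_def simp del: index_mult_mat(1))
      then show ?thesis using c2 by (simp add: S1_def K_def C0_def)
    qed
    have "(\<Sum>i<N. \<Sum>j<N. (d i j)\<^sup>2) \<le> (\<Sum>i<N. lam / del\<^sup>2 * (r i \<bullet> (C0 *\<^sub>v r i)))"
      by (rule sum_mono) (use dsum in auto)
    also have "\<dots> \<le> lam / del\<^sup>2 * c2"
      unfolding sum_distrib_left[symmetric] using tr lam by (intro mult_left_mono) auto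
    finally show "(\<Sum>i<N. \<Sum>j<N. (d i j)\<^sup>2) \<le> lam * c2 / del\<^sup>2" by simp
  next
    fix z b0
    define \<zeta> where "\<zeta> = ?E *\<^sub>v vec N z"
    have \<zeta>: "\<zeta> \<in> carrier_vec N" unfolding \<zeta>_def by (rule Ec) simp
    have wn: "white_noise N L z = \<zeta>"
      unfolding \<zeta>_def by (rule white_noise_eq[OF s onb]) (simp add: e_def)
    define x where "x = R *\<^sub>v \<zeta>"
    have x: "x \<in> carrier_vec N" using c \<zeta> by (simp add: x_def)
    have S0x: "S0 *\<^sub>v x \<in> carrier_vec N" using c x by simp
    have Kx: "K *\<^sub>v x \<in> carrier_vec N" using K x by simp
    have S1Kx: "S1 *\<^sub>v (K *\<^sub>v x) \<in> carrier_vec N" using c Kx by simp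
    have "S0 *\<^sub>v u_draw N L lam del y z = m + S0 *\<^sub>v x"
      unfolding u_draw_def wn using c pm x
      by (simp add: mult_add_distrib_mat_vec[of _ N N] m_def x_def R_def C_def)
    then have rate: "gamma_rate N L b0 lam del y z = b0 + 1/2 * (s * ((m + S0 *\<^sub>v x) \<bullet> (m + S0 *\<^sub>v x)))"
      using s scalar_prod_self_nonneg[of "m + S0 *\<^sub>v x"]
      by (simp add: gamma_rate_def scaled_norm_def scaled_inner_def S0_def s_def)
    have sq: "(m + S0 *\<^sub>v x) \<bullet> (m + S0 *\<^sub>v x) = m \<bullet> m + 2 * (m \<bullet> (S0 *\<^sub>v x)) + (S0 *\<^sub>v x) \<bullet> (S0 *\<^sub>v x)"
      using m S0x comm_scalar_prod[OF m S0x]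
      by (simp add: add_scalar_prod_distrib[of _ N] scalar_prod_add_distrib[of _ N])
    have lin: "m \<bullet> (S0 *\<^sub>v x) = g \<bullet> \<zeta>"
      using sym_scalar_prod_swap[OF c(5) t(5) m x] sym_scalar_prod_swap[OF c(4) t(4), of "S0 *\<^sub>v m" \<zeta>] c m \<zeta>
      by (simp add: g_def x_def)
    have quad0: "(S0 *\<^sub>v x) \<bullet> (S0 *\<^sub>v x) = x \<bullet> (I0 *\<^sub>v x)"
      using scalar_prod_mult_sym[OF c(5) t(5) x x] SS0 by simp
    have quad1: "(K *\<^sub>v x) \<bullet> (I1 *\<^sub>v (K *\<^sub>v x)) = (S1 *\<^sub>v (K *\<^sub>v x)) \<bullet> (S1 *\<^sub>v (K *\<^sub>v x))"
      using scalar_prod_mult_sym[OF c(6) t(6) Kx Kx] SS1 by simp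
    have "x \<bullet> (P *\<^sub>v x) = \<zeta> \<bullet> (R *\<^sub>v (P *\<^sub>v (R *\<^sub>v \<zeta>)))"
      unfolding x_def using sym_scalar_prod_swap[OF c(4) t(4) \<zeta>, of "P *\<^sub>v (R *\<^sub>v \<zeta>)"] c \<zeta> by simp
    then have "\<zeta> \<bullet> \<zeta> = x \<bullet> (P *\<^sub>v x)" using RPR[OF \<zeta>] by simp
    also have "\<dots> = lam * ((K *\<^sub>v x) \<bullet> (I1 *\<^sub>v (K *\<^sub>v x))) + del * (x \<bullet> (I0 *\<^sub>v x))"
      unfolding P_def K_def I1_def I0_def C0_def by (rule post_prec_quadratic[OF L x])
    finally have split: "x \<bullet> (I0 *\<^sub>v x) = (\<zeta> \<bullet> \<zeta>) / del - lam / del * ((S1 *\<^sub>v (K *\<^sub>v x)) \<bullet> (S1 *\<^sub>v (K *\<^sub>v x)))"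
      using del unfolding quad1 by (simp add: field_simps)
    have comp: "(S1 *\<^sub>v (K *\<^sub>v x)) $ i = (\<Sum>j<N. ((R *\<^sub>v r i) \<bullet> e j) * z j)" if i: "i < N" for i
    proof -
      have "S1 *\<^sub>v (K *\<^sub>v x) = (S1 * K) *\<^sub>v x" using c K x by simp
      then have "(S1 *\<^sub>v (K *\<^sub>v x)) $ i = r i \<bullet> x" using i SK carrier_matD(1)[OF SK] by (simp add: r_def)
      also have "\<dots> = (R *\<^sub>v r i) \<bullet> \<zeta>"
        unfolding x_def using sym_scalar_prod_swap[OF c(4) t(4) r[OF i] \<zeta>] by simp
      also have "\<dots> = (\<Sum>j<N. ((R *\<^sub>v r i) \<bullet> e j) * z j)"
        unfolding \<zeta>_def by (rule basis_expansion_scalar_prod[OF s onb Rr[OF i]])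
      finally show ?thesis .
    qed
    have "(\<Sum>i<N. (\<Sum>j<N. d i j * z j)\<^sup>2) = (\<Sum>i<N. lam * s / del * ((S1 *\<^sub>v (K *\<^sub>v x)) $ i)\<^sup>2)"
    proof (rule sum.cong[OF refl])
      fix i assume "i \<in> {..<N}"
      then have i: "i < N" by simp
      have "(\<Sum>j<N. d i j * z j) = sqrt (lam * s / del) * (S1 *\<^sub>v (K *\<^sub>v x)) $ i"
        unfolding comp[OF i] d_def sum_distrib_left by (simp add: mult.assoc)
      then show "(\<Sum>j<N. d i j * z j)\<^sup>2 = lam * s / del * ((S1 *\<^sub>v (K *\<^sub>v x)) $ i)\<^sup>2"
        using lam s del by (simp add: power_mult_distrib)
    qed
    also have "\<dots> = lam * s / del * ((S1 *\<^sub>v (K *\<^sub>v x)) \<bullet> (S1 *\<^sub>v (K *\<^sub>v x)))"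
      using carrier_vecD[OF S1Kx]
      by (simp add: scalar_prod_def[of "S1 *\<^sub>v (K *\<^sub>v x)" "S1 *\<^sub>v (K *\<^sub>v x)"] atLeast0LessThan
          power2_eq_square sum_distrib_left del: dim_mult_mat_vec index_mult_mat_vec)
    finally have Q: "(\<Sum>i<N. (\<Sum>j<N. d i j * z j)\<^sup>2) = lam * s / del * ((S1 *\<^sub>v (K *\<^sub>v x)) \<bullet> (S1 *\<^sub>v (K *\<^sub>v x)))" .
    have B: "(\<Sum>j<N. b j * z j) = s * (g \<bullet> \<zeta>)"
      unfolding \<zeta>_def basis_expansion_scalar_prod[OF s onb g] b_def sum_distrib_left by (simp add: mult.assoc)
    have Z: "(\<Sum>j<N. (z j)\<^sup>2) = s * (\<zeta> \<bullet> \<zeta>)"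
      unfolding \<zeta>_def by (rule basis_expansion_norm[OF s onb, symmetric])
    show "gamma_rate N L b0 lam del y z = b0 + \<kappa> + (\<Sum>j<N. b j * z j)
       + 1 / (2 * del) * (\<Sum>j<N. (z j)\<^sup>2) - 1/2 * (\<Sum>i<N. (\<Sum>j<N. d i j * z j)\<^sup>2)"
      unfolding rate sq lin quad0 split Q B Z \<kappa>_def by (simp add: field_simps)
  qed
qed

section \<open>Moments of Gaussian forms\<close>

lemma power_le_fact_exp:
  "\<bar>x\<bar> ^ n \<le> fact n * (exp x + exp (- x))" for x :: real
proof -
  have pos: "y ^ n / fact n \<le> exp y" if "y \<ge> 0" for y :: real
  proof -
    have "(\<lambda>k. y ^ k / fact k) sums exp y"
      using exp_converges[of y] by (simp add: divide_inverse mult.commute)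
    then have "sum (\<lambda>k. y ^ k / fact k) {n} \<le> exp y"
      using that sum_le_suminf[of "\<lambda>k. y ^ k / fact k" "{n}"] by (auto simp: sums_iff)
    then show ?thesis by simp
  qed
  have "\<bar>x\<bar> ^ n \<le> fact n * exp \<bar>x\<bar>" using pos[of "\<bar>x\<bar>"] by (simp add: field_simps)
  also have "\<dots> \<le> fact n * (exp x + exp (- x))" by (intro mult_left_mono) (auto simp: abs_if)
  finally show ?thesis .
qed

lemma gauss_prob: "prob_space std_normal_distribution" by (rule prob_space_normal_density) simp

lemma gauss_one: "has_bochner_integral std_normal_distribution (\<lambda>x. 1 :: real) 1"
  using std_normal_distribution_even_moments[of 0] by (simp add: has_bochner_integral_iff)

text \<open>Completing the square: tilting the standard normal density by \<open>e\<^bsup>b x\<^esup>\<close> shifts its mean to \<open>b\<close>.\<close>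

lemma gauss_mgf: "has_bochner_integral std_normal_distribution (\<lambda>x. exp (b * x)) (exp (b\<^sup>2 / 2))"
proof -
  have "has_bochner_integral lborel (normal_density b 1) 1"
    by (simp add: has_bochner_integral_iff)
  then have "has_bochner_integral lborel (\<lambda>x. normal_density b 1 x * exp (b\<^sup>2 / 2)) (1 * exp (b\<^sup>2 / 2))"
    by (rule has_bochner_integral_mult_left)
  moreover have "normal_density b 1 x * exp (b\<^sup>2 / 2) = std_normal_density x *\<^sub>R exp (b * x)" for x
    unfolding normal_density_def
    by (simp add: exp_add[symmetric] mult.assoc) (simp add: power2_eq_square field_simps)
  ultimately show ?thesis
    by (intro has_bochner_integral_density) auto
qed

text \<open>Tilting by \<open>e\<^bsup>t x\<^sup>2\<^esup>\<close> only changes the variance, to \<open>1 / (1 - 2 t)\<close>.\<close>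

lemma gauss_square_mgf:
  assumes t: "t < 1/2"
  shows "has_bochner_integral std_normal_distribution (\<lambda>x. exp (t * (x\<^sup>2 - 1))) (exp (- t) / sqrt (1 - 2 * t))"
proof -
  define \<sigma> where "\<sigma> = 1 / sqrt (1 - 2 * t)"
  have \<sigma>: "\<sigma> > 0" "\<sigma>\<^sup>2 = 1 / (1 - 2 * t)" using t by (auto simp: \<sigma>_def power_divide)
  have "has_bochner_integral lborel (normal_density 0 \<sigma>) 1"
    using \<sigma> by (simp add: has_bochner_integral_iff)
  then have "has_bochner_integral lborel (\<lambda>x. normal_density 0 \<sigma> x * (exp (- t) * \<sigma>)) (1 * (exp (- t) * \<sigma>))"
    by (rule has_bochner_integral_mult_left)
  moreover have "normal_density 0 \<sigma> x * (exp (- t) * \<sigma>) = std_normal_density x *\<^sub>R exp (t * (x\<^sup>2 - 1))" for x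
  proof -
    have "- (x - 0)\<^sup>2 / (2 * \<sigma>\<^sup>2) + - t = - x\<^sup>2 / 2 + t * (x\<^sup>2 - 1)"
      using t unfolding \<sigma>(2) by (simp add: field_simps)
    then have e: "exp (- (x - 0)\<^sup>2 / (2 * \<sigma>\<^sup>2)) * exp (- t) = exp (- x\<^sup>2 / 2) * exp (t * (x\<^sup>2 - 1))"
      by (simp only: exp_add[symmetric])
    have "sqrt (2 * pi * \<sigma>\<^sup>2) = sqrt (2 * pi) * \<sigma>"
      using \<sigma>(1) by (simp add: real_sqrt_mult)
    then have "normal_density 0 \<sigma> x * (exp (- t) * \<sigma>)
        = 1 / sqrt (2 * pi) * (exp (- (x - 0)\<^sup>2 / (2 * \<sigma>\<^sup>2)) * exp (- t))"
      unfolding normal_density_def using \<sigma>(1) by simp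
    then show ?thesis unfolding e by (simp add: std_normal_density_def)
  qed
  ultimately show ?thesis
    by (intro has_bochner_integral_density) (auto simp: \<sigma>_def)
qed

lemma gauss_square_mgf_le:
  assumes t: "\<bar>t\<bar> \<le> 1/4"
  shows "exp (- t) / sqrt (1 - 2 * t) \<le> exp (4 * t\<^sup>2)"
proof -
  have p: "1 - 2 * t > 0" using t by linarith
  have "\<bar>ln (1 + (- 2 * t)) - (- 2 * t)\<bar> \<le> 2 * (- 2 * t)\<^sup>2"
    by (rule abs_ln_one_plus_x_minus_x_bound) (use t in simp)
  then have "- t - ln (1 - 2 * t) / 2 \<le> 4 * t\<^sup>2" by (simp add: power_mult_distrib)
  then have "exp (- t - ln (1 - 2 * t) / 2) \<le> exp (4 * t\<^sup>2)" by simp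
  moreover have "sqrt (1 - 2 * t) = exp (ln (1 - 2 * t) / 2)"
    using p by (simp add: powr_half_sqrt[symmetric] powr_def)
  ultimately show ?thesis by (simp add: exp_diff)
qed

lemma gauss_centred_square:
  "has_bochner_integral std_normal_distribution (\<lambda>x. x\<^sup>2 - 1) 0"
  "has_bochner_integral std_normal_distribution (\<lambda>x. (x\<^sup>2 - 1) * (x\<^sup>2 - 1)) 2"
proof -
  note 0 = gauss_one
  have 2: "has_bochner_integral std_normal_distribution (\<lambda>x. x\<^sup>2) 1"
    using std_normal_distribution_even_moments[of 1] by (simp add: has_bochner_integral_iff)
  have 4: "has_bochner_integral std_normal_distribution (\<lambda>x. x ^ 4) 3"
    using std_normal_distribution_even_moments[of 2] by (simp add: has_bochner_integral_iff fact_numeral)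
  show "has_bochner_integral std_normal_distribution (\<lambda>x. x\<^sup>2 - 1) 0"
    using has_bochner_integral_diff[OF 2 0] by simp
  have "has_bochner_integral std_normal_distribution (\<lambda>x. x ^ 4 - 2 * x\<^sup>2 + 1) (3 - 2 * 1 + 1)"
    by (intro has_bochner_integral_add has_bochner_integral_diff has_bochner_integral_mult_right 0 2 4) 
  moreover have "x ^ 4 - 2 * x\<^sup>2 + 1 = (x\<^sup>2 - 1) * (x\<^sup>2 - 1)" for x :: real
    by (simp add: algebra_simps power2_eq_square power4_eq_xxxx)
  ultimately show "has_bochner_integral std_normal_distribution (\<lambda>x. (x\<^sup>2 - 1) * (x\<^sup>2 - 1)) 2" by simp
qed

lemma std_normals_prob: "prob_space (std_normals N)"
  unfolding std_normals_def by (rule prob_space_PiM) (rule gauss_prob)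

lemma std_normals_measurable [measurable]:
  "j < N \<Longrightarrow> (\<lambda>z. z j) \<in> borel_measurable (std_normals N)"
  unfolding std_normals_def
  using measurable_component_singleton[of j "{..<N}" "\<lambda>_. std_normal_distribution"] by simp

lemma std_normals_prod:
  fixes f :: "nat \<Rightarrow> real \<Rightarrow> real"
  assumes "\<And>j. j < N \<Longrightarrow> has_bochner_integral std_normal_distribution (f j) (c j)"
  shows "has_bochner_integral (std_normals N) (\<lambda>z. \<Prod>j<N. f j (z j)) (\<Prod>j<N. c j)"
proof -
  interpret product_sigma_finite "\<lambda>_::nat. std_normal_distribution"
    by (simp add: product_sigma_finite_def prob_space_imp_sigma_finite gauss_prob)
  have i: "integrable std_normal_distribution (f j)" "integral\<^sup>L std_normal_distribution (f j) = c j" if "j < N" for j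
    using assms[OF that] by (auto simp: has_bochner_integral_iff)
  show ?thesis
    unfolding std_normals_def has_bochner_integral_iff
    using product_integrable_prod[of "{..<N}" f] product_integral_prod[of "{..<N}" f] i by auto
qed

lemma centred_chi_square_mean: "has_bochner_integral (std_normals N) (\<lambda>z. \<Sum>j<N. ((z j)\<^sup>2 - 1)) 0"
proof -
  note one = gauss_one
  have "has_bochner_integral (std_normals N) (\<lambda>z. (z i)\<^sup>2 - 1) 0" if i: "i < N" for i
  proof -
    have "has_bochner_integral (std_normals N) (\<lambda>z. \<Prod>j<N. if j = i then (z j)\<^sup>2 - 1 else 1)
        (\<Prod>j<N. if j = i then 0 else 1)"
    proof (rule std_normals_prod)
      fix j show "has_bochner_integral std_normal_distribution (\<lambda>x. if j = i then x\<^sup>2 - 1 else 1) (if j = i then 0 else 1)"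
        using gauss_centred_square(1) one by (cases "j = i") auto
    qed
    then show ?thesis using i by (simp add: prod.delta)
  qed
  then have "has_bochner_integral (std_normals N) (\<lambda>z. \<Sum>j<N. ((z j)\<^sup>2 - 1)) (\<Sum>j<N. 0)"
    by (intro has_bochner_integral_sum) auto
  then show ?thesis by simp
qed

lemma centred_chi_square_variance:
  "has_bochner_integral (std_normals N) (\<lambda>z. (\<Sum>j<N. ((z j)\<^sup>2 - 1))\<^sup>2) (2 * real N)"
proof -
  note one = gauss_one
  have "has_bochner_integral (std_normals N) (\<lambda>z. ((z i)\<^sup>2 - 1) * ((z k)\<^sup>2 - 1)) (if i = k then 2 else 0)"
    if i: "i < N" and k: "k < N" for i k
  proof -
    \<comment> \<open>A product of one-coordinate functions in which \<open>i\<close> and \<open>k\<close> may coincide.\<close>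
    let ?f = "\<lambda>j x. (if j = i then x\<^sup>2 - 1 else 1) * (if j = k then x\<^sup>2 - 1 else 1 :: real)"
    let ?c = "\<lambda>j. if i = k then (if j = i then 2 else 1) else (if j = i then 0 else if j = k then 0 else (1::real))"
    have "has_bochner_integral (std_normals N) (\<lambda>z. \<Prod>j<N. ?f j (z j)) (\<Prod>j<N. ?c j)"
    proof (rule std_normals_prod)
      fix j show "has_bochner_integral std_normal_distribution (?f j) (?c j)"
        using gauss_centred_square one by auto
    qed
    moreover have "(\<Prod>j<N. ?f j (z j)) = ((z i)\<^sup>2 - 1) * ((z k)\<^sup>2 - 1)" for z :: "nat \<Rightarrow> real"
      using i k by (simp add: prod.distrib prod.delta)
    moreover have "(\<Prod>j<N. ?c j) = (if i = k then 2 else 0)"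
      using i k by (cases "i = k") (auto simp: prod.delta intro: prod_zero)
    ultimately show ?thesis by simp
  qed
  then have "has_bochner_integral (std_normals N) (\<lambda>z. \<Sum>i<N. \<Sum>k<N. ((z i)\<^sup>2 - 1) * ((z k)\<^sup>2 - 1))
      (\<Sum>i<N. \<Sum>k<N. if i = k then 2 else 0)"
    by (intro has_bochner_integral_sum) auto
  then show ?thesis by (simp add: power2_eq_square sum_product mult.commute[of 2 "real N"])
qed

text \<open>Control of the moment generating function at \<open>1\<close> and \<open>-1\<close> controls all even moments at once, which
  replaces the combinatorics of mixed moments.\<close>

lemma moment_from_mgf:
  assumes [measurable]: "X \<in> borel_measurable M"
    and p: "integrable M (\<lambda>x. exp (X x))" "(\<integral>x. exp (X x) \<partial>M) \<le> c"
    and m: "integrable M (\<lambda>x. exp (- X x))" "(\<integral>x. exp (- X x) \<partial>M) \<le> c"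
    and n: "even n"
  shows "integrable M (\<lambda>x. (X x :: real) ^ n)" "(\<integral>x. X x ^ n \<partial>M) \<le> 2 * fact n * c"
proof -
  have int: "integrable M (\<lambda>x. fact n * (exp (X x) + exp (- X x)))" using p m by simp
  have le: "X x ^ n \<le> fact n * (exp (X x) + exp (- X x))" for x
    using power_le_fact_exp[of "X x" n] n by (simp add: power_even_abs)
  show i: "integrable M (\<lambda>x. X x ^ n)"
    by (rule Bochner_Integration.integrable_bound[OF int])
      (use le n in \<open>auto simp: zero_le_even_power abs_mult intro!: AE_I2 order_trans[OF le]\<close>)
  have "(\<integral>x. X x ^ n \<partial>M) \<le> (\<integral>x. fact n * (exp (X x) + exp (- X x)) \<partial>M)"
    by (rule integral_mono[OF i int le])
  also have "\<dots> = fact n * ((\<integral>x. exp (X x) \<partial>M) + (\<integral>x. exp (- X x) \<partial>M))" using p m by simp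
  also have "\<dots> \<le> fact n * (c + c)" using p m by (intro mult_left_mono add_mono) auto
  finally show "(\<integral>x. X x ^ n \<partial>M) \<le> 2 * fact n * c" by simp
qed

lemma linear_form_mgf:
  "has_bochner_integral (std_normals N) (\<lambda>z. exp (\<Sum>j<N. b j * z j)) (exp ((\<Sum>j<N. (b j)\<^sup>2) / 2))"
  using std_normals_prod[of N "\<lambda>j x. exp (b j * x)" "\<lambda>j. exp ((b j)\<^sup>2 / 2)", OF gauss_mgf]
  by (simp add: exp_sum sum_divide_distrib)

lemma linear_form_moment:
  assumes b: "(\<Sum>j<N. (b j)\<^sup>2) \<le> V" and V: "V > 0" and n: "even n"
  shows "integrable (std_normals N) (\<lambda>z. (\<Sum>j<N. b j * z j) ^ n)"
    and "(\<integral>z. (\<Sum>j<N. b j * z j) ^ n \<partial>std_normals N) \<le> 2 * fact n * exp (1/2) * sqrt V ^ n"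
proof -
  \<comment> \<open>Rescaled to variance at most 1, the form has its generating function at \<open>\<plusminus>1\<close> bounded by \<open>e\<^bsup>1/2\<^esup>\<close>.\<close>
  define a where "a = (\<lambda>j. b j / sqrt V)"
  have asum: "(\<Sum>j<N. (a j)\<^sup>2) \<le> 1"
    using b V by (simp add: a_def power_divide sum_divide_distrib[symmetric])
  have meas: "(\<lambda>z. \<Sum>j<N. a j * z j) \<in> borel_measurable (std_normals N)" by measurable
  have i1: "integrable (std_normals N) (\<lambda>z. exp (\<Sum>j<N. a j * z j))"
      "(\<integral>z. exp (\<Sum>j<N. a j * z j) \<partial>std_normals N) \<le> exp (1/2)"
    using linear_form_mgf[of N a] asum by (auto simp: has_bochner_integral_iff)
  have i2: "integrable (std_normals N) (\<lambda>z. exp (- (\<Sum>j<N. a j * z j)))"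
      "(\<integral>z. exp (- (\<Sum>j<N. a j * z j)) \<partial>std_normals N) \<le> exp (1/2)"
    using linear_form_mgf[of N "\<lambda>j. - a j"] asum by (auto simp: has_bochner_integral_iff sum_negf)
  note m = moment_from_mgf[OF meas i1 i2 n]
  have eq: "(\<Sum>j<N. b j * z j) ^ n = sqrt V ^ n * (\<Sum>j<N. a j * z j) ^ n" for z :: "nat \<Rightarrow> real"
    unfolding power_mult_distrib[symmetric] sum_distrib_left using V by (simp add: a_def)
  show "integrable (std_normals N) (\<lambda>z. (\<Sum>j<N. b j * z j) ^ n)"
    unfolding eq using m(1) by simp
  have "sqrt V ^ n * (\<integral>z. (\<Sum>j<N. a j * z j) ^ n \<partial>std_normals N) \<le> sqrt V ^ n * (2 * fact n * exp (1/2))"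
    using m(2) V by (intro mult_left_mono) auto
  then show "(\<integral>z. (\<Sum>j<N. b j * z j) ^ n \<partial>std_normals N) \<le> 2 * fact n * exp (1/2) * sqrt V ^ n"
    unfolding eq by (simp add: mult_ac)
qed

text \<open>The scale \<open>t = 1 / (4 \<surd>N)\<close> is small enough for \<open>gauss_square_mgf_le\<close> and balances the product
  over the coordinates: \<open>e\<^bsup>4 t\<^sup>2\<^esup>\<close> to the power \<open>N\<close> is the constant \<open>e\<^bsup>1/4\<^esup>\<close>.\<close>

lemma centred_chi_square_moment:
  assumes N: "N \<ge> 1" and n: "even n"
  shows "integrable (std_normals N) (\<lambda>z. (\<Sum>j<N. ((z j)\<^sup>2 - 1)) ^ n)"
    and "(\<integral>z. (\<Sum>j<N. ((z j)\<^sup>2 - 1)) ^ n \<partial>std_normals N) \<le> 2 * fact n * exp (1/4) * (4 * sqrt N) ^ n"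
proof -
  define t where "t = 1 / (4 * sqrt N)"
  have t: "0 < t" "t \<le> 1/4" "4 * real N * t\<^sup>2 = 1/4"
    using N by (auto simp: t_def field_simps power2_eq_square)
  have mgf: "integrable (std_normals N) (\<lambda>z. exp (u * (\<Sum>j<N. ((z j)\<^sup>2 - 1)))) \<and>
      (\<integral>z. exp (u * (\<Sum>j<N. ((z j)\<^sup>2 - 1))) \<partial>std_normals N) \<le> exp (1/4)" if u: "u = t \<or> u = - t" for u
  proof -
    have u': "\<bar>u\<bar> \<le> 1/4" "u\<^sup>2 = t\<^sup>2" using u t by auto
    then have "has_bochner_integral (std_normals N) (\<lambda>z. \<Prod>j<N. exp (u * ((z j)\<^sup>2 - 1)))
        (\<Prod>j<N. exp (- u) / sqrt (1 - 2 * u))"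
      by (intro std_normals_prod gauss_square_mgf) linarith
    then have h: "has_bochner_integral (std_normals N) (\<lambda>z. exp (u * (\<Sum>j<N. ((z j)\<^sup>2 - 1))))
        ((exp (- u) / sqrt (1 - 2 * u)) ^ N)"
      by (simp add: exp_sum sum_distrib_left)
    have "(exp (- u) / sqrt (1 - 2 * u)) ^ N \<le> exp (4 * u\<^sup>2) ^ N"
      using u' by (intro power_mono gauss_square_mgf_le) (auto simp: abs_le_iff)
    also have "\<dots> = exp (1/4)" using u' t by (simp add: exp_of_nat_mult[symmetric] mult_ac)
    finally show ?thesis using h by (auto simp: has_bochner_integral_iff)
  qed
  have meas: "(\<lambda>z. t * (\<Sum>j<N. ((z j)\<^sup>2 - 1))) \<in> borel_measurable (std_normals N)" by measurable
  have m: "integrable (std_normals N) (\<lambda>z. (t * (\<Sum>j<N. ((z j)\<^sup>2 - 1))) ^ n)"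
    "(\<integral>z. (t * (\<Sum>j<N. ((z j)\<^sup>2 - 1))) ^ n \<partial>std_normals N) \<le> 2 * fact n * exp (1/4)"
    using mgf[of t] mgf[of "- t"] by (auto intro!: moment_from_mgf[OF meas _ _ _ _ n])
  have eq: "(\<Sum>j<N. ((z j)\<^sup>2 - 1)) ^ n = (4 * sqrt N) ^ n * (t * (\<Sum>j<N. ((z j)\<^sup>2 - 1))) ^ n"
    for z :: "nat \<Rightarrow> real"
    unfolding power_mult_distrib[symmetric] using N by (simp add: t_def)
  show "integrable (std_normals N) (\<lambda>z. (\<Sum>j<N. ((z j)\<^sup>2 - 1)) ^ n)"
    by (subst eq) (use m(1) in simp)
  have "(\<integral>z. (\<Sum>j<N. ((z j)\<^sup>2 - 1)) ^ n \<partial>std_normals N)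
      = (4 * sqrt N) ^ n * (\<integral>z. (t * (\<Sum>j<N. ((z j)\<^sup>2 - 1))) ^ n \<partial>std_normals N)"
    by (subst eq) simp
  also have "\<dots> \<le> (4 * sqrt N) ^ n * (2 * fact n * exp (1/4))"
    using m(2) by (intro mult_left_mono) auto
  finally show "(\<integral>z. (\<Sum>j<N. ((z j)\<^sup>2 - 1)) ^ n \<partial>std_normals N) \<le> 2 * fact n * exp (1/4) * (4 * sqrt N) ^ n"
    by (simp add: mult_ac)
qed

text \<open>Jensen's inequality with weights proportional to the variances of the forms. The weights are shifted by
  \<open>1/N\<close> so that forms that vanish identically still get a positive weight; this costs the \<open>+ 1\<close> in the bound.\<close>

lemma square_sum_moment:
  fixes d :: "nat \<Rightarrow> nat \<Rightarrow> real"
  assumes N: "N \<ge> 1" and d: "(\<Sum>i<N. \<Sum>j<N. (d i j)\<^sup>2) \<le> \<tau>" and n: "even n"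
  shows "integrable (std_normals N) (\<lambda>z. (\<Sum>i<N. (\<Sum>j<N. d i j * z j)\<^sup>2) ^ n)"
    and "(\<integral>z. (\<Sum>i<N. (\<Sum>j<N. d i j * z j)\<^sup>2) ^ n \<partial>std_normals N)
      \<le> 2 * fact (2 * n) * exp (1/2) * (\<tau> + 1) ^ n"
proof -
  define q where "q = (\<lambda>i. \<Sum>j<N. (d i j)\<^sup>2)"
  define T where "T = (\<Sum>i<N. q i)"
  \<comment> \<open>\<open>T + 1\<close> is the sum of the numerators.\<close>
  define w where "w = (\<lambda>i. (q i + 1 / N) / (T + 1))"
  have q: "q i \<ge> 0" for i by (simp add: q_def sum_nonneg)
  have T: "T \<ge> 0" "T \<le> \<tau>" using q d by (auto simp: T_def q_def intro: sum_nonneg)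
  have wpos: "w i > 0" for i using q[of i] T N by (simp add: w_def add_nonneg_pos)
  have w1: "(\<Sum>i<N. w i) = 1"
    using T N by (simp add: w_def sum_divide_distrib[symmetric] sum.distrib T_def[symmetric])
  have qw: "(\<Sum>j<N. (d i j / sqrt (w i))\<^sup>2) \<le> \<tau> + 1" for i
  proof -
    have "q i \<le> w i * (T + 1)" using T N by (simp add: w_def)
    also have "\<dots> \<le> w i * (\<tau> + 1)" using T wpos[of i] by (intro mult_left_mono) auto
    finally have "q i / w i \<le> \<tau> + 1" using wpos[of i] by (simp add: field_simps)
    then show ?thesis using wpos[of i] by (simp add: power_divide sum_divide_distrib[symmetric] q_def)
  qed
  have V: "\<tau> + 1 > 0" using T by simp
  let ?M = "std_normals N"
  let ?B = "2 * fact (2 * n) * exp (1/2) * (\<tau> + 1) ^ n"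
  let ?h = "\<lambda>i z. (\<Sum>j<N. d i j / sqrt (w i) * z j) ^ (2 * n)"
  have h: "integrable ?M (?h i)" "(\<integral>z. ?h i z \<partial>?M) \<le> ?B" for i
    using linear_form_moment[OF qw[of i] V, of "2 * n"] V
    by (auto simp: power_mult)
  have jensen: "(\<Sum>i<N. (\<Sum>j<N. d i j * z j)\<^sup>2) ^ n \<le> (\<Sum>i<N. w i * ?h i z)" for z :: "nat \<Rightarrow> real"
  proof -
    have sq: "(\<Sum>j<N. d i j * z j)\<^sup>2 = w i * (\<Sum>j<N. d i j / sqrt (w i) * z j)\<^sup>2" for i
    proof -
      have "(\<Sum>j<N. d i j * z j) = sqrt (w i) * (\<Sum>j<N. d i j / sqrt (w i) * z j)"
        unfolding sum_distrib_left using wpos[of i] by (intro sum.cong) (auto simp: less_imp_neq[symmetric])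
      then show ?thesis using wpos[of i] by (simp add: power_mult_distrib)
    qed
    have "(\<Sum>i<N. w i *\<^sub>R (\<Sum>j<N. d i j / sqrt (w i) * z j)\<^sup>2) ^ n
        \<le> (\<Sum>i<N. w i * ((\<Sum>j<N. d i j / sqrt (w i) * z j)\<^sup>2) ^ n)"
      by (rule convex_on_sum[OF _ _ convex_power_even[OF n]])
        (use N w1 wpos in \<open>auto simp: less_imp_le\<close>)
    then show ?thesis unfolding sq by (simp add: power_mult)
  qed
  have ih: "integrable ?M (\<lambda>z. \<Sum>i<N. w i * ?h i z)" using h by auto
  have nn: "(\<Sum>i<N. (\<Sum>j<N. d i j * z j)\<^sup>2) ^ n \<ge> 0" for z :: "nat \<Rightarrow> real"
    using n by (simp add: zero_le_even_power)
  show int: "integrable ?M (\<lambda>z. (\<Sum>i<N. (\<Sum>j<N. d i j * z j)\<^sup>2) ^ n)"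
    by (rule Bochner_Integration.integrable_bound[OF ih])
      (use jensen nn in \<open>auto intro!: AE_I2 order_trans[OF jensen]\<close>)
  have "(\<integral>z. (\<Sum>i<N. (\<Sum>j<N. d i j * z j)\<^sup>2) ^ n \<partial>?M) \<le> (\<integral>z. (\<Sum>i<N. w i * ?h i z) \<partial>?M)"
    by (rule integral_mono[OF int ih jensen])
  also have "\<dots> = (\<Sum>i<N. w i * (\<integral>z. ?h i z \<partial>?M))" using h by simp
  also have "\<dots> \<le> (\<Sum>i<N. w i * ?B)"
    using h wpos by (intro sum_mono mult_left_mono) (auto simp: less_imp_le)
  also have "\<dots> = ?B" unfolding sum_distrib_right[symmetric] w1 by simp
  finally show "(\<integral>z. (\<Sum>i<N. (\<Sum>j<N. d i j * z j)\<^sup>2) ^ n \<partial>?M) \<le> ?B" .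
qed

section \<open>Expansion of inverse moments\<close>

lemma abs_power_le_one_plus:
  assumes "k \<le> 8" shows "\<bar>t\<bar> ^ k \<le> 1 + (t :: real) ^ 8"
proof (cases "\<bar>t\<bar> \<le> 1")
  case True
  then have "\<bar>t\<bar> ^ k \<le> 1" by (simp add: power_le_one)
  then show ?thesis by (simp add: add_increasing2 zero_le_even_power)
next
  case False
  then have "\<bar>t\<bar> ^ k \<le> \<bar>t\<bar> ^ 8" using assms by (intro power_increasing) auto
  then show ?thesis by (simp add: power_even_abs)
qed

text \<open>Here \<open>x = h t\<close> with \<open>h = N\<^bsup>-1/2\<^esup>\<close>. For \<open>x \<ge> -1/2\<close> the remainders are of order \<open>\<bar>x\<bar>\<^sup>3\<close>.
  For \<open>x < -1/2\<close> the denominators are bounded below by powers of \<open>c h\<^sup>2\<close>, which is made up for by the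
  factors \<open>(2 \<bar>x\<bar>)\<^sup>2 \<ge> 1\<close> and \<open>(2 \<bar>x\<bar>)\<^sup>4 \<ge> 1\<close> respectively.\<close>

lemma inverse_taylor_bounds:
  fixes h t c :: real
  assumes h: "0 < h" and c: "c > 0" and low: "1 + h * t \<ge> c * h\<^sup>2"
  shows "\<bar>1 / (1 + h * t) - (1 - h * t + (h * t)\<^sup>2)\<bar> \<le> (2 + 4 / c) * h ^ 3 * (1 + t ^ 8)"
    and "\<bar>1 / (1 + h * t)\<^sup>2 - (1 - 2 * (h * t) + 3 * (h * t)\<^sup>2)\<bar>
      \<le> (28 + 64 / c\<^sup>2) * (h ^ 3 * (1 + h)) * (1 + t ^ 8)"
proof -
  define x where "x = h * t"
  have ch: "c * h\<^sup>2 > 0" using h c by simp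
  have x1: "1 + x > 0" using low ch by (simp add: x_def)
  have ax: "\<bar>x\<bar> ^ k = h ^ k * \<bar>t\<bar> ^ k" for k using h by (simp add: x_def abs_mult power_mult_distrib)
  have tk: "\<bar>t\<bar> ^ k \<le> 1 + t ^ 8" if "k \<le> 8" for k using abs_power_le_one_plus[OF that] .
  have t8: "1 + t ^ 8 \<ge> 0" by (simp add: add_nonneg_nonneg zero_le_even_power)
  have bnd: "h ^ j * \<bar>t\<bar> ^ k \<le> h ^ j * (1 + t ^ 8)" if "k \<le> 8" for j k
    using tk[OF that] h by (intro mult_left_mono) auto
  have b: "h ^ 3 * \<bar>t\<bar> ^ 3 \<le> h ^ 3 * (1 + t ^ 8)" "h ^ 4 * \<bar>t\<bar> ^ 4 \<le> h ^ 4 * (1 + t ^ 8)"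
      "h ^ 3 * \<bar>t\<bar> ^ 5 \<le> h ^ 3 * (1 + t ^ 8)" "h ^ 3 * \<bar>t\<bar> ^ 7 \<le> h ^ 3 * (1 + t ^ 8)"
    by (rule bnd; simp)+
  have e1: "1 / (1 + x) - (1 - x + x\<^sup>2) = - (x ^ 3) / (1 + x)"
    using x1 by (simp add: field_simps power2_eq_square power3_eq_cube)
  have e2: "1 / (1 + x)\<^sup>2 - (1 - 2 * x + 3 * x\<^sup>2) = - (x ^ 3 * (4 + 3 * x)) / (1 + x)\<^sup>2"
  proof -
    have "(1 + x)\<^sup>2 * (1 - 2 * x + 3 * x\<^sup>2) = 1 + x ^ 3 * (4 + 3 * x)"
      by (simp add: algebra_simps power2_eq_square power3_eq_cube)
    then have "1 - 2 * x + 3 * x\<^sup>2 = (1 + x ^ 3 * (4 + 3 * x)) / (1 + x)\<^sup>2"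
      using x1 by (simp add: eq_divide_eq mult.commute)
    then show ?thesis by (simp add: diff_divide_distrib[symmetric])
  qed
  show "\<bar>1 / (1 + h * t) - (1 - h * t + (h * t)\<^sup>2)\<bar> \<le> (2 + 4 / c) * h ^ 3 * (1 + t ^ 8)"
  proof -
    have "\<bar>1 / (1 + x) - (1 - x + x\<^sup>2)\<bar> = \<bar>x\<bar> ^ 3 / (1 + x)"
      unfolding e1 using x1 by (simp add: abs_divide power_abs)
    also have "\<dots> \<le> 2 * (h ^ 3 * (1 + t ^ 8)) + 4 / c * (h ^ 3 * (1 + t ^ 8))"
    proof (cases "x \<ge> - 1/2")
      case True
      have "\<bar>x\<bar> ^ 3 / (1 + x) \<le> \<bar>x\<bar> ^ 3 / (1/2)"
        using True by (intro divide_left_mono) auto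
      also have "\<dots> \<le> 2 * (h ^ 3 * (1 + t ^ 8))" using b(1) unfolding ax by simp
      also have "\<dots> \<le> \<dots> + 4 / c * (h ^ 3 * (1 + t ^ 8))" using c h t8 by simp
      finally show ?thesis .
    next
      case False
      have "1 \<le> (2 * \<bar>x\<bar>) ^ 2" by (rule one_le_power) (use False in auto)
      then have "\<bar>x\<bar> ^ 3 * 1 \<le> \<bar>x\<bar> ^ 3 * (2 * \<bar>x\<bar>) ^ 2" by (intro mult_left_mono) auto
      also have "\<dots> = 4 * \<bar>x\<bar> ^ 5" by (simp only: power_mult_distrib) (simp add: eval_nat_numeral)
      finally have "\<bar>x\<bar> ^ 3 \<le> 4 * \<bar>x\<bar> ^ 5" by simp
      then have "\<bar>x\<bar> ^ 3 / (1 + x) \<le> 4 * \<bar>x\<bar> ^ 5 / (c * h\<^sup>2)"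
        using low ch by (intro frac_le) (auto simp: x_def)
      also have "\<dots> = 4 / c * (h ^ 3 * \<bar>t\<bar> ^ 5)"
      proof -
        have "4 * (h ^ 5 * u) / (c * h\<^sup>2) = 4 / c * (h ^ 3 * u)" for u
          using h c by (simp add: field_simps eval_nat_numeral)
        then show ?thesis unfolding ax .
      qed
      also have "\<dots> \<le> 4 / c * (h ^ 3 * (1 + t ^ 8))" by (rule mult_left_mono[OF b(3)]) (use c in auto)
      also have "\<dots> \<le> 2 * (h ^ 3 * (1 + t ^ 8)) + \<dots>" using h t8 by simp
      finally show ?thesis .
    qed
    also have "\<dots> = (2 + 4 / c) * h ^ 3 * (1 + t ^ 8)" by (simp only: distrib_right mult.assoc)
    finally show ?thesis by (simp only: x_def)
  qed
  show "\<bar>1 / (1 + h * t)\<^sup>2 - (1 - 2 * (h * t) + 3 * (h * t)\<^sup>2)\<bar>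
      \<le> (28 + 64 / c\<^sup>2) * (h ^ 3 * (1 + h)) * (1 + t ^ 8)"
  proof -
    let ?E = "h ^ 3 * (1 + h) * (1 + t ^ 8)"
    have E3: "h ^ 3 * (1 + t ^ 8) \<le> ?E" using h t8 by (simp add: mult_left_mono mult_right_mono)
    have E4: "h ^ 4 * (1 + t ^ 8) \<le> ?E"
    proof -
      have "h ^ 4 \<le> h ^ 3 * (1 + h)" using h by (simp add: eval_nat_numeral algebra_simps)
      then show ?thesis using t8 by (rule mult_right_mono)
    qed
    have Enn: "?E \<ge> 0" using h t8 by simp
    have pos: "4 + 3 * x > 0" using x1 by linarith
    have "\<bar>1 / (1 + x)\<^sup>2 - (1 - 2 * x + 3 * x\<^sup>2)\<bar> = \<bar>x\<bar> ^ 3 * (4 + 3 * x) / (1 + x)\<^sup>2"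
      unfolding e2 using x1 pos by (simp add: abs_divide abs_mult power_abs)
    also have "\<dots> \<le> 28 * ?E + 64 / c\<^sup>2 * ?E"
    proof (cases "x \<ge> - 1/2")
      case True
      have "(1/2)\<^sup>2 \<le> (1 + x)\<^sup>2" using True by (intro power_mono) auto
      then have "\<bar>x\<bar> ^ 3 * (4 + 3 * x) / (1 + x)\<^sup>2 \<le> \<bar>x\<bar> ^ 3 * (4 + 3 * \<bar>x\<bar>) / (1/2)\<^sup>2"
        using pos by (intro frac_le mult_left_mono) auto
      also have "\<dots> = 16 * \<bar>x\<bar> ^ 3 + 12 * \<bar>x\<bar> ^ 4"
        by (simp add: power2_eq_square algebra_simps eval_nat_numeral)
      also have "\<dots> \<le> 16 * ?E + 12 * ?E"
        using b(1,2) E3 E4 unfolding ax by linarith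
      also have "\<dots> \<le> 28 * ?E + 64 / c\<^sup>2 * ?E" using Enn c by simp
      finally show ?thesis .
    next
      case False
      have "1 \<le> (2 * \<bar>x\<bar>) ^ 4" by (rule one_le_power) (use False in auto)
      then have "\<bar>x\<bar> ^ 3 * 1 \<le> \<bar>x\<bar> ^ 3 * (2 * \<bar>x\<bar>) ^ 4" by (intro mult_left_mono) auto
      also have "\<dots> = 16 * \<bar>x\<bar> ^ 7" by (simp only: power_mult_distrib) (simp add: eval_nat_numeral)
      finally have "\<bar>x\<bar> ^ 3 * (4 + 3 * x) \<le> (16 * \<bar>x\<bar> ^ 7) * 4"
        using False pos by (intro mult_mono) auto
      moreover have "(c * h\<^sup>2)\<^sup>2 \<le> (1 + x)\<^sup>2" using low ch by (intro power_mono) (auto simp: x_def)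
      ultimately have "\<bar>x\<bar> ^ 3 * (4 + 3 * x) / (1 + x)\<^sup>2 \<le> (16 * \<bar>x\<bar> ^ 7) * 4 / (c * h\<^sup>2)\<^sup>2"
        using ch by (intro frac_le) auto
      also have "\<dots> = 64 / c\<^sup>2 * (h ^ 3 * \<bar>t\<bar> ^ 7)"
      proof -
        have "(16 * (h ^ 7 * u)) * 4 / (c * h\<^sup>2)\<^sup>2 = 64 / c\<^sup>2 * (h ^ 3 * u)" for u
          using h c by (simp add: field_simps eval_nat_numeral)
        then show ?thesis unfolding ax .
      qed
      also have "\<dots> \<le> 64 / c\<^sup>2 * ?E"
        by (rule mult_left_mono[OF order_trans[OF b(4) E3]]) simp
      also have "\<dots> \<le> 28 * ?E + \<dots>" using Enn by simp
      finally show ?thesis .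
    qed
    also have "\<dots> = (28 + 64 / c\<^sup>2) * ?E" by (rule distrib_right[symmetric])
    also have "\<dots> = (28 + 64 / c\<^sup>2) * (h ^ 3 * (1 + h)) * (1 + t ^ 8)" by (simp only: mult.assoc)
    finally show ?thesis by (simp only: x_def)
  qed
qed

lemma (in prob_space) lower_moments:
  fixes X :: "'a \<Rightarrow> real"
  assumes [measurable]: "X \<in> borel_measurable M" and i: "integrable M (\<lambda>x. X x ^ 8)" and k: "k \<le> 8"
  shows "integrable M (\<lambda>x. X x ^ k)" and "expectation (\<lambda>x. \<bar>X x\<bar> ^ k) \<le> 1 + expectation (\<lambda>x. X x ^ 8)"
proof -
  have j: "integrable M (\<lambda>x. 1 + X x ^ 8)" using i by simp
  have le: "\<bar>X x\<bar> ^ k \<le> 1 + X x ^ 8" for x by (rule abs_power_le_one_plus[OF k])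
  show "integrable M (\<lambda>x. X x ^ k)"
    by (rule Bochner_Integration.integrable_bound[OF j])
      (auto simp: power_abs intro!: AE_I2 order_trans[OF le])
  have a: "integrable M (\<lambda>x. \<bar>X x\<bar> ^ k)"
    by (rule Bochner_Integration.integrable_bound[OF j])
      (auto simp: power_abs intro!: AE_I2 order_trans[OF le])
  have "expectation (\<lambda>x. \<bar>X x\<bar> ^ k) \<le> expectation (\<lambda>x. 1 + X x ^ 8)"
    by (rule integral_mono[OF a j le])
  then show "expectation (\<lambda>x. \<bar>X x\<bar> ^ k) \<le> 1 + expectation (\<lambda>x. X x ^ 8)"
    using i by (simp add: prob_space)
qed

text \<open>In the application \<open>h = N\<^bsup>-1/2\<^esup>\<close>, \<open>Y\<close> is the normalised chi-square fluctuation and \<open>F\<close> the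
  rate remainder. The mean of \<open>Y\<close> vanishes, so \<open>F\<close> enters at order \<open>h\<^sup>2\<close> through its mean only; the mixed
  moment of \<open>Y\<close> and \<open>F\<close>, estimated by \<open>2 \<bar>Y F\<bar> \<le> Y\<^sup>2 + F\<^sup>2\<close>, contributes at order \<open>h\<^sup>3\<close>.\<close>

lemma (in prob_space) inverse_moment_expansion:
  fixes Y F :: "'a \<Rightarrow> real" and h del c :: real
  assumes meas [measurable]: "Y \<in> borel_measurable M" "F \<in> borel_measurable M"
    and h: "0 < h" "h \<le> 1" and del: "del > 0" and c: "c > 0"
    and Y1: "has_bochner_integral M Y 0"
    and Y2: "has_bochner_integral M (\<lambda>x. (Y x)\<^sup>2) 2"
    and Y8: "integrable M (\<lambda>x. Y x ^ 8)" "expectation (\<lambda>x. Y x ^ 8) \<le> CY"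
    and F8: "integrable M (\<lambda>x. F x ^ 8)" "expectation (\<lambda>x. F x ^ 8) \<le> CF"
    and low: "\<And>x. 1 + h * (Y x + 2 * del * h * F x) \<ge> c * h\<^sup>2"
  defines "A \<equiv> (56 + 4 / c + 128 / c\<^sup>2) * (1 + 256 * (CY + (2 * del) ^ 8 * CF))
      + 3 * (2 * del * (3 + CF) + 4 * del\<^sup>2 * (1 + CF))"
    and "U \<equiv> \<lambda>x. 1 / (1 + h * (Y x + 2 * del * h * F x))"
  shows "\<bar>expectation F\<bar> \<le> 1 + CF"
    and "\<bar>expectation U - (1 - 2 * del * expectation F * h\<^sup>2 + 2 * h\<^sup>2)\<bar> \<le> A * h ^ 3"
    and "\<bar>expectation (\<lambda>x. (U x)\<^sup>2) - (1 - 4 * del * expectation F * h\<^sup>2 + 6 * h\<^sup>2)\<bar> \<le> A * h ^ 3"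
    and "integrable M U" "integrable M (\<lambda>x. (U x)\<^sup>2)"
proof -
  have iF: "integrable M F" "integrable M (\<lambda>x. (F x)\<^sup>2)"
    using lower_moments(1)[OF meas(2) F8(1), of 1] lower_moments(1)[OF meas(2) F8(1), of 2] by auto
  have EF2: "expectation (\<lambda>x. (F x)\<^sup>2) \<le> 1 + CF"
    using lower_moments(2)[OF meas(2) F8(1), of 2] F8(2) by simp
  have "\<bar>expectation F\<bar> \<le> expectation (\<lambda>x. \<bar>F x\<bar>)" by (rule integral_abs_bound)
  also have "\<dots> \<le> 1 + CF" using lower_moments(2)[OF meas(2) F8(1), of 1] F8(2) by simp
  finally show "\<bar>expectation F\<bar> \<le> 1 + CF" .
  have iY: "integrable M Y" "integrable M (\<lambda>x. (Y x)\<^sup>2)" "expectation Y = 0" "expectation (\<lambda>x. (Y x)\<^sup>2) = 2"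
    using Y1 Y2 by (auto simp: has_bochner_integral_iff)
  define T where "T = (\<lambda>x. Y x + 2 * del * h * F x)"
  have T [measurable]: "T \<in> borel_measurable M" by (simp add: T_def)
  have T8le: "T x ^ 8 \<le> 256 * (Y x ^ 8 + (2 * del) ^ 8 * F x ^ 8)" for x
  proof -
    let ?b = "2 * del * h * F x"
    have "\<bar>T x\<bar> ^ 8 \<le> (2 * max \<bar>Y x\<bar> \<bar>?b\<bar>) ^ 8" by (intro power_mono) (auto simp: T_def)
    also have "\<dots> \<le> 256 * (\<bar>Y x\<bar> ^ 8 + \<bar>?b\<bar> ^ 8)" by (auto simp: power_mult_distrib max_def)
    also have "\<bar>?b\<bar> ^ 8 = h ^ 8 * ((2 * del) ^ 8 * F x ^ 8)"
      by (simp add: power_even_abs power_mult_distrib)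
    also have "\<dots> \<le> 1 * ((2 * del) ^ 8 * F x ^ 8)"
      using h by (intro mult_right_mono power_le_one) (auto simp: zero_le_even_power)
    finally show ?thesis by (simp add: power_even_abs)
  qed
  have iR: "integrable M (\<lambda>x. 256 * (Y x ^ 8 + (2 * del) ^ 8 * F x ^ 8))" using Y8 F8 by simp
  have iT8: "integrable M (\<lambda>x. T x ^ 8)"
    by (rule Bochner_Integration.integrable_bound[OF iR])
      (use T8le in \<open>auto simp: zero_le_even_power intro!: AE_I2 order_trans[OF T8le]\<close>)
  define CT where "CT = 256 * (CY + (2 * del) ^ 8 * CF)"
  have ET8: "expectation (\<lambda>x. T x ^ 8) \<le> CT"
  proof -
    have "expectation (\<lambda>x. T x ^ 8) \<le> expectation (\<lambda>x. 256 * (Y x ^ 8 + (2 * del) ^ 8 * F x ^ 8))"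
      by (rule integral_mono[OF iT8 iR T8le])
    also have "\<dots> = 256 * (expectation (\<lambda>x. Y x ^ 8) + (2 * del) ^ 8 * expectation (\<lambda>x. F x ^ 8))"
      using Y8 F8 by simp
    also have "\<dots> \<le> CT" unfolding CT_def using Y8 F8 del by (intro mult_left_mono add_mono) auto
    finally show ?thesis .
  qed
  have CT0: "CT \<ge> 0"
    using ET8 by (rule order_trans[rotated]) (simp add: zero_le_even_power integral_nonneg_AE)
  have UT: "U = (\<lambda>x. 1 / (1 + h * T x))" by (simp add: U_def T_def)
  have lowT: "1 + h * T x \<ge> c * h\<^sup>2" for x using low by (simp add: T_def)
  have ch: "c * h\<^sup>2 > 0" using c h by simp
  have Ubd: "0 \<le> U x" "U x \<le> 1 / (c * h\<^sup>2)" for x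
    using lowT[of x] ch unfolding UT by (auto intro!: divide_nonneg_pos frac_le)
  have Um [measurable]: "U \<in> borel_measurable M" by (simp add: UT)
  show iU: "integrable M U"
    by (rule integrable_const_bound[of _ "1 / (c * h\<^sup>2)"]) (use Ubd in auto)
  show iU2: "integrable M (\<lambda>x. (U x)\<^sup>2)"
    by (rule integrable_const_bound[of _ "(1 / (c * h\<^sup>2))\<^sup>2"])
      (use Ubd in \<open>auto intro!: AE_I2 power_mono\<close>)
  have iT: "integrable M T" "integrable M (\<lambda>x. (T x)\<^sup>2)"
    using lower_moments(1)[OF T iT8, of 1] lower_moments(1)[OF T iT8, of 2] by auto
  define f where "f = expectation F"
  have ET: "expectation T = 2 * del * h * f" using iF iY by (simp add: T_def f_def)
  have iYF: "integrable M (\<lambda>x. Y x * F x)"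
  proof (rule Bochner_Integration.integrable_bound)
    show "integrable M (\<lambda>x. ((Y x)\<^sup>2 + (F x)\<^sup>2) / 2)" using iF iY by simp
    show "AE x in M. norm (Y x * F x) \<le> norm (((Y x)\<^sup>2 + (F x)\<^sup>2) / 2)"
    proof (rule AE_I2)
      fix x
      have "2 * \<bar>Y x * F x\<bar> \<le> (Y x)\<^sup>2 + (F x)\<^sup>2"
        using sum_squares_bound[of "\<bar>Y x\<bar>" "\<bar>F x\<bar>"] by (simp add: abs_mult)
      then show "norm (Y x * F x) \<le> norm (((Y x)\<^sup>2 + (F x)\<^sup>2) / 2)" by simp
    qed
  qed simp
  have EYF: "\<bar>expectation (\<lambda>x. Y x * F x)\<bar> \<le> (3 + CF) / 2"
  proof -
    have "\<bar>expectation (\<lambda>x. Y x * F x)\<bar> \<le> expectation (\<lambda>x. \<bar>Y x * F x\<bar>)" by (rule integral_abs_bound)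
    also have "\<dots> \<le> expectation (\<lambda>x. ((Y x)\<^sup>2 + (F x)\<^sup>2) / 2)"
    proof (rule integral_mono)
      fix x show "\<bar>Y x * F x\<bar> \<le> ((Y x)\<^sup>2 + (F x)\<^sup>2) / 2"
        using sum_squares_bound[of "\<bar>Y x\<bar>" "\<bar>F x\<bar>"] by (simp add: abs_mult)
    qed (use iYF iY iF in auto)
    also have "\<dots> = (2 + expectation (\<lambda>x. (F x)\<^sup>2)) / 2" using iY iF by simp
    also have "\<dots> \<le> (2 + (1 + CF)) / 2" using EF2 by (intro divide_right_mono add_left_mono) auto
    finally show ?thesis by simp
  qed
  define K3 where "K3 = 2 * del * (3 + CF) + 4 * del\<^sup>2 * (1 + CF)"
  have ET2: "\<bar>expectation (\<lambda>x. (T x)\<^sup>2) - 2\<bar> \<le> K3 * h"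
  proof -
    have "(T x)\<^sup>2 = (Y x)\<^sup>2 + 4 * del * h * (Y x * F x) + 4 * del\<^sup>2 * h\<^sup>2 * (F x)\<^sup>2" for x
      by (simp add: T_def power2_eq_square algebra_simps)
    then have e: "expectation (\<lambda>x. (T x)\<^sup>2) - 2
        = 4 * del * h * expectation (\<lambda>x. Y x * F x) + 4 * del\<^sup>2 * h\<^sup>2 * expectation (\<lambda>x. (F x)\<^sup>2)"
      using iYF iY iF by simp
    have "\<bar>4 * del * h * expectation (\<lambda>x. Y x * F x)\<bar> = 4 * del * h * \<bar>expectation (\<lambda>x. Y x * F x)\<bar>"
      using del h by (simp add: abs_mult)
    also have "\<dots> \<le> 4 * del * h * ((3 + CF) / 2)"
      using EYF del h by (intro mult_left_mono) auto
    also have "\<dots> = 2 * del * (3 + CF) * h" by (simp add: mult_ac)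
    finally have 1: "\<bar>4 * del * h * expectation (\<lambda>x. Y x * F x)\<bar> \<le> 2 * del * (3 + CF) * h" .
    have nn: "expectation (\<lambda>x. (F x)\<^sup>2) \<ge> 0" by simp
    have "h\<^sup>2 \<le> h" using h by (simp add: power2_eq_square mult_left_le)
    then have "4 * del\<^sup>2 * h\<^sup>2 * expectation (\<lambda>x. (F x)\<^sup>2) \<le> 4 * del\<^sup>2 * h * (1 + CF)"
      using EF2 nn h by (intro mult_mono) auto
    then have 2: "\<bar>4 * del\<^sup>2 * h\<^sup>2 * expectation (\<lambda>x. (F x)\<^sup>2)\<bar> \<le> 4 * del\<^sup>2 * (1 + CF) * h"
      using nn by (simp add: mult_ac)
    have "\<bar>expectation (\<lambda>x. (T x)\<^sup>2) - 2\<bar> \<le> 2 * del * (3 + CF) * h + 4 * del\<^sup>2 * (1 + CF) * h"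
      unfolding e by (rule order_trans[OF abs_triangle_ineq add_mono[OF 1 2]])
    then show ?thesis by (simp only: K3_def distrib_right)
  qed
  have CF0: "CF \<ge> 0"
    using F8(2) by (rule order_trans[rotated]) (simp add: zero_le_even_power integral_nonneg_AE)
  have K30: "K3 \<ge> 0" using CF0 del by (simp add: K3_def)
  have remainder: "\<bar>expectation V - expectation W\<bar> \<le> k * (1 + CT)"
    if iV: "integrable M V" and iW: "integrable M W" and k: "k \<ge> 0"
      and b: "\<And>x. \<bar>V x - W x\<bar> \<le> k * (1 + T x ^ 8)" for V W :: "'a \<Rightarrow> real" and k
  proof -
    have "\<bar>expectation V - expectation W\<bar> = \<bar>expectation (\<lambda>x. V x - W x)\<bar>" using iV iW by simp
    also have "\<dots> \<le> expectation (\<lambda>x. \<bar>V x - W x\<bar>)" by (rule integral_abs_bound)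
    also have "\<dots> \<le> expectation (\<lambda>x. k * (1 + T x ^ 8))"
      by (rule integral_mono) (use iV iW iT8 b in auto)
    also have "\<dots> = k * (1 + expectation (\<lambda>x. T x ^ 8))" using iT8 by (simp add: prob_space)
    also have "\<dots> \<le> k * (1 + CT)" using ET8 k by (intro mult_left_mono) auto
    finally show ?thesis .
  qed
  have cc: "4 / c \<ge> 0" "128 / c\<^sup>2 \<ge> 0" using c by auto
  have AK: "A = (56 + 4 / c + 128 / c\<^sup>2) * (1 + CT) + 3 * K3" by (simp add: A_def CT_def K3_def)
  have "(2 + 4 / c) * (1 + CT) \<le> (56 + 4 / c + 128 / c\<^sup>2) * (1 + CT)"
    by (rule mult_right_mono) (use cc CT0 in linarith)+
  then have A1: "(2 + 4 / c) * (1 + CT) + K3 \<le> A" unfolding AK using K30 by linarith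
  have "(56 + 128 / c\<^sup>2) * (1 + CT) \<le> (56 + 4 / c + 128 / c\<^sup>2) * (1 + CT)"
    by (rule mult_right_mono) (use cc CT0 in linarith)+
  then have A2: "(56 + 128 / c\<^sup>2) * (1 + CT) + 3 * K3 \<le> A" unfolding AK by linarith
  have h3: "h ^ 3 = h * h\<^sup>2" by (simp add: eval_nat_numeral)
  show "\<bar>expectation U - (1 - 2 * del * expectation F * h\<^sup>2 + 2 * h\<^sup>2)\<bar> \<le> A * h ^ 3"
  proof -
    have 1: "\<bar>expectation U - expectation (\<lambda>x. 1 - h * T x + (h * T x)\<^sup>2)\<bar> \<le> (2 + 4 / c) * h ^ 3 * (1 + CT)"
    proof (rule remainder)
      show "\<bar>U x - (1 - h * T x + (h * T x)\<^sup>2)\<bar> \<le> (2 + 4 / c) * h ^ 3 * (1 + T x ^ 8)" for x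
        unfolding UT by (rule inverse_taylor_bounds(1)[OF h(1) c lowT])
    qed (use iU iT h c in \<open>auto simp: power_mult_distrib\<close>)
    have "expectation (\<lambda>x. 1 - h * T x + (h * T x)\<^sup>2) = 1 - h * expectation T + h\<^sup>2 * expectation (\<lambda>x. (T x)\<^sup>2)"
      using iT by (simp add: power_mult_distrib prob_space)
    then have 2: "expectation (\<lambda>x. 1 - h * T x + (h * T x)\<^sup>2) - (1 - 2 * del * f * h\<^sup>2 + 2 * h\<^sup>2)
        = h\<^sup>2 * (expectation (\<lambda>x. (T x)\<^sup>2) - 2)" unfolding ET by (simp add: algebra_simps power2_eq_square)
    have 3: "\<bar>h\<^sup>2 * (expectation (\<lambda>x. (T x)\<^sup>2) - 2)\<bar> \<le> h\<^sup>2 * (K3 * h)"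
      using ET2 by (simp add: abs_mult mult_left_mono)
    have "\<bar>expectation U - (1 - 2 * del * f * h\<^sup>2 + 2 * h\<^sup>2)\<bar>
        \<le> (2 + 4 / c) * h ^ 3 * (1 + CT) + h\<^sup>2 * (K3 * h)" using 1 2 3 by linarith
    also have "\<dots> = ((2 + 4 / c) * (1 + CT) + K3) * h ^ 3" by (simp add: algebra_simps h3)
    also have "\<dots> \<le> A * h ^ 3" by (rule mult_right_mono[OF A1]) (use h in simp)
    finally show ?thesis by (simp add: f_def)
  qed
  show "\<bar>expectation (\<lambda>x. (U x)\<^sup>2) - (1 - 4 * del * expectation F * h\<^sup>2 + 6 * h\<^sup>2)\<bar> \<le> A * h ^ 3"
  proof -
    have 1: "\<bar>expectation (\<lambda>x. (U x)\<^sup>2) - expectation (\<lambda>x. 1 - 2 * (h * T x) + 3 * (h * T x)\<^sup>2)\<bar>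
        \<le> (28 + 64 / c\<^sup>2) * (h ^ 3 * (1 + h)) * (1 + CT)"
    proof (rule remainder)
      show "\<bar>(U x)\<^sup>2 - (1 - 2 * (h * T x) + 3 * (h * T x)\<^sup>2)\<bar>
          \<le> (28 + 64 / c\<^sup>2) * (h ^ 3 * (1 + h)) * (1 + T x ^ 8)" for x
        using inverse_taylor_bounds(2)[OF h(1) c lowT[of x]] by (simp add: UT power_divide)
    qed (use iU2 iT h c in \<open>auto simp: power_mult_distrib\<close>)
    have "(28 + 64 / c\<^sup>2) * (h ^ 3 * (1 + h)) * (1 + CT) \<le> (28 + 64 / c\<^sup>2) * (h ^ 3 * 2) * (1 + CT)"
      using h CT0 by (intro mult_right_mono mult_left_mono) auto
    then have one: "\<bar>expectation (\<lambda>x. (U x)\<^sup>2) - expectation (\<lambda>x. 1 - 2 * (h * T x) + 3 * (h * T x)\<^sup>2)\<bar>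
        \<le> (28 + 64 / c\<^sup>2) * (h ^ 3 * 2) * (1 + CT)" using 1 by linarith
    have "expectation (\<lambda>x. 1 - 2 * (h * T x) + 3 * (h * T x)\<^sup>2)
        = 1 - 2 * h * expectation T + 3 * h\<^sup>2 * expectation (\<lambda>x. (T x)\<^sup>2)"
      using iT by (simp add: power_mult_distrib prob_space)
    then have 2: "expectation (\<lambda>x. 1 - 2 * (h * T x) + 3 * (h * T x)\<^sup>2) - (1 - 4 * del * f * h\<^sup>2 + 6 * h\<^sup>2)
        = 3 * (h\<^sup>2 * (expectation (\<lambda>x. (T x)\<^sup>2) - 2))" unfolding ET by (simp add: algebra_simps power2_eq_square)
    have 3: "\<bar>h\<^sup>2 * (expectation (\<lambda>x. (T x)\<^sup>2) - 2)\<bar> \<le> h\<^sup>2 * (K3 * h)"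
      using ET2 by (simp add: abs_mult mult_left_mono)
    have "\<bar>expectation (\<lambda>x. (U x)\<^sup>2) - (1 - 4 * del * f * h\<^sup>2 + 6 * h\<^sup>2)\<bar>
        \<le> (28 + 64 / c\<^sup>2) * (h ^ 3 * 2) * (1 + CT) + 3 * (h\<^sup>2 * (K3 * h))" using one 2 3 by linarith
    also have "\<dots> = ((56 + 128 / c\<^sup>2) * (1 + CT) + 3 * K3) * h ^ 3" by (simp add: algebra_simps h3)
    also have "\<dots> \<le> A * h ^ 3" by (rule mult_right_mono[OF A2]) (use h in simp)
    finally show ?thesis by (simp add: f_def)
  qed
qed

lemma abs_mult_le:
  fixes x y a b :: real
  assumes "\<bar>x\<bar> \<le> a" "\<bar>y\<bar> \<le> b" shows "\<bar>x * y\<bar> \<le> a * b"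
  using assms by (simp add: abs_mult mult_mono')

text \<open>Pure arithmetic: the factor \<open>1 + 2 a\<^sub>0 h\<^sup>2\<close> is \<open>2 a / N\<close> for the shape \<open>a = a\<^sub>0 + N/2\<close>, and
  \<open>1 / (2 h\<^sup>2) = N / 2\<close>. Of the limiting drift, \<open>a\<^sub>0 \<delta>\<close> comes from this factor and \<open>\<delta>\<close> from the
  variance of the chi-square fluctuation.\<close>

lemma gamma_mean_expansion:
  fixes h \<delta> a0 f eu A \<Phi> :: real
  assumes h: "0 < h" "h \<le> 1" and \<delta>: "\<delta> > 0" and a0: "a0 > 0" and A: "A \<ge> 0"
    and eu: "\<bar>eu - (1 - 2 * \<delta> * f * h\<^sup>2 + 2 * h\<^sup>2)\<bar> \<le> A * h ^ 3"
    and f: "\<bar>f\<bar> \<le> \<Phi>"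
  shows "\<bar>(\<delta> * (1 + 2 * a0 * h\<^sup>2) * eu - \<delta>) / (2 * h\<^sup>2) - ((a0 + 1) * \<delta> - f * \<delta>\<^sup>2)\<bar>
    \<le> \<delta> * (A + a0 * (2 + 2 * \<delta> * \<Phi>) + a0 * A) * h"
proof -
  define p where "p = 2 - 2 * \<delta> * f"
  define r where "r = (eu - (1 + p * h\<^sup>2)) / h ^ 3"
  have h0: "h ^ 3 > 0" using h by simp
  have "\<bar>eu - (1 + p * h\<^sup>2)\<bar> \<le> A * h ^ 3" using eu by (simp add: p_def algebra_simps)
  then have r: "\<bar>r\<bar> \<le> A" using h0 by (simp add: r_def divide_le_eq)
  have eueq: "eu = 1 + p * h\<^sup>2 + r * h ^ 3" using h0 by (simp add: r_def)
  have p: "\<bar>p\<bar> \<le> 2 + 2 * \<delta> * \<Phi>"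
  proof -
    have "\<bar>p\<bar> \<le> 2 + 2 * \<delta> * \<bar>f\<bar>" using \<delta> by (simp add: p_def abs_mult order_trans[OF abs_triangle_ineq4])
    also have "\<dots> \<le> 2 + 2 * \<delta> * \<Phi>" using f \<delta> by simp
    finally show ?thesis .
  qed
  have eq: "(\<delta> * (1 + 2 * a0 * h\<^sup>2) * eu - \<delta>) / (2 * h\<^sup>2) - ((a0 + 1) * \<delta> - f * \<delta>\<^sup>2)
      = \<delta> * (r / 2 + (a0 * p) * h + (a0 * r) * h\<^sup>2) * h"
    using h unfolding eueq p_def by (simp add: field_simps power2_eq_square power3_eq_cube)
  have hh: "h\<^sup>2 \<le> 1" using h by (simp add: power_le_one)
  have "\<bar>r / 2 + (a0 * p) * h + (a0 * r) * h\<^sup>2\<bar> \<le> \<bar>r / 2\<bar> + \<bar>(a0 * p) * h\<bar> + \<bar>(a0 * r) * h\<^sup>2\<bar>"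
    by linarith
  also have "\<dots> \<le> A + a0 * (2 + 2 * \<delta> * \<Phi>) + a0 * A"
  proof -
    have "\<bar>(a0 * p) * h\<bar> \<le> (a0 * (2 + 2 * \<delta> * \<Phi>)) * 1"
      by (intro abs_mult_le) (use p h a0 in \<open>auto simp: abs_mult\<close>)
    moreover have "\<bar>(a0 * r) * h\<^sup>2\<bar> \<le> (a0 * A) * 1"
      by (intro abs_mult_le) (use r hh a0 in \<open>auto simp: abs_mult\<close>)
    moreover have "\<bar>r / 2\<bar> \<le> A" using r by simp
    ultimately show ?thesis by linarith
  qed
  finally have "\<delta> * \<bar>r / 2 + (a0 * p) * h + (a0 * r) * h\<^sup>2\<bar> * h
      \<le> \<delta> * (A + a0 * (2 + 2 * \<delta> * \<Phi>) + a0 * A) * h"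
    using \<delta> h by (intro mult_right_mono mult_left_mono) auto
  then show ?thesis unfolding eq using \<delta> h by (simp add: abs_mult)
qed

text \<open>With \<open>g = 2 a / N\<close>, the term \<open>g * (g + 2 h\<^sup>2)\<close> is \<open>4 a (a + 1) / N\<^sup>2\<close>. Half of the limit
  \<open>2 \<delta>\<^sup>2\<close> is the intrinsic variance of the Gamma draw, half is the variance of its random rate.\<close>

lemma gamma_variance_expansion:
  fixes h \<delta> a0 f eu eu2 A \<Phi> :: real
  assumes h: "0 < h" "h \<le> 1" and \<delta>: "\<delta> > 0" and a0: "a0 > 0" and A: "A \<ge> 0"
    and eu: "\<bar>eu - (1 - 2 * \<delta> * f * h\<^sup>2 + 2 * h\<^sup>2)\<bar> \<le> A * h ^ 3"
    and eu2: "\<bar>eu2 - (1 - 4 * \<delta> * f * h\<^sup>2 + 6 * h\<^sup>2)\<bar> \<le> A * h ^ 3"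
    and f: "\<bar>f\<bar> \<le> \<Phi>"
  defines "g \<equiv> 1 + 2 * a0 * h\<^sup>2" and "P \<equiv> 2 + 2 * \<delta> * \<Phi>" and "G \<equiv> 1 + 2 * a0"
  shows "\<bar>\<delta>\<^sup>2 * (g * (g + 2 * h\<^sup>2) * eu2 - (g * eu)\<^sup>2) / (2 * h\<^sup>2) - 2 * \<delta>\<^sup>2\<bar>
    \<le> \<delta>\<^sup>2 * (2 * a0 * (3 + 2 * a0) + G * (G * (3 * A + P\<^sup>2 + A\<^sup>2 + 2 * P * A) + 2 + 2 * P + A)) * h"
proof -
  define p where "p = 2 - 2 * \<delta> * f"
  define r where "r = (eu - (1 + p * h\<^sup>2)) / h ^ 3"
  define s where "s = (eu2 - (1 + (2 + 2 * p) * h\<^sup>2)) / h ^ 3"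
  have h0: "h ^ 3 > 0" using h by simp
  have "\<bar>eu - (1 + p * h\<^sup>2)\<bar> \<le> A * h ^ 3" using eu by (simp add: p_def algebra_simps)
  then have r: "\<bar>r\<bar> \<le> A" using h0 by (simp add: r_def divide_le_eq)
  have "\<bar>eu2 - (1 + (2 + 2 * p) * h\<^sup>2)\<bar> \<le> A * h ^ 3" using eu2 by (simp add: p_def algebra_simps)
  then have s: "\<bar>s\<bar> \<le> A" using h0 by (simp add: s_def divide_le_eq)
  have eueq: "eu = 1 + p * h\<^sup>2 + r * h ^ 3" and eu2eq: "eu2 = 1 + (2 + 2 * p) * h\<^sup>2 + s * h ^ 3"
    using h0 by (auto simp: r_def s_def)
  have p: "\<bar>p\<bar> \<le> P"
  proof -
    have "\<bar>p\<bar> \<le> 2 + 2 * \<delta> * \<bar>f\<bar>" using \<delta> by (simp add: p_def abs_mult order_trans[OF abs_triangle_ineq4])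
    also have "\<dots> \<le> P" using f \<delta> by (simp add: P_def)
    finally show ?thesis .
  qed
  have P0: "P \<ge> 0" using p by linarith
  have hh: "\<bar>h ^ k\<bar> \<le> 1" for k using h by (simp add: power_le_one)
  have g: "\<bar>g\<bar> \<le> G" "0 \<le> g" using hh[of 2] a0 by (auto simp: g_def G_def mult_left_le)
  define R where "R = p\<^sup>2 * h + r\<^sup>2 * h ^ 3 + 2 * r + 2 * p * h\<^sup>2 * r"
  have eusq: "eu\<^sup>2 = 1 + 2 * p * h\<^sup>2 + R * h ^ 3"
    unfolding eueq R_def by (simp add: algebra_simps power2_eq_square power3_eq_cube)
  have R: "\<bar>R\<bar> \<le> P\<^sup>2 + A\<^sup>2 + 2 * A + 2 * P * A"
  proof -
    have "\<bar>p\<^sup>2 * h\<bar> \<le> P\<^sup>2 * 1"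
      using abs_mult_le[OF p p] h by (intro abs_mult_le) (auto simp: power2_eq_square)
    moreover have "\<bar>r\<^sup>2 * h ^ 3\<bar> \<le> A\<^sup>2 * 1"
      using abs_mult_le[OF r r] hh by (intro abs_mult_le) (auto simp: power2_eq_square)
    moreover have "\<bar>(2 * p * h\<^sup>2) * r\<bar> \<le> (2 * P * 1) * A"
      by (intro abs_mult_le) (use p r hh[of 2] in auto)
    moreover have "\<bar>2 * r\<bar> \<le> 2 * A" using r by simp
    ultimately show ?thesis unfolding R_def by linarith
  qed
  have eq: "\<delta>\<^sup>2 * (g * (g + 2 * h\<^sup>2) * eu2 - (g * eu)\<^sup>2) / (2 * h\<^sup>2) - 2 * \<delta>\<^sup>2
      = \<delta>\<^sup>2 * (2 * a0 * h * (3 + 2 * a0 * h\<^sup>2) + g * (g * (s - R) / 2 + (2 + 2 * p) * h + s * h\<^sup>2)) * h"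
  proof -
    have "g * (g + 2 * h\<^sup>2) * eu2 - (g * eu)\<^sup>2 = g * (g * (eu2 - eu\<^sup>2) + 2 * h\<^sup>2 * eu2)"
      by (simp add: algebra_simps power2_eq_square)
    also have "\<dots> = 2 * h\<^sup>2 * (g * (g + 1 + (g * (s - R) / 2 + (2 + 2 * p) * h + s * h\<^sup>2) * h))"
      unfolding eusq unfolding eu2eq by (simp add: field_simps power2_eq_square power3_eq_cube)
    finally have "\<delta>\<^sup>2 * (g * (g + 2 * h\<^sup>2) * eu2 - (g * eu)\<^sup>2) / (2 * h\<^sup>2)
        = \<delta>\<^sup>2 * (g * (g + 1 + (g * (s - R) / 2 + (2 + 2 * p) * h + s * h\<^sup>2) * h))"
      using h by simp
    moreover have "g * (g + 1) - 2 = 2 * a0 * h * (3 + 2 * a0 * h\<^sup>2) * h"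
      unfolding g_def by (simp add: algebra_simps power2_eq_square)
    moreover have "\<delta>\<^sup>2 * (g * (g + 1 + Q * h)) - 2 * \<delta>\<^sup>2 = \<delta>\<^sup>2 * (W + g * Q) * h"
      if "g * (g + 1) - 2 = W * h" for Q W
    proof -
      have e: "g * (g + 1 + Q * h) = 2 + (W + g * Q) * h" using that by (simp add: algebra_simps)
      show ?thesis unfolding e by (simp add: algebra_simps)
    qed
    ultimately show ?thesis by simp
  qed
  have "\<bar>2 * a0 * h * (3 + 2 * a0 * h\<^sup>2) + g * (g * (s - R) / 2 + (2 + 2 * p) * h + s * h\<^sup>2)\<bar>
      \<le> 2 * a0 * (3 + 2 * a0) + G * (G * (3 * A + P\<^sup>2 + A\<^sup>2 + 2 * P * A) + 2 + 2 * P + A)"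
  proof -
    have "\<bar>(2 * a0) * h\<bar> \<le> (2 * a0) * 1" by (rule abs_mult_le) (use h a0 in auto)
    moreover have "\<bar>(2 * a0) * h\<^sup>2\<bar> \<le> (2 * a0) * 1" by (rule abs_mult_le) (use hh[of 2] a0 in auto)
    then have "\<bar>3 + 2 * a0 * h\<^sup>2\<bar> \<le> 3 + 2 * a0" using a0 by simp
    ultimately have "\<bar>(2 * a0 * h) * (3 + 2 * a0 * h\<^sup>2)\<bar> \<le> (2 * a0 * 1) * (3 + 2 * a0)"
      by (rule abs_mult_le)
    then have "\<bar>(2 * a0 * h) * (3 + 2 * a0 * h\<^sup>2)\<bar> \<le> (2 * a0) * (3 + 2 * a0)" by simp
    moreover have "\<bar>g * (g * (s - R) / 2 + (2 + 2 * p) * h + s * h\<^sup>2)\<bar>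
        \<le> G * (G * (3 * A + P\<^sup>2 + A\<^sup>2 + 2 * P * A) + 2 + 2 * P + A)"
    proof (rule abs_mult_le[OF g(1)])
      have "\<bar>s - R\<bar> \<le> 3 * A + P\<^sup>2 + A\<^sup>2 + 2 * P * A" using s R by linarith
      then have "\<bar>g * (s - R)\<bar> \<le> G * (3 * A + P\<^sup>2 + A\<^sup>2 + 2 * P * A)" by (rule abs_mult_le[OF g(1)])
      moreover have "\<bar>(2 + 2 * p) * h\<bar> \<le> (2 + 2 * P) * 1" using p h by (intro abs_mult_le) auto
      moreover have "\<bar>s * h\<^sup>2\<bar> \<le> A * 1" using s hh[of 2] by (intro abs_mult_le) auto
      moreover have "\<bar>u / 2 + v + w\<bar> \<le> U + V + W"
        if "\<bar>u\<bar> \<le> U" "\<bar>v\<bar> \<le> V" "\<bar>w\<bar> \<le> W" for u v w U V W :: real using that by linarith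
      ultimately have "\<bar>g * (s - R) / 2 + (2 + 2 * p) * h + s * h\<^sup>2\<bar>
          \<le> G * (3 * A + P\<^sup>2 + A\<^sup>2 + 2 * P * A) + (2 + 2 * P) * 1 + A * 1" by blast
      then show "\<bar>g * (s - R) / 2 + (2 + 2 * p) * h + s * h\<^sup>2\<bar>
          \<le> G * (3 * A + P\<^sup>2 + A\<^sup>2 + 2 * P * A) + 2 + 2 * P + A" by (simp only: mult_1_right add.assoc)
    qed
    ultimately show ?thesis by linarith
  qed
  then have "\<delta>\<^sup>2 * \<bar>2 * a0 * h * (3 + 2 * a0 * h\<^sup>2) + g * (g * (s - R) / 2 + (2 + 2 * p) * h + s * h\<^sup>2)\<bar> * h
      \<le> \<delta>\<^sup>2 * (2 * a0 * (3 + 2 * a0) + G * (G * (3 * A + P\<^sup>2 + A\<^sup>2 + 2 * P * A) + 2 + 2 * P + A)) * h"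
    using h by (intro mult_right_mono mult_left_mono) auto
  then show ?thesis unfolding eq using h by (simp add: abs_mult)
qed

section \<open>Mixtures of Gamma distributions\<close>

lemma gamma_density_nonneg: "a > 0 \<Longrightarrow> gamma_density a b x \<ge> 0"
  by (simp add: gamma_density_def Gamma_real_pos less_imp_le)

text \<open>The substitution \<open>t = b x\<close> reduces the moments to Euler's integral.\<close>

lemma gamma_distr_moment:
  assumes a: "a > 0" and b: "b > 0"
  shows "(\<integral>\<^sup>+ x. ennreal (x ^ k) \<partial>gamma_distr a b) = ennreal (Gamma (a + real k) / (Gamma a * b ^ k))"
proof -
  define G where "G = (\<lambda>t::real. ennreal (indicator {0..} t * t powr (a + real k - 1) / exp t))"
  have Gm: "G \<in> borel_measurable borel" unfolding G_def by measurable
  have Ga: "Gamma a > 0" using a by (rule Gamma_real_pos)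
  have dm: "gamma_density a b \<in> borel_measurable borel" unfolding gamma_density_def[abs_def] by measurable
  have "(\<integral>\<^sup>+ x. ennreal (x ^ k) \<partial>gamma_distr a b)
      = (\<integral>\<^sup>+ x. ennreal (gamma_density a b x) * ennreal (x ^ k) \<partial>lborel)"
    unfolding gamma_distr_def using dm by (intro nn_integral_density) auto
  also have "\<dots> = (\<integral>\<^sup>+ x. ennreal (b / (Gamma a * b ^ k)) * G (0 + b * x) \<partial>lborel)"
  proof (rule nn_integral_cong)
    fix x :: real
    show "ennreal (gamma_density a b x) * ennreal (x ^ k) = ennreal (b / (Gamma a * b ^ k)) * G (0 + b * x)"
    proof (cases "x > 0")
      case True
      have "(b * x) powr (a + real k - 1) = b powr a * b ^ k / b * (x powr (a - 1) * x ^ k)"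
        using True b by (simp add: powr_mult powr_diff powr_add powr_realpow)
      then have "gamma_density a b x * x ^ k
          = b / (Gamma a * b ^ k) * (indicator {0..} (b * x) * (b * x) powr (a + real k - 1) / exp (b * x))"
        using True b Ga by (simp add: gamma_density_def exp_minus field_simps)
      then show ?thesis
        unfolding G_def using True b Ga gamma_density_nonneg[OF a, of b x]
        by (simp add: ennreal_mult[symmetric])
    next
      case False
      then have "G (0 + b * x) = 0"
        using b by (cases "x = 0") (auto simp: G_def indicator_def zero_le_mult_iff)
      then show ?thesis using False by (simp add: gamma_density_def)
    qed
  qed
  also have "\<dots> = ennreal (1 / (Gamma a * b ^ k)) * (ennreal \<bar>b\<bar> * (\<integral>\<^sup>+ x. G (0 + b * x) \<partial>lborel))"
    using b Ga Gm by (subst nn_integral_cmult) (auto simp: ennreal_mult[symmetric] mult.assoc[symmetric])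
  also have "ennreal \<bar>b\<bar> * (\<integral>\<^sup>+ x. G (0 + b * x) \<partial>lborel) = (\<integral>\<^sup>+ x. G x \<partial>lborel)"
    by (rule nn_integral_real_affine[symmetric]) (use Gm b in auto)
  also have "(\<integral>\<^sup>+ x. G x \<partial>lborel) = ennreal (Gamma (a + real k))"
    unfolding G_def by (rule Gamma_conv_nn_integral_real[symmetric]) (use a in simp)
  finally show ?thesis
    using Ga b Gamma_real_pos[of "a + real k"] a by (simp add: ennreal_mult[symmetric])
qed

lemma gamma_distr_moments:
  assumes a: "a > 0" and b: "b > 0"
  shows "prob_space (gamma_distr a b)"
    and "(\<integral>\<^sup>+ x. ennreal x \<partial>gamma_distr a b) = ennreal (a / b)"
    and "(\<integral>\<^sup>+ x. ennreal (x\<^sup>2) \<partial>gamma_distr a b) = ennreal (a * (a + 1) / b\<^sup>2)"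
proof -
  have Ga: "Gamma a > 0" using a by (rule Gamma_real_pos)
  have np: "x \<notin> \<int>\<^sub>\<le>\<^sub>0" if "x > 0" for x :: real using nonpos_Ints_nonpos[of x] that by auto
  have G1: "Gamma (a + 1) = a * Gamma a" by (rule Gamma_plus1) (use a np in auto)
  have G2: "Gamma (a + 2) = (a + 1) * (a * Gamma a)"
    using Gamma_plus1[of "a + 1", OF np] a G1 by (simp add: add.assoc)
  show "prob_space (gamma_distr a b)"
    using gamma_distr_moment[OF a b, of 0] Ga by (intro prob_spaceI) simp
  show "(\<integral>\<^sup>+ x. ennreal x \<partial>gamma_distr a b) = ennreal (a / b)"
    using gamma_distr_moment[OF a b, of 1] Ga by (simp add: G1)
  show "(\<integral>\<^sup>+ x. ennreal (x\<^sup>2) \<partial>gamma_distr a b) = ennreal (a * (a + 1) / b\<^sup>2)"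
    using gamma_distr_moment[OF a b, of 2] Ga by (simp add: G2 mult.commute)
qed

lemma AE_gamma_distr_nonneg: "AE x in gamma_distr a b. 0 \<le> x"
proof -
  have "gamma_density a b \<in> borel_measurable borel" unfolding gamma_density_def[abs_def] by measurable
  then show ?thesis
    unfolding gamma_distr_def by (subst AE_density) (auto simp: gamma_density_def)
qed

text \<open>Measurability of the Gamma laws in their rate, needed for the mixture to be a genuine kernel composition.\<close>

lemma gamma_distr_measurable:
  assumes [measurable]: "B \<in> borel_measurable M" and a: "a > 0" and pos: "\<And>z. B z > 0"
  shows "(\<lambda>z. gamma_distr a (B z)) \<in> measurable M (subprob_algebra borel)"
proof (rule measurable_subprob_algebra)
  fix z show "subprob_space (gamma_distr a (B z))"
    using gamma_distr_moments(1)[OF a pos] by (rule prob_space_imp_subprob_space)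
next
  fix z show "sets (gamma_distr a (B z)) = sets borel" by (simp add: gamma_distr_def)
next
  fix A :: "real set" assume A [measurable]: "A \<in> sets borel"
  have dm [measurable]: "gamma_density a b \<in> borel_measurable borel" for b
    unfolding gamma_density_def[abs_def] by measurable
  have "emeasure (gamma_distr a (B z)) A
      = (\<integral>\<^sup>+ x. ennreal (gamma_density a (B z) x) * indicator A x \<partial>lborel)" for z
    unfolding gamma_distr_def by (rule emeasure_density) auto
  moreover have "(\<lambda>z. \<integral>\<^sup>+ x. ennreal (gamma_density a (B z) x) * indicator A x \<partial>lborel) \<in> borel_measurable M"
    unfolding gamma_density_def by (rule lborel.borel_measurable_nn_integral) measurable
  ultimately show "(\<lambda>z. emeasure (gamma_distr a (B z)) A) \<in> borel_measurable M" by simp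
qed

text \<open>The mixture is carried by the nonnegative numbers, so its moments are iterated nonnegative integrals;
  the lower bound on the rate makes them finite.\<close>

lemma gamma_mixture_moments:
  assumes M: "prob_space M" and B [measurable]: "B \<in> borel_measurable M"
    and a: "a > 0" and b0: "b0 > 0" and low: "\<And>z. B z \<ge> b0"
  defines "\<kappa> \<equiv> M \<bind> (\<lambda>z. gamma_distr a (B z))"
  shows "prob_space \<kappa>"
    and "has_bochner_integral \<kappa> (\<lambda>d. d) (a * (\<integral>z. 1 / B z \<partial>M))"
    and "has_bochner_integral \<kappa> (\<lambda>d. d\<^sup>2) (a * (a + 1) * (\<integral>z. (1 / B z)\<^sup>2 \<partial>M))"
proof -
  interpret M: prob_space M by fact
  have pos: "B z > 0" for z using low[of z] b0 by linarith
  have meas: "(\<lambda>z. gamma_distr a (B z)) \<in> measurable M (subprob_algebra borel)"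
    by (rule gamma_distr_measurable[OF B a pos])
  have sets: "sets \<kappa> = sets borel"
    unfolding \<kappa>_def by (rule sets_bind[OF sets_kernel[OF meas] M.not_empty])
  show "prob_space \<kappa>"
    unfolding \<kappa>_def
    by (rule M.prob_space_bind[OF _ meas]) (use gamma_distr_moments(1)[OF a pos] in auto)
  have AE: "AE d in \<kappa>. 0 \<le> d"
    unfolding \<kappa>_def by (subst AE_bind[OF meas]) (use AE_gamma_distr_nonneg in auto)
  have id: "(\<lambda>d. d) \<in> borel_measurable \<kappa>" by (rule measurable_ident_sets[OF sets])
  then have sq: "(\<lambda>d. d\<^sup>2) \<in> borel_measurable \<kappa>" by (rule borel_measurable_power)
  have bd: "0 \<le> 1 / B z" "1 / B z \<le> 1 / b0" for z
    using low[of z] b0 pos[of z] by (auto intro: frac_le)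
  have i1: "integrable M (\<lambda>z. 1 / B z)"
    by (rule M.integrable_const_bound[of _ "1 / b0"]) (use bd in auto)
  have i2: "integrable M (\<lambda>z. (1 / B z)\<^sup>2)"
    by (rule M.integrable_const_bound[of _ "(1 / b0)\<^sup>2"])
      (use bd in \<open>auto simp del: power_divide intro!: AE_I2 power_mono\<close>)
  have "(\<integral>\<^sup>+ d. ennreal d \<partial>\<kappa>) = (\<integral>\<^sup>+ z. ennreal (a * (1 / B z)) \<partial>M)"
    unfolding \<kappa>_def using gamma_distr_moments(2)[OF a pos]
    by (subst nn_integral_bind[OF _ meas]) auto
  also have "\<dots> = ennreal (\<integral>z. a * (1 / B z) \<partial>M)"
    by (rule nn_integral_eq_integral) (use integrable_mult_right[of a M, OF i1] a bd in auto)
  also have "\<dots> = ennreal (a * (\<integral>z. 1 / B z \<partial>M))" by (simp only: integral_mult_right_zero)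
  finally show "has_bochner_integral \<kappa> (\<lambda>d. d) (a * (\<integral>z. 1 / B z \<partial>M))"
    by (intro has_bochner_integral_nn_integral id AE)
      (use a bd in \<open>auto intro!: integral_nonneg_AE mult_nonneg_nonneg simp del: times_divide_eq_right\<close>)
  have "(\<integral>\<^sup>+ d. ennreal (d\<^sup>2) \<partial>\<kappa>) = (\<integral>\<^sup>+ z. ennreal (a * (a + 1) * (1 / B z)\<^sup>2) \<partial>M)"
    unfolding \<kappa>_def using gamma_distr_moments(3)[OF a pos]
    by (subst nn_integral_bind[OF _ meas]) (auto simp: power_divide)
  also have "\<dots> = ennreal (\<integral>z. a * (a + 1) * (1 / B z)\<^sup>2 \<partial>M)"
    by (rule nn_integral_eq_integral) (use integrable_mult_right[of "a * (a + 1)" M, OF i2] a in auto)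
  also have "\<dots> = ennreal (a * (a + 1) * (\<integral>z. (1 / B z)\<^sup>2 \<partial>M))"
    by (simp only: integral_mult_right_zero)
  finally show "has_bochner_integral \<kappa> (\<lambda>d. d\<^sup>2) (a * (a + 1) * (\<integral>z. (1 / B z)\<^sup>2 \<partial>M))"
    by (intro has_bochner_integral_nn_integral sq)
      (use a in \<open>auto intro!: integral_nonneg_AE mult_nonneg_nonneg\<close>)
qed

lemma increment_moments:
  assumes B: "gamma_rate N L b0 lam del y \<in> borel_measurable (std_normals N)"
    and M: "prob_space (std_normals N)"
    and a0: "a0 > 0" and b0: "b0 > 0"
  defines "a \<equiv> a0 + real N / 2" and "B \<equiv> gamma_rate N L b0 lam del y"
  shows "increment_mean N L a0 b0 lam y del = a * (\<integral>z. 1 / B z \<partial>std_normals N) - del"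
    and "increment_var N L a0 b0 lam y del
      = a * (a + 1) * (\<integral>z. (1 / B z)\<^sup>2 \<partial>std_normals N) - (a * (\<integral>z. 1 / B z \<partial>std_normals N))\<^sup>2"
proof -
  have a: "a > 0" using a0 by (simp add: a_def)
  have low: "B z \<ge> b0" for z by (simp add: B_def gamma_rate_def)
  let ?K = "delta_kernel N L a0 b0 lam y del"
  have K: "?K = std_normals N \<bind> (\<lambda>z. gamma_distr a (B z))"
    by (simp add: delta_kernel_def a_def B_def)
  note m = gamma_mixture_moments[OF M B[folded B_def] a b0 low, folded K]
  interpret K: prob_space ?K by (rule m(1))
  have i: "integrable ?K (\<lambda>d. d)" "integrable ?K (\<lambda>d. d\<^sup>2)"
    and e: "K.expectation (\<lambda>d. d) = a * (\<integral>z. 1 / B z \<partial>std_normals N)"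
      "K.expectation (\<lambda>d. d\<^sup>2) = a * (a + 1) * (\<integral>z. (1 / B z)\<^sup>2 \<partial>std_normals N)"
    using m(2,3) by (auto simp: has_bochner_integral_iff)
  have mean: "K.expectation (\<lambda>d. d - del) = K.expectation (\<lambda>d. d) - del"
    using i by (simp add: K.prob_space)
  then show "increment_mean N L a0 b0 lam y del = a * (\<integral>z. 1 / B z \<partial>std_normals N) - del"
    by (simp add: increment_mean_def e)
  have "increment_var N L a0 b0 lam y del = K.variance (\<lambda>d. d)"
    unfolding increment_var_def mean by simp
  also have "\<dots> = K.expectation (\<lambda>d. d\<^sup>2) - (K.expectation (\<lambda>d. d))\<^sup>2"
    by (rule K.variance_eq) (use i in auto)
  finally show "increment_var N L a0 b0 lam y del
      = a * (a + 1) * (\<integral>z. (1 / B z)\<^sup>2 \<partial>std_normals N) - (a * (\<integral>z. 1 / B z \<partial>std_normals N))\<^sup>2"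
    by (simp add: e)
qed

section \<open>The increments of the chain\<close>

text \<open>By \<open>gamma_rate_representation\<close>, the remainder is a bounded constant plus a linear form minus half a
  sum of squares; the bound depends on the level only through the constants of (A1) and (A2).\<close>

lemma rate_remainder_moments:
  assumes L: "valid_level N L" and y: "y \<in> carrier_vec N" and N: "N \<ge> 1"
    and lam: "lam > 0" and del: "del > 0" and b0: "b0 > 0"
    and c1: "scaled_norm (scal L) (cov0_inv_sqrt L *\<^sub>v post_mean L lam del y) \<le> c1"
    and c2: "mat_trace (cov1_inv_sqrt L * fwd L * cov0 L * transpose_mat (fwd L) * cov1_inv_sqrt L) \<le> c2"
  defines "F \<equiv> rate_remainder N L b0 lam y del"
  shows "F \<in> borel_measurable (std_normals N)"
    and "integrable (std_normals N) (\<lambda>z. F z ^ 8)"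
    and "(\<integral>z. F z ^ 8 \<partial>std_normals N) \<le> 3 ^ 8 * ((b0 + c1\<^sup>2 / 2) ^ 8
        + 2 * fact 8 * exp (1/2) * sqrt (c1\<^sup>2 / del + 1) ^ 8
        + 2 * fact (2 * 8) * exp (1/2) * (lam * c2 / del\<^sup>2 + 1) ^ 8)"
    and "gamma_rate N L b0 lam del y z = real N / (2 * del) + (\<Sum>j<N. ((z j)\<^sup>2 - 1)) / (2 * del) + F z"
proof -
  obtain \<kappa> b d where k: "0 \<le> \<kappa>" "\<kappa> \<le> c1\<^sup>2 / 2" and b: "(\<Sum>j<N. (b j)\<^sup>2) \<le> c1\<^sup>2 / del"
    and d: "(\<Sum>i<N. \<Sum>j<N. (d i j)\<^sup>2) \<le> lam * c2 / del\<^sup>2"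
    and rate: "\<And>z b0. gamma_rate N L b0 lam del y z = b0 + \<kappa> + (\<Sum>j<N. b j * z j)
       + 1 / (2 * del) * (\<Sum>j<N. (z j)\<^sup>2) - 1/2 * (\<Sum>i<N. (\<Sum>j<N. d i j * z j)\<^sup>2)"
    by (rule gamma_rate_representation[OF L y lam del c1 c2]) blast
  have Wd: "sqrt (real N / 2) * W1 N z = (\<Sum>j<N. ((z j)\<^sup>2 - 1)) / 2" for z
  proof -
    have "sqrt (real N / 2) * (1 / sqrt (2 * real N)) = 1 / 2"
      using N by (simp add: real_sqrt_divide real_sqrt_mult field_simps)
    then show ?thesis unfolding W1_def mult.assoc[symmetric] by simp
  qed
  have split: "F z = gamma_rate N L b0 lam del y z - (real N / (2 * del) + (\<Sum>j<N. ((z j)\<^sup>2 - 1)) / (2 * del))" for z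
    unfolding F_def rate_remainder_def mult.assoc Wd by simp
  then show "gamma_rate N L b0 lam del y z = real N / (2 * del) + (\<Sum>j<N. ((z j)\<^sup>2 - 1)) / (2 * del) + F z"
    by simp
  define l where "l = (\<lambda>z :: nat \<Rightarrow> real. \<Sum>j<N. b j * z j)"
  define G where "G = (\<lambda>z :: nat \<Rightarrow> real. \<Sum>i<N. (\<Sum>j<N. d i j * z j)\<^sup>2)"
  have F: "F z = b0 + \<kappa> + l z - 1/2 * G z" for z
    unfolding split rate l_def G_def
    by (simp add: sum_subtractf diff_divide_distrib add_divide_distrib)
  have [measurable]: "l \<in> borel_measurable (std_normals N)" "G \<in> borel_measurable (std_normals N)"
    unfolding l_def G_def by measurable
  show Fm: "F \<in> borel_measurable (std_normals N)" unfolding F[abs_def] by measurable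
  interpret prob_space "std_normals N" by (rule std_normals_prob)
  have bpos: "c1\<^sup>2 / del + 1 > 0" using del by (simp add: add_nonneg_pos)
  have l: "integrable (std_normals N) (\<lambda>z. l z ^ 8)"
      "expectation (\<lambda>z. l z ^ 8) \<le> 2 * fact 8 * exp (1/2) * sqrt (c1\<^sup>2 / del + 1) ^ 8"
    unfolding l_def by (rule linear_form_moment; use b bpos in simp)+
  have G: "integrable (std_normals N) (\<lambda>z. G z ^ 8)"
      "expectation (\<lambda>z. G z ^ 8) \<le> 2 * fact (2 * 8) * exp (1/2) * (lam * c2 / del\<^sup>2 + 1) ^ 8"
    unfolding G_def by (rule square_sum_moment[OF N d]; simp)+
  have bd: "F z ^ 8 \<le> 3 ^ 8 * ((b0 + c1\<^sup>2 / 2) ^ 8 + l z ^ 8 + G z ^ 8)" for z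
  proof -
    define m where "m = max (b0 + c1\<^sup>2 / 2) (max \<bar>l z\<bar> \<bar>G z\<bar>)"
    have "\<bar>b0 + \<kappa>\<bar> \<le> m" "\<bar>l z\<bar> \<le> m" "\<bar>G z\<bar> \<le> m" using k b0 by (auto simp: m_def)
    then have "\<bar>F z\<bar> \<le> 3 * m" unfolding F by linarith
    then have "\<bar>F z\<bar> ^ 8 \<le> (3 * m) ^ 8" by (intro power_mono) auto
    also have "(3 * m) ^ 8 = 3 ^ 8 * m ^ 8" by (rule power_mult_distrib)
    also have "m ^ 8 \<le> (b0 + c1\<^sup>2 / 2) ^ 8 + \<bar>l z\<bar> ^ 8 + \<bar>G z\<bar> ^ 8"
      by (auto simp: m_def max_def zero_le_even_power)
    finally show ?thesis by (simp add: power_even_abs)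
  qed
  have iR: "integrable (std_normals N) (\<lambda>z. 3 ^ 8 * ((b0 + c1\<^sup>2 / 2) ^ 8 + l z ^ 8 + G z ^ 8))"
    using l G by simp
  show i8: "integrable (std_normals N) (\<lambda>z. F z ^ 8)"
    by (rule Bochner_Integration.integrable_bound[OF iR])
      (use Fm bd in \<open>auto simp: zero_le_even_power intro!: AE_I2 order_trans[OF bd]\<close>)
  have "expectation (\<lambda>z. F z ^ 8) \<le> expectation (\<lambda>z. 3 ^ 8 * ((b0 + c1\<^sup>2 / 2) ^ 8 + l z ^ 8 + G z ^ 8))"
    by (rule integral_mono[OF i8 iR bd])
  also have "\<dots> = 3 ^ 8 * ((b0 + c1\<^sup>2 / 2) ^ 8 + expectation (\<lambda>z. l z ^ 8) + expectation (\<lambda>z. G z ^ 8))"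
    using l G by (simp add: prob_space)
  also have "\<dots> \<le> 3 ^ 8 * ((b0 + c1\<^sup>2 / 2) ^ 8
        + 2 * fact 8 * exp (1/2) * sqrt (c1\<^sup>2 / del + 1) ^ 8
        + 2 * fact (2 * 8) * exp (1/2) * (lam * c2 / del\<^sup>2 + 1) ^ 8)"
    by (intro mult_left_mono add_mono order_refl l G) simp
  finally show "expectation (\<lambda>z. F z ^ 8) \<le> 3 ^ 8 * ((b0 + c1\<^sup>2 / 2) ^ 8
        + 2 * fact 8 * exp (1/2) * sqrt (c1\<^sup>2 / del + 1) ^ 8
        + 2 * fact (2 * 8) * exp (1/2) * (lam * c2 / del\<^sup>2 + 1) ^ 8)" .
qed

text \<open>The quantitative form of the theorem at a single level: the constant depends on the level and the data
  only through the bounds in (A1) and (A2), so it is uniform in \<open>N\<close>.\<close>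

lemma uniform_increment_bounds:
  fixes \<delta> lam a0 b0 c1 c2 :: real
  assumes lam: "lam > 0" and \<delta>: "\<delta> > 0" and a0: "a0 > 0" and b0: "b0 > 0"
  obtains C where "\<And>N L y. N \<ge> 1 \<Longrightarrow> valid_level N L \<Longrightarrow> y \<in> carrier_vec N \<Longrightarrow>
      scaled_norm (scal L) (cov0_inv_sqrt L *\<^sub>v post_mean L lam \<delta> y) \<le> c1 \<Longrightarrow>
      mat_trace (cov1_inv_sqrt L * fwd L * cov0 L * transpose_mat (fwd L) * cov1_inv_sqrt L) \<le> c2 \<Longrightarrow>
      \<bar>mean_remainder N L b0 lam y \<delta>\<bar> \<le> C \<and>
      \<bar>real N / 2 * increment_mean N L a0 b0 lam y \<delta>
         - ((a0 + 1) * \<delta> - mean_remainder N L b0 lam y \<delta> * \<delta>\<^sup>2)\<bar> \<le> C * real N powr (- 1/2) \<and>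
      \<bar>real N / 2 * increment_var N L a0 b0 lam y \<delta> - 2 * \<delta>\<^sup>2\<bar> \<le> C * real N powr (- 1/2)"
proof -
  define CF where "CF = 3 ^ 8 * ((b0 + c1\<^sup>2 / 2) ^ 8
        + 2 * fact 8 * exp (1/2) * sqrt (c1\<^sup>2 / \<delta> + 1) ^ 8
        + 2 * fact (2 * 8) * exp (1/2) * (lam * c2 / \<delta>\<^sup>2 + 1) ^ 8)"
  define CY where "CY = (2 * fact 8 * exp (1/4) * 4 ^ 8 :: real)"
  define c where "c = 2 * \<delta> * b0"
  have c: "c > 0" using \<delta> b0 by (simp add: c_def)
  define A where "A = (56 + 4 / c + 128 / c\<^sup>2) * (1 + 256 * (CY + (2 * \<delta>) ^ 8 * CF))
      + 3 * (2 * \<delta> * (3 + CF) + 4 * \<delta>\<^sup>2 * (1 + CF))"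
  define C1 where "C1 = \<delta> * (A + a0 * (2 + 2 * \<delta> * (1 + CF)) + a0 * A)"
  define P where "P = 2 + 2 * \<delta> * (1 + CF)"
  define G where "G = 1 + 2 * a0"
  define C2 where "C2 = \<delta>\<^sup>2 * (2 * a0 * (3 + 2 * a0) + G * (G * (3 * A + P\<^sup>2 + A\<^sup>2 + 2 * P * A) + 2 + 2 * P + A))"
  define C where "C = (1 + CF) + \<bar>C1\<bar> + \<bar>C2\<bar>"
  show thesis
  proof (rule that[of C])
    fix N :: nat and L :: level and y :: "real vec"
    assume N: "N \<ge> 1" and L: "valid_level N L" and y: "y \<in> carrier_vec N"
      and c1: "scaled_norm (scal L) (cov0_inv_sqrt L *\<^sub>v post_mean L lam \<delta> y) \<le> c1"
      and c2: "mat_trace (cov1_inv_sqrt L * fwd L * cov0 L * transpose_mat (fwd L) * cov1_inv_sqrt L) \<le> c2"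
    let ?M = "std_normals N"
    interpret prob_space ?M by (rule std_normals_prob)
    define F where "F = rate_remainder N L b0 lam y \<delta>"
    define B where "B = gamma_rate N L b0 lam \<delta> y"
    note rem = rate_remainder_moments[OF L y N lam \<delta> b0 c1 c2, folded F_def CF_def B_def]
    define S where "S = (\<lambda>z :: nat \<Rightarrow> real. \<Sum>j<N. ((z j)\<^sup>2 - 1))"
    \<comment> \<open>In these units the rate is \<open>(1 + h (Y + 2 \<delta> h F)) / (2 \<delta> h\<^sup>2)\<close>.\<close>
    define h where "h = 1 / sqrt (real N)"
    have h: "0 < h" "h \<le> 1" using N by (auto simp: h_def)
    have hN: "h\<^sup>2 = 1 / real N" using N by (simp add: h_def power_divide)
    then have Nh: "real N = 1 / h\<^sup>2" by simp
    have hp: "real N powr (- 1/2) = h"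
      using N by (simp add: h_def powr_minus_divide powr_half_sqrt)
    define Y where "Y = (\<lambda>z. h * S z)"
    have Sm [measurable]: "S \<in> borel_measurable ?M" unfolding S_def by measurable
    have Ym: "Y \<in> borel_measurable ?M" unfolding Y_def by measurable
    have Y1: "has_bochner_integral ?M Y 0"
      using has_bochner_integral_mult_right[OF centred_chi_square_mean[of N], of h] by (simp add: Y_def S_def)
    have Y2: "has_bochner_integral ?M (\<lambda>z. (Y z)\<^sup>2) 2"
      using has_bochner_integral_mult_right[OF centred_chi_square_variance[of N], of "h\<^sup>2"] N
      by (simp add: Y_def S_def power_mult_distrib hN)
    have Y8: "integrable ?M (\<lambda>z. Y z ^ 8)" "expectation (\<lambda>z. Y z ^ 8) \<le> CY"
    proof -
      have S8: "integrable ?M (\<lambda>z. S z ^ 8)"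
          "expectation (\<lambda>z. S z ^ 8) \<le> 2 * fact 8 * exp (1/4) * (4 * sqrt N) ^ 8"
        unfolding S_def by (rule centred_chi_square_moment[OF N]; simp)+
      show "integrable ?M (\<lambda>z. Y z ^ 8)" using S8(1) by (simp add: Y_def power_mult_distrib)
      have "expectation (\<lambda>z. Y z ^ 8) = h ^ 8 * expectation (\<lambda>z. S z ^ 8)"
        by (simp add: Y_def power_mult_distrib)
      also have "\<dots> \<le> h ^ 8 * (2 * fact 8 * exp (1/4) * (4 * sqrt N) ^ 8)"
        using S8(2) h by (intro mult_left_mono) auto
      also have "\<dots> = CY * (h * sqrt N) ^ 8" by (simp add: CY_def power_mult_distrib)
      also have "h * sqrt N = 1" using N by (simp add: h_def)
      finally show "expectation (\<lambda>z. Y z ^ 8) \<le> CY" by simp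
    qed
    have B: "B z = (1 + h * (Y z + 2 * \<delta> * h * F z)) / (2 * \<delta> * h\<^sup>2)" for z
    proof -
      have "B z = 1 / h\<^sup>2 / (2 * \<delta>) + S z / (2 * \<delta>) + F z"
        using rem(4)[of z] by (simp add: S_def Nh)
      then show ?thesis using \<delta> h by (simp add: Y_def field_simps power2_eq_square)
    qed
    have Blow: "B z \<ge> b0" for z by (simp add: B_def gamma_rate_def)
    have dh: "2 * \<delta> * h\<^sup>2 > 0" using \<delta> h by simp
    have low: "1 + h * (Y z + 2 * \<delta> * h * F z) \<ge> c * h\<^sup>2" for z
    proof -
      have "1 + h * (Y z + 2 * \<delta> * h * F z) = 2 * \<delta> * h\<^sup>2 * B z" unfolding B using h \<delta> by simp
      also have "\<dots> \<ge> 2 * \<delta> * h\<^sup>2 * b0" using Blow dh by (intro mult_left_mono) auto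
      finally show ?thesis by (simp add: c_def mult_ac)
    qed
    define U where "U = (\<lambda>z. 1 / (1 + h * (Y z + 2 * \<delta> * h * F z)))"
    note ex = inverse_moment_expansion[OF Ym rem(1) h \<delta> c Y1 Y2 Y8 rem(2,3) low, folded A_def]
    define f where "f = expectation F"
    define eu where "eu = expectation U"
    define eu2 where "eu2 = expectation (\<lambda>z. (U z)\<^sup>2)"
    have f: "mean_remainder N L b0 lam y \<delta> = f" by (simp add: mean_remainder_def f_def F_def)
    have A0: "A \<ge> 0"
    proof -
      have "0 \<le> A * h ^ 3" using ex(2) by linarith
      then show ?thesis using h by (simp add: zero_le_mult_iff)
    qed
    have IB: "1 / B z = 2 * \<delta> * h\<^sup>2 * U z" for z unfolding B U_def by simp
    have e1: "expectation (\<lambda>z. 1 / B z) = 2 * \<delta> * h\<^sup>2 * eu"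
      unfolding IB eu_def by simp
    have e2: "expectation (\<lambda>z. (1 / B z)\<^sup>2) = (2 * \<delta> * h\<^sup>2)\<^sup>2 * eu2"
      unfolding IB eu2_def power_mult_distrib[of _ "U _"] by simp
    have Bm: "gamma_rate N L b0 lam \<delta> y \<in> borel_measurable ?M"
    proof -
      have "B \<in> borel_measurable ?M" unfolding B[abs_def] using Ym rem(1) by measurable
      then show ?thesis by (simp add: B_def)
    qed
    note inc = increment_moments[OF Bm std_normals_prob a0 b0, folded B_def, unfolded e1 e2]
    define g where "g = 1 + 2 * a0 * h\<^sup>2"
    define a where "a = a0 + real N / 2"
    have ag: "a * (2 * h\<^sup>2) = g" and ag1: "(a + 1) * (2 * h\<^sup>2) = g + 2 * h\<^sup>2"
      using h by (simp_all add: a_def g_def Nh field_simps)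
    have m: "real N / 2 * increment_mean N L a0 b0 lam y \<delta> = (\<delta> * g * eu - \<delta>) / (2 * h\<^sup>2)"
    proof -
      have "a * (2 * \<delta> * h\<^sup>2 * eu) = \<delta> * (a * (2 * h\<^sup>2)) * eu" by (simp only: mult_ac)
      then have e: "a * (2 * \<delta> * h\<^sup>2 * eu) = \<delta> * g * eu" by (simp only: ag)
      show ?thesis unfolding inc(1) a_def[symmetric] e by (simp add: Nh)
    qed
    have v: "real N / 2 * increment_var N L a0 b0 lam y \<delta>
        = \<delta>\<^sup>2 * (g * (g + 2 * h\<^sup>2) * eu2 - (g * eu)\<^sup>2) / (2 * h\<^sup>2)"
    proof -
      have "a * (2 * \<delta> * h\<^sup>2 * eu) = \<delta> * ((a * (2 * h\<^sup>2)) * eu)" by (simp only: mult_ac)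
      then have e: "a * (2 * \<delta> * h\<^sup>2 * eu) = \<delta> * (g * eu)" by (simp only: ag)
      have "a * (a + 1) * ((2 * \<delta> * h\<^sup>2)\<^sup>2 * eu2)
          = \<delta>\<^sup>2 * ((a * (2 * h\<^sup>2)) * ((a + 1) * (2 * h\<^sup>2)) * eu2)"
        by (simp only: power2_eq_square mult_ac)
      then have e': "a * (a + 1) * ((2 * \<delta> * h\<^sup>2)\<^sup>2 * eu2) = \<delta>\<^sup>2 * (g * (g + 2 * h\<^sup>2) * eu2)"
        by (simp only: ag ag1)
      show ?thesis
        unfolding inc(2) a_def[symmetric] e e' power_mult_distrib[of \<delta>] right_diff_distrib[symmetric]
        by (simp add: Nh)
    qed
    have Cf: "\<bar>f\<bar> \<le> 1 + CF" using ex(1) by (simp add: f_def)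
    have r1: "\<bar>eu - (1 - 2 * \<delta> * f * h\<^sup>2 + 2 * h\<^sup>2)\<bar> \<le> A * h ^ 3"
      unfolding eu_def U_def f_def by (rule ex(2))
    have r2: "\<bar>eu2 - (1 - 4 * \<delta> * f * h\<^sup>2 + 6 * h\<^sup>2)\<bar> \<le> A * h ^ 3"
      unfolding eu2_def U_def f_def by (rule ex(3))
    have "\<bar>real N / 2 * increment_mean N L a0 b0 lam y \<delta> - ((a0 + 1) * \<delta> - f * \<delta>\<^sup>2)\<bar> \<le> C1 * h"
      unfolding m g_def C1_def by (rule gamma_mean_expansion[OF h \<delta> a0 A0 r1 Cf])
    moreover have "\<bar>real N / 2 * increment_var N L a0 b0 lam y \<delta> - 2 * \<delta>\<^sup>2\<bar> \<le> C2 * h"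
      unfolding v g_def C2_def P_def G_def by (rule gamma_variance_expansion[OF h \<delta> a0 A0 r1 r2 Cf])
    moreover have "C1 * h \<le> C * h" "C2 * h \<le> C * h" "1 + CF \<le> C"
      using h Cf by (auto intro!: mult_right_mono simp: C_def)
    ultimately show "\<bar>mean_remainder N L b0 lam y \<delta>\<bar> \<le> C \<and>
      \<bar>real N / 2 * increment_mean N L a0 b0 lam y \<delta>
         - ((a0 + 1) * \<delta> - mean_remainder N L b0 lam y \<delta> * \<delta>\<^sup>2)\<bar> \<le> C * real N powr (- 1/2) \<and>
      \<bar>real N / 2 * increment_var N L a0 b0 lam y \<delta> - 2 * \<delta>\<^sup>2\<bar> \<le> C * real N powr (- 1/2)"
      unfolding f hp using Cf by linarith
  qed
qed

theorem theorem3p4: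
  fixes D :: "'w measure"
    and y :: "nat \<Rightarrow> 'w \<Rightarrow> real vec"
    and L :: "nat \<Rightarrow> level"
    and \<alpha>\<^sub>0 \<beta>\<^sub>0 lam :: real
  assumes "prob_space D"
    and "\<And>N \<omega>. N \<ge> 1 \<Longrightarrow> \<omega> \<in> space D \<Longrightarrow> y N \<omega> \<in> carrier_vec N"
    and "\<And>N. N \<ge> 1 \<Longrightarrow> valid_level N (L N)"
    and "\<alpha>\<^sub>0 > 0" and "\<beta>\<^sub>0 > 0" and "lam > 0"
    and "assumption_A1 D L y"
    and "assumption_A2 L"
  shows "AE \<omega> in D.
    (\<forall>\<delta>>0.
       (\<lambda>N. real N / 2 * increment_mean N (L N) \<alpha>\<^sub>0 \<beta>\<^sub>0 lam (y N \<omega>) \<delta>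
              - ((\<alpha>\<^sub>0 + 1) * \<delta> - mean_remainder N (L N) \<beta>\<^sub>0 lam (y N \<omega>) \<delta> * \<delta>\<^sup>2))
         \<in> O(\<lambda>N. real N powr (- 1/2))
       \<and> (\<exists>c. \<forall>N\<ge>1. \<bar>mean_remainder N (L N) \<beta>\<^sub>0 lam (y N \<omega>) \<delta>\<bar> \<le> c)
       \<and> (\<forall>f::real.
            (\<lambda>N. mean_remainder N (L N) \<beta>\<^sub>0 lam (y N \<omega>) \<delta>) \<longlonglongrightarrow> f \<longrightarrow>
            (\<lambda>N. real N / 2 * increment_mean N (L N) \<alpha>\<^sub>0 \<beta>\<^sub>0 lam (y N \<omega>) \<delta>
                   - ((\<alpha>\<^sub>0 + 1) * \<delta> - f * \<delta>\<^sup>2))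
              \<in> o(\<lambda>N. 1)))
    \<and> (\<forall>\<delta>>0.
         (\<lambda>N. real N / 2 * increment_var N (L N) \<alpha>\<^sub>0 \<beta>\<^sub>0 lam (y N \<omega>) \<delta> - 2 * \<delta>\<^sup>2)
           \<in> O(\<lambda>N. real N powr (- 1/2)))"
proof -
  note valid = assms(3) and pos = assms(4-6)
  obtain c2 where c2: "\<And>N. N \<ge> 1 \<Longrightarrow> mat_trace (cov1_inv_sqrt (L N) * fwd (L N) * cov0 (L N)
      * transpose_mat (fwd (L N)) * cov1_inv_sqrt (L N)) \<le> c2"
    using assms(8) unfolding assumption_A2_def by blast
  have "AE \<omega> in D. \<forall>lam>0. \<forall>del>0. \<exists>c1\<ge>0. \<forall>N\<ge>1.
      scaled_norm (scal (L N)) (cov0_inv_sqrt (L N) *\<^sub>v post_mean (L N) lam del (y N \<omega>)) \<le> c1"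
    using assms(7) unfolding assumption_A1_def .
  then show ?thesis
    using AE_space
  proof eventually_elim
    case (elim \<omega>)
    let ?f = "\<lambda>\<delta> N. mean_remainder N (L N) \<beta>\<^sub>0 lam (y N \<omega>) \<delta>"
    let ?m = "\<lambda>\<delta> N. real N / 2 * increment_mean N (L N) \<alpha>\<^sub>0 \<beta>\<^sub>0 lam (y N \<omega>) \<delta>"
    let ?v = "\<lambda>\<delta> N. real N / 2 * increment_var N (L N) \<alpha>\<^sub>0 \<beta>\<^sub>0 lam (y N \<omega>) \<delta>"
    have yc: "y N \<omega> \<in> carrier_vec N" if "N \<ge> 1" for N using assms(2)[OF that elim(2)] .
    have main: "\<exists>C. \<forall>N\<ge>1. \<bar>?f \<delta> N\<bar> \<le> C
        \<and> \<bar>?m \<delta> N - ((\<alpha>\<^sub>0 + 1) * \<delta> - ?f \<delta> N * \<delta>\<^sup>2)\<bar> \<le> C * real N powr (- 1/2)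
        \<and> \<bar>?v \<delta> N - 2 * \<delta>\<^sup>2\<bar> \<le> C * real N powr (- 1/2)" if \<delta>: "\<delta> > 0" for \<delta>
    proof -
      obtain c1 where c1: "\<And>N. N \<ge> 1 \<Longrightarrow> scaled_norm (scal (L N))
          (cov0_inv_sqrt (L N) *\<^sub>v post_mean (L N) lam \<delta> (y N \<omega>)) \<le> c1"
        using elim(1) pos(3) \<delta> by blast
      obtain C where C: "\<And>N L y. N \<ge> 1 \<Longrightarrow> valid_level N L \<Longrightarrow> y \<in> carrier_vec N \<Longrightarrow>
          scaled_norm (scal L) (cov0_inv_sqrt L *\<^sub>v post_mean L lam \<delta> y) \<le> c1 \<Longrightarrow>
          mat_trace (cov1_inv_sqrt L * fwd L * cov0 L * transpose_mat (fwd L) * cov1_inv_sqrt L) \<le> c2 \<Longrightarrow>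
          \<bar>mean_remainder N L \<beta>\<^sub>0 lam y \<delta>\<bar> \<le> C \<and>
          \<bar>real N / 2 * increment_mean N L \<alpha>\<^sub>0 \<beta>\<^sub>0 lam y \<delta>
             - ((\<alpha>\<^sub>0 + 1) * \<delta> - mean_remainder N L \<beta>\<^sub>0 lam y \<delta> * \<delta>\<^sup>2)\<bar> \<le> C * real N powr (- 1/2) \<and>
          \<bar>real N / 2 * increment_var N L \<alpha>\<^sub>0 \<beta>\<^sub>0 lam y \<delta> - 2 * \<delta>\<^sup>2\<bar> \<le> C * real N powr (- 1/2)"
        using uniform_increment_bounds[OF pos(3) \<delta> pos(1,2)] by blast
      show ?thesis
      proof (intro exI[of _ C] allI impI)
        fix N :: nat assume N: "N \<ge> 1"
        show "\<bar>?f \<delta> N\<bar> \<le> C \<and> \<bar>?m \<delta> N - ((\<alpha>\<^sub>0 + 1) * \<delta> - ?f \<delta> N * \<delta>\<^sup>2)\<bar> \<le> C * real N powr (- 1/2)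
            \<and> \<bar>?v \<delta> N - 2 * \<delta>\<^sup>2\<bar> \<le> C * real N powr (- 1/2)"
          by (rule C[OF N valid[OF N] yc[OF N] c1[OF N] c2[OF N]])
      qed
    qed
    have bigo: "g \<in> O(\<lambda>N. real N powr (- 1/2))"
      if "\<And>N. N \<ge> 1 \<Longrightarrow> \<bar>g N\<bar> \<le> C * real N powr (- 1/2)" for g :: "nat \<Rightarrow> real" and C
      by (rule bigoI[of _ C]) (use that in \<open>auto intro: eventually_sequentiallyI[of 1]\<close>)
    have lim: "(\<lambda>N. ?m \<delta> N - ((\<alpha>\<^sub>0 + 1) * \<delta> - f * \<delta>\<^sup>2)) \<in> o(\<lambda>N. 1)"
      if \<delta>: "\<delta> > 0" and f: "?f \<delta> \<longlonglongrightarrow> f" for \<delta> f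
    proof -
      obtain C where C: "\<And>N. N \<ge> 1 \<Longrightarrow>
          \<bar>?m \<delta> N - ((\<alpha>\<^sub>0 + 1) * \<delta> - ?f \<delta> N * \<delta>\<^sup>2)\<bar> \<le> C * real N powr (- 1/2)"
        using main[OF \<delta>] by blast
      have ev: "\<forall>\<^sub>F N in sequentially.
          norm (?m \<delta> N - ((\<alpha>\<^sub>0 + 1) * \<delta> - ?f \<delta> N * \<delta>\<^sup>2)) \<le> C * real N powr (- 1/2)"
        unfolding real_norm_def by (rule eventually_sequentiallyI[of 1]) (rule C)
      have "(\<lambda>N. C * real N powr (- 1/2)) \<longlonglongrightarrow> C * 0"
        by (intro tendsto_mult_left tendsto_neg_powr filterlim_real_sequentially) simp
      then have "(\<lambda>N. ?m \<delta> N - ((\<alpha>\<^sub>0 + 1) * \<delta> - ?f \<delta> N * \<delta>\<^sup>2)) \<longlonglongrightarrow> 0"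
        by (intro Lim_null_comparison[OF ev]) simp
      then have "(\<lambda>N. (?m \<delta> N - ((\<alpha>\<^sub>0 + 1) * \<delta> - ?f \<delta> N * \<delta>\<^sup>2)) - (?f \<delta> N - f) * \<delta>\<^sup>2) \<longlonglongrightarrow> 0 - (f - f) * \<delta>\<^sup>2"
        by (intro tendsto_intros f)
      then have "(\<lambda>N. ?m \<delta> N - ((\<alpha>\<^sub>0 + 1) * \<delta> - f * \<delta>\<^sup>2)) \<longlonglongrightarrow> 0"
        by (simp add: algebra_simps)
      then show ?thesis by (intro smalloI_tendsto) auto
    qed
    show ?case
    proof (intro conjI allI impI)
      fix \<delta> :: real assume \<delta>: "\<delta> > 0"
      obtain C where C: "\<And>N. N \<ge> 1 \<Longrightarrow> \<bar>?f \<delta> N\<bar> \<le> C"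
          "\<And>N. N \<ge> 1 \<Longrightarrow> \<bar>?m \<delta> N - ((\<alpha>\<^sub>0 + 1) * \<delta> - ?f \<delta> N * \<delta>\<^sup>2)\<bar> \<le> C * real N powr (- 1/2)"
          "\<And>N. N \<ge> 1 \<Longrightarrow> \<bar>?v \<delta> N - 2 * \<delta>\<^sup>2\<bar> \<le> C * real N powr (- 1/2)"
        using main[OF \<delta>] by blast
      show "(\<lambda>N. ?m \<delta> N - ((\<alpha>\<^sub>0 + 1) * \<delta> - ?f \<delta> N * \<delta>\<^sup>2)) \<in> O(\<lambda>N. real N powr (- 1/2))"
        by (rule bigo[OF C(2)])
      show "\<exists>c. \<forall>N\<ge>1. \<bar>?f \<delta> N\<bar> \<le> c" using C(1) by blast
      show "(\<lambda>N. ?v \<delta> N - 2 * \<delta>\<^sup>2) \<in> O(\<lambda>N. real N powr (- 1/2))" by (rule bigo[OF C(3)])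
    next
      fix \<delta> f :: real assume "\<delta> > 0" "?f \<delta> \<longlonglongrightarrow> f"
      then show "(\<lambda>N. ?m \<delta> N - ((\<alpha>\<^sub>0 + 1) * \<delta> - f * \<delta>\<^sup>2)) \<in> o(\<lambda>N. 1)" by (rule lim)
    qed
  qed
qed

end
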